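(* Let $n\ge1$. The non-trivial symmetry classes of spanning trees of the odd Aztec diamond $OD_n$ not involving rotations are enumerated by $$\mathrm{t}_{\langle h\rangle}(OD_n)=\mathrm{M}(C_{2n-1})=\frac{1}{2^{2n}}\prod_{\substack{1\leq j\leq k\leq 2n-1\\ j+k\ \text{even}}}\left(4-2\cos\frac{j\pi}{2n}-2\cos\frac{k\pi}{2n}\right)$$ and $$\mathrm{t}_{\langle h,v\rangle}(OD_n)=\mathrm{M}(A_{n-1})=\frac{1}{2^{n-1}}\prod_{1\leq j\leq k\leq n-1}\left(4-2\cos\frac{j\pi}{n}-2\cos\frac{k\pi}{n}\right).$$
   Context: $OD_n$ is the graph whose vertices are the black unit squares of a $(2n+1)\times(2n+1)$ chessboard with black corners, two vertices being adjacent if the corresponding squares share a corner. It is drawn rotated by $45^\circ$ so that its edges are horizontal and vertical; in this drawing $OD_n$ is the subgraph of the grid $\mathbb{Z}^2$ induced by the points $(x,y)$ with $|x|+|y|\le n$. Let $h$ and $v$ be the reflections across the horizontal axis ($y=0$) and across the vertical axis ($x=0$) in this drawing. For a graph $G$ and a group $H$ of symmetries of $G$, $\mathrm{t}_H(G)$ is the number of spanning trees of $G$ invariant under $H$, and $\mathrm{M}(G)$ is the number of perfect matchings of $G$ (equal to $1$ for the empty graph). The following are induced subgraphs of the grid $\mathbb{Z}^2$. Let $NE(i,j)$ be the infinite zig-zag lattice path starting at $(i,j)$ and taking alternately two unit steps north and two unit steps east; $NW(i,j)$ is the analogous path alternating two steps north and two steps west. $A_n$ is induced by the points $(i,j)$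 with $0\le i,j\le 2n-1$ that are on or above $NE(1,0)$, i.e. the points with $0\le i\le 2n-1$ and $2\lfloor i/2\rfloor\le j\le 2n-1$. $C_n$ is induced by the points $(i,j)$ with $j\ge0$ that are on or below both $NE(-n+1,-1)$ and $NW(n-1,-1)$, i.e. the points with $j\ge0$ and $|i|\le n-1-2\lfloor j/2\rfloor$. Empty products equal $1$. *)

theory Defs
  imports Complex_Main "HOL-Algebra.Bij" "HOL-Algebra.Generated_Groups"
begin

text \<open>
  Finite simple undirected graphs are pairs of a vertex set and a set of two-element edges.
  The trees of the AFP entry Graph_Theory are not used: they are directed, and the cycles
  they forbid include the back-and-forth walk along a symmetric pair of arcs.
\<close>

type_synonym 'a ugraph = "'a set \<times> 'a set set"

abbreviation verts :: "'a ugraph \<Rightarrow> 'a set" where "verts G \<equiv> fst G"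
abbreviation edges :: "'a ugraph \<Rightarrow> 'a set set" where "edges G \<equiv> snd G"

definition connected_graph :: "'a ugraph \<Rightarrow> bool" where
  "connected_graph G \<longleftrightarrow> verts G \<noteq> {} \<and>
     (\<forall>u\<in>verts G. \<forall>w\<in>verts G. (u, w) \<in> {(a, b). {a, b} \<in> edges G}\<^sup>*)"

definition is_cycle :: "'a ugraph \<Rightarrow> 'a list \<Rightarrow> bool" where
  "is_cycle G c \<longleftrightarrow> 3 \<le> length c \<and> distinct c \<and> set c \<subseteq> verts G \<and>
     (\<forall>i < length c. {c ! i, c ! (Suc i mod length c)} \<in> edges G)"

definition is_tree :: "'a ugraph \<Rightarrow> bool" where
  "is_tree G \<longleftrightarrow> connected_graph G \<and> (\<nexists>c. is_cycle G c)"

text \<open>A spanning tree is identified with its set of edges.\<close>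

definition spanning_trees :: "'a ugraph \<Rightarrow> 'a set set set" where
  "spanning_trees G = {T. T \<subseteq> edges G \<and> is_tree (verts G, T)}"

definition perfect_matchings :: "'a ugraph \<Rightarrow> 'a set set set" where
  "perfect_matchings G = {X. X \<subseteq> edges G \<and> (\<forall>u\<in>verts G. \<exists>!e. e \<in> X \<and> u \<in> e)}"

definition num_matchings :: "'a ugraph \<Rightarrow> nat" where
  "num_matchings G = card (perfect_matchings G)"

definition invariant_under :: "('a \<Rightarrow> 'a) set \<Rightarrow> 'a set set \<Rightarrow> bool" where
  "invariant_under H T \<longleftrightarrow> (\<forall>g\<in>H. (\<lambda>e. g ` e) ` T = T)"

definition num_invariant_trees :: "('a \<Rightarrow> 'a) set \<Rightarrow> 'a ugraph \<Rightarrow> nat" where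
  "num_invariant_trees H G = card {T \<in> spanning_trees G. invariant_under H T}"

definition grid_adj :: "int \<times> int \<Rightarrow> int \<times> int \<Rightarrow> bool" where
  "grid_adj p q \<longleftrightarrow> \<bar>fst p - fst q\<bar> + \<bar>snd p - snd q\<bar> = 1"

definition grid_graph :: "(int \<times> int) set \<Rightarrow> (int \<times> int) ugraph" where
  "grid_graph V = (V, {{p, q} |p q. p \<in> V \<and> q \<in> V \<and> grid_adj p q})"

definition odd_diamond :: "nat \<Rightarrow> (int \<times> int) ugraph" where
  "odd_diamond n = grid_graph {(x, y). \<bar>x\<bar> + \<bar>y\<bar> \<le> int n}"

text \<open>
  On a chessboard with corner square \<open>(0, 0)\<close> black, the black squares are those with even
  coordinate sum. The map \<open>rot45\<close> (a rotation by 45 degrees composed with a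
  scaling and a translation) identifies the chessboard graph with \<open>odd_diamond\<close>.
\<close>

definition chessboard_graph :: "nat \<Rightarrow> (int \<times> int) ugraph" where
  "chessboard_graph n =
     (let V = {(a, b). 0 \<le> a \<and> a \<le> 2 * int n \<and> 0 \<le> b \<and> b \<le> 2 * int n \<and> even (a + b)}
      in (V, {{p, q} |p q. p \<in> V \<and> q \<in> V \<and>
                \<bar>fst p - fst q\<bar> = 1 \<and> \<bar>snd p - snd q\<bar> = 1}))"

definition rot45 :: "nat \<Rightarrow> int \<times> int \<Rightarrow> int \<times> int" where
  "rot45 n = (\<lambda>(a, b). ((a + b) div 2 - int n, (b - a) div 2))"

lemma rot45_bij: "bij_betw (rot45 n) (verts (chessboard_graph n)) (verts (odd_diamond n))"
proof (rule bij_betw_byWitness[where f' = "\<lambda>(x, y). (x - y + int n, x + y + int n)"])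
  have "(case rot45 n p of (x, y) \<Rightarrow> (x - y + int n, x + y + int n)) = p \<and>
        rot45 n p \<in> verts (odd_diamond n)" if p: "p \<in> verts (chessboard_graph n)" for p
  proof -
    obtain a b where ab: "p = (a, b)" by fastforce
    from p ab have bnds: "0 \<le> a" "a \<le> 2 * int n" "0 \<le> b" "b \<le> 2 * int n" "even (a + b)"
      by (auto simp: chessboard_graph_def Let_def)
    from bnds(5) obtain s where "a + b = 2 * s" by (elim evenE)
    then have b: "b = 2 * s - a" by simp
    have d: "(b - a) div 2 = s - a" and e: "(a + b) div 2 = s" using b by simp_all
    show ?thesis
      using bnds unfolding ab rot45_def odd_diamond_def grid_graph_def prod.case d e
      by (auto simp: b)
  qed
  then show "\<forall>p\<in>verts (chessboard_graph n).
      (case rot45 n p of (x, y) \<Rightarrow> (x - y + int n, x + y + int n)) = p"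
    and "rot45 n ` verts (chessboard_graph n) \<subseteq> verts (odd_diamond n)" by blast+
qed (auto simp: chessboard_graph_def odd_diamond_def grid_graph_def rot45_def Let_def)

lemma rot45_adj:
  assumes "p \<in> verts (chessboard_graph n)" "q \<in> verts (chessboard_graph n)"
  shows "grid_adj (rot45 n p) (rot45 n q) \<longleftrightarrow>
           \<bar>fst p - fst q\<bar> = 1 \<and> \<bar>snd p - snd q\<bar> = 1"
proof -
  obtain a b c d where pq: "p = (a, b)" "q = (c, d)" by fastforce
  from assms pq have "even (a + b)" "even (c + d)"
    by (auto simp: chessboard_graph_def Let_def)
  then obtain s t where "a + b = 2 * s" "c + d = 2 * t" by (elim evenE)
  then have b: "b = 2 * s - a" and d: "d = 2 * t - c" by simp_all
  have divs: "(b - a) div 2 = s - a" "(a + b) div 2 = s" "(d - c) div 2 = t - c" "(c + d) div 2 = t"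
    using b d by simp_all
  have "\<bar>s - t\<bar> + \<bar>(s - a) - (t - c)\<bar> = 1 \<longleftrightarrow> \<bar>a - c\<bar> = 1 \<and> \<bar>b - d\<bar> = 1"
    unfolding b d by arith
  then show ?thesis by (simp add: pq grid_adj_def rot45_def divs)
qed

definition aztec_A :: "nat \<Rightarrow> (int \<times> int) ugraph" where
  "aztec_A n = grid_graph
     {(i, j). 0 \<le> i \<and> i \<le> 2 * int n - 1 \<and> 2 * (i div 2) \<le> j \<and> j \<le> 2 * int n - 1}"

definition aztec_C :: "nat \<Rightarrow> (int \<times> int) ugraph" where
  "aztec_C n = grid_graph {(i, j). 0 \<le> j \<and> \<bar>i\<bar> \<le> int n - 1 - 2 * (j div 2)}"

definition refl_h :: "int \<times> int \<Rightarrow> int \<times> int" where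
  "refl_h = (\<lambda>(x, y). (x, - y))"

definition refl_v :: "int \<times> int \<Rightarrow> int \<times> int" where
  "refl_v = (\<lambda>(x, y). (- x, y))"

text \<open>The group generated by \<open>S\<close> in the group of all permutations of \<open>\<int>\<^sup>2\<close>.\<close>

abbreviation sym_gen :: "(int \<times> int \<Rightarrow> int \<times> int) set \<Rightarrow> (int \<times> int \<Rightarrow> int \<times> int) set" where
  "sym_gen S \<equiv> generate (BijGroup UNIV) S"

lemma refl_in_BijGroup:
  "refl_h \<in> carrier (BijGroup UNIV)" "refl_v \<in> carrier (BijGroup UNIV)"
proof -
  have "bij refl_h" by (rule involuntory_imp_bij) (auto simp: refl_h_def)
  moreover have "bij refl_v" by (rule involuntory_imp_bij) (auto simp: refl_v_def)
  ultimately show "refl_h \<in> carrier (BijGroup UNIV)" "refl_v \<in> carrier (BijGroup UNIV)"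
    by (auto simp: BijGroup_def Bij_def)
qed

end

theory Submission
  imports Defs "HOL-Library.Product_Plus" "Jordan_Normal_Form.Determinant"
begin

text \<open>
  In a spanning tree invariant under a reflection, the path between two points of its axis is fixed
  pointwise, so the tree contains the whole axis. Contracting the axes to a root, invariant trees become
  rooted spanning forests of a half or a quarter of the diamond. Temperley's bijection matches these
  with the perfect matchings of \<open>C\<close> and \<open>A\<close>, and the matrix-tree theorem counts them by a
  determinant. The Laplacian of the half or the quarter is, up to the factors 2 and 4 on its free
  boundary, the Dirichlet Laplacian of a square on the functions symmetric in one or both diagonals,
  and is diagonalised there by products of sines.
\<close>

text \<open>The powers of two in the formulas are products of boundary factors. On a free side two
  of the four lattice neighbours are missing and are mirror images of the two that remain, so
  doubling the row restores the full Laplacian; at the apex of the half three are missing and the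
  factor is 4. The quarter has n - 1 free points, the half 2n - 2 and the apex. Scaling rows
  destroys symmetry in general, so orthogonality is taken from the whole square, and folding the
  square onto the region turns it into an explicit left inverse. That j + k be even selects the
  modes symmetric in both diagonals. Planarity is the obstacle in Temperley's bijection. Two facts
  are required: a matching never closes up a cycle of vertices, and every face reaches the outer
  face without crossing the forest. The first comes from counting crossings modulo 2 and an infinite
  descent that alternates between vertices and faces, the second from the even degree of a boundary.
  The Jordan curve theorem and Euler's formula are avoided; the balance of edges against vertices
  and faces is read off a tiling by vertical dominoes.\<close>

section \<open>Escaping maps\<close>

text \<open>Everything outside \<open>V\<close> acts as one contracted root, so that the choice functions \<open>v \<mapsto> f v\<close>
  whose walks all leave \<open>V\<close> encode the spanning trees rooted there.\<close>

definition escapes :: "'a set \<Rightarrow> ('a \<Rightarrow> 'a) \<Rightarrow> bool" where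
  "escapes V g \<longleftrightarrow> (\<forall>v\<in>V. \<exists>k. (g ^^ k) v \<notin> V)"

definition escaping_choices :: "'a set \<Rightarrow> ('a \<Rightarrow> 'c set) \<Rightarrow> ('a \<Rightarrow> 'c \<Rightarrow> 'a) \<Rightarrow> ('a \<Rightarrow> 'c) set" where
  "escaping_choices V C nxt = {f \<in> Pi\<^sub>E V C. escapes V (\<lambda>v. nxt v (f v))}"

text \<open>Together with its converse \<open>escapesI_closed\<close> this trades walks for closed
  sets: most escape arguments below exhibit a set that the map sends into itself.\<close>

lemma escapes_no_closed:
  assumes "escapes V g" "A \<subseteq> V" "g ` A \<subseteq> A"
  shows "A = {}"
proof (rule ccontr)
  assume "A \<noteq> {}"
  then obtain a where a: "a \<in> A" by blast
  have "(g ^^ k) a \<in> A" for k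
    by (induction k) (use a assms(3) in auto)
  with assms(1,2) a show False unfolding escapes_def by blast
qed

lemma escapesI_closed:
  assumes "\<And>A. A \<subseteq> V \<Longrightarrow> A \<noteq> {} \<Longrightarrow> g ` A \<subseteq> A \<Longrightarrow> False"
  shows "escapes V g"
  unfolding escapes_def
proof (rule ballI, rule ccontr)
  fix v assume v: "v \<in> V" "\<nexists>k. (g ^^ k) v \<notin> V"
  let ?A = "range (\<lambda>k. (g ^^ k) v)"
  have "g ((g ^^ k) v) \<in> ?A" for k
    by (rule range_eqI[of _ _ "Suc k"]) simp
  then have "g ` ?A \<subseteq> ?A" by blast
  with assms[of ?A] v show False by blast
qed

text \<open>A map cannot enlarge a finite set, so a set covered by its image is mapped onto itself
  and is closed. This allows acyclicity to be contradicted by following predecessors.\<close>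

lemma escapes_no_covered:
  assumes "escapes V g" "finite A" "A \<subseteq> V" "A \<subseteq> g ` A"
  shows "A = {}"
proof -
  have "card (g ` A) \<le> card A" using assms(2) by (rule card_image_le)
  then have "g ` A = A"
    using assms(2,4) by (metis card_seteq finite_imageI)
  with assms escapes_no_closed show ?thesis by blast
qed

lemma escapes_fixpoint:
  assumes "escapes V g" "v \<in> V" shows "g v \<noteq> v"
  using escapes_no_closed[OF assms(1), of "{v}"] assms(2) by auto

lemma escapes_no_2cycle:
  assumes "escapes V g" "v \<in> V" "g v \<in> V" shows "g (g v) \<noteq> v"
  using escapes_no_closed[OF assms(1), of "{v, g v}"] assms(2,3) by auto

text \<open>Transports forests along a change of coordinates. \<open>h\<close> is injective on the
  whole type because walks also visit points outside \<open>V\<close>, and these have to land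
  outside \<open>V'\<close>; \<open>\<kappa>\<close> allows directions to be reflected along with
  the vertices.\<close>

lemma card_escaping_choices_iso:
  assumes h: "inj h" and k: "bij \<kappa>" and V': "V' = h ` V"
    and C': "\<And>v. v \<in> V \<Longrightarrow> C' (h v) = \<kappa> ` C v"
    and nxt: "\<And>v d. v \<in> V \<Longrightarrow> d \<in> C v \<Longrightarrow> nxt' (h v) (\<kappa> d) = h (nxt v d)"
  shows "card (escaping_choices V C nxt) = card (escaping_choices V' C' nxt')"
proof (rule bij_betw_same_card)
  let ?t = "\<lambda>f. restrict (\<lambda>w. \<kappa> (f (inv_into UNIV h w))) V'"
  let ?s = "\<lambda>f. restrict (\<lambda>v. inv_into UNIV \<kappa> (f (h v))) V"
  have ih [simp]: "inv_into UNIV h (h v) = v" for v using h by simp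
  have ik [simp]: "inv_into UNIV \<kappa> (\<kappa> c) = c" for c using k by (simp add: bij_is_inj)
  have ki [simp]: "\<kappa> (inv_into UNIV \<kappa> c) = c" for c using k by (simp add: bij_is_surj surj_f_inv_f)
  have esc_iff: "escapes V (\<lambda>v. nxt v (f v)) \<longleftrightarrow> escapes V' (\<lambda>w. nxt' w (f' w))"
    if f: "\<And>v. v \<in> V \<Longrightarrow> f v \<in> C v" and ff: "\<And>v. v \<in> V \<Longrightarrow> f' (h v) = \<kappa> (f v)" for f f'
  proof
    assume e: "escapes V (\<lambda>v. nxt v (f v))"
    show "escapes V' (\<lambda>w. nxt' w (f' w))"
    proof (rule escapesI_closed)
      fix A assume A: "A \<subseteq> V'" "A \<noteq> {}" "(\<lambda>w. nxt' w (f' w)) ` A \<subseteq> A"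
      have "(\<lambda>v. nxt v (f v)) ` (V \<inter> h -` A) \<subseteq> V \<inter> h -` A"
      proof (rule image_subsetI)
        fix v assume "v \<in> V \<inter> h -` A"
        then have v: "v \<in> V" "h v \<in> A" by auto
        then have "h (nxt v (f v)) \<in> A" using A(3) nxt[OF v(1) f[OF v(1)]] ff[OF v(1)] by auto
        then show "nxt v (f v) \<in> V \<inter> h -` A"
          using A(1) V' h by (auto dest: injD)
      qed
      from escapes_no_closed[OF e _ this] have "V \<inter> h -` A = {}" by blast
      with A V' show False by auto
    qed
  next
    assume e: "escapes V' (\<lambda>w. nxt' w (f' w))"
    show "escapes V (\<lambda>v. nxt v (f v))"
    proof (rule escapesI_closed)
      fix A assume A: "A \<subseteq> V" "A \<noteq> {}" "(\<lambda>v. nxt v (f v)) ` A \<subseteq> A"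
      have "(\<lambda>w. nxt' w (f' w)) ` h ` A \<subseteq> h ` A"
        using A(1,3) nxt f ff by (auto simp: subset_iff image_iff)
      from escapes_no_closed[OF e _ this] A V' show False by auto
    qed
  qed
  show "bij_betw ?t (escaping_choices V C nxt) (escaping_choices V' C' nxt')"
  proof (rule bij_betw_byWitness[where f' = ?s])
    show "\<forall>f\<in>escaping_choices V C nxt. ?s (?t f) = f"
      by (auto simp: escaping_choices_def V' fun_eq_iff restrict_def PiE_def extensional_def)
    show "\<forall>f\<in>escaping_choices V' C' nxt'. ?t (?s f) = f"
      by (auto simp: escaping_choices_def V' fun_eq_iff restrict_def PiE_def extensional_def)
    show "?t ` escaping_choices V C nxt \<subseteq> escaping_choices V' C' nxt'"
    proof (rule image_subsetI)
      fix f assume "f \<in> escaping_choices V C nxt"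
      then have f: "f \<in> Pi\<^sub>E V C" "escapes V (\<lambda>v. nxt v (f v))" by (auto simp: escaping_choices_def)
      have "escapes V' (\<lambda>w. nxt' w (?t f w))"
        using esc_iff[of f "?t f"] f V' by (auto simp: PiE_iff)
      moreover have "?t f \<in> Pi\<^sub>E V' C'" using f V' C' by (auto simp: PiE_iff)
      ultimately show "?t f \<in> escaping_choices V' C' nxt'" by (simp add: escaping_choices_def)
    qed
    show "?s ` escaping_choices V' C' nxt' \<subseteq> escaping_choices V C nxt"
    proof (rule image_subsetI)
      fix f assume "f \<in> escaping_choices V' C' nxt'"
      then have f: "f \<in> Pi\<^sub>E V' C'" "escapes V' (\<lambda>v. nxt' v (f v))" by (auto simp: escaping_choices_def)
      have fk: "f (h v) \<in> \<kappa> ` C v" if "v \<in> V" for v using f V' C' that by (auto simp: PiE_iff)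
      have s: "?s f \<in> Pi\<^sub>E V C"
      proof (rule restrict_PiE_iff[THEN iffD2], rule ballI)
        fix v assume "v \<in> V"
        with fk obtain c where "c \<in> C v" "f (h v) = \<kappa> c" by blast
        then show "inv_into UNIV \<kappa> (f (h v)) \<in> C v" by simp
      qed
      moreover have "escapes V (\<lambda>w. nxt w (?s f w))"
      proof (rule esc_iff[THEN iffD2])
        show "?s f v \<in> C v" if "v \<in> V" for v using s that by (rule PiE_mem)
        show "f (h v) = \<kappa> (?s f v)" if "v \<in> V" for v using that by simp
        show "escapes V' (\<lambda>w. nxt' w (f w))" by (rule f(2))
      qed
      ultimately show "?s f \<in> escaping_choices V C nxt" by (simp add: escaping_choices_def)
    qed
  qed
qed

text \<open>The rank is the exit time of the walk. A numerical rank makes it possible to pick an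
  extremal vertex on a cycle.\<close>

lemma escapes_rank:
  assumes "escapes V g"
  shows "\<exists>\<rho>. \<forall>v\<in>V. \<rho> (g v) < (\<rho> v :: nat)"
proof -
  define \<rho> where "\<rho> v = (LEAST k. (g ^^ k) v \<notin> V)" for v
  have "\<rho> (g v) < \<rho> v" if v: "v \<in> V" for v
  proof -
    have "\<exists>k. (g ^^ k) v \<notin> V" using assms v by (auto simp: escapes_def)
    then have *: "(g ^^ \<rho> v) v \<notin> V" unfolding \<rho>_def by (rule LeastI_ex)
    then obtain k where k: "\<rho> v = Suc k" using v by (cases "\<rho> v") auto
    with * have "(g ^^ k) (g v) \<notin> V" by (simp add: funpow_swap1)
    then have "\<rho> (g v) \<le> k" unfolding \<rho>_def by (rule Least_le)
    with k show ?thesis by simp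
  qed
  then show ?thesis by blast
qed

lemma escapes_if_rank:
  fixes \<rho> :: "'a \<Rightarrow> nat"
  assumes "\<And>v. v \<in> V \<Longrightarrow> \<rho> (g v) < \<rho> v"
  shows "escapes V g"
proof (rule escapesI_closed)
  fix A assume A: "A \<subseteq> V" "A \<noteq> {}" "g ` A \<subseteq> A"
  then obtain a where a: "a \<in> A" "\<forall>b\<in>A. \<rho> a \<le> \<rho> b"
    using exists_least_iff[of "\<lambda>k. \<exists>a\<in>A. \<rho> a = k"] by (metis all_not_in_conv leI)
  then have "g a \<in> A" "a \<in> V" using A by auto
  with a(2) assms[of a] show False by fastforce
qed

text \<open>Iterated images of a finite closed set shrink until they stabilise; on the stable core
  the map is a permutation, that is, a union of cycles.\<close>

lemma exists_stable_subset:
  assumes "finite A" "A \<noteq> {}" "g ` A \<subseteq> A"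
  shows "\<exists>S\<subseteq>A. S \<noteq> {} \<and> g ` S = S"
  using assms
proof (induction A rule: finite_psubset_induct)
  case (psubset A)
  show ?case
  proof (cases "g ` A = A")
    case False
    with psubset.prems have "g ` A \<subset> A" by blast
    moreover have "g ` A \<noteq> {}" "g ` g ` A \<subseteq> g ` A" using psubset.prems by auto
    ultimately have "\<exists>S\<subseteq>g ` A. S \<noteq> {} \<and> g ` S = S" by (rule psubset.IH)
    then obtain S where S: "S \<subseteq> g ` A" "S \<noteq> {}" "g ` S = S" by (elim exE conjE)
    from S(1) \<open>g ` A \<subset> A\<close> have "S \<subseteq> A" by (rule subset_trans[OF _ psubset_imp_subset])
    with S show ?thesis by (intro exI conjI)
  qed (use psubset.prems in blast)
qed

section \<open>The matrix-tree theorem for escaping choices\<close>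

definition step_laplacian :: "nat \<Rightarrow> (nat \<Rightarrow> 'a) \<Rightarrow> ('a \<Rightarrow> 'a) \<Rightarrow> real mat" where
  "step_laplacian n en g = mat n n (\<lambda>(a, b). of_bool (a = b) - of_bool (g (en a) = en b))"

text \<open>The indicator vector of the trapped points, those whose walk never leaves
  \<open>V\<close>, is a nonzero kernel vector: a point of \<open>V\<close> is trapped exactly when
  its image is.\<close>

lemma det_step_laplacian_not_escapes:
  assumes en: "bij_betw en {0..<n} V" and ne: "\<not> escapes V g"
  shows "det (step_laplacian n en g) = 0"
proof -
  let ?A = "step_laplacian n en g"
  define W where "W = {v \<in> V. \<forall>k. (g ^^ k) v \<in> V}"
  have Wg: "v \<in> W \<longleftrightarrow> g v \<in> W" if "v \<in> V" for v
  proof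
    assume "v \<in> W"
    then have "(g ^^ Suc k) v \<in> V" for k by (simp add: W_def del: funpow.simps)
    from this[of 0] this show "g v \<in> W" unfolding W_def by (simp add: funpow_swap1)
  next
    assume "g v \<in> W"
    then have "(g ^^ k) v \<in> V" for k
      using that by (cases k) (auto simp: W_def funpow_swap1)
    then show "v \<in> W" using that by (simp add: W_def)
  qed
  obtain w where w: "w \<in> W" using ne unfolding escapes_def W_def by blast
  define x where "x = vec n (\<lambda>a. of_bool (en a \<in> W) :: real)"
  have "?A *\<^sub>v x = 0\<^sub>v n"
  proof (rule eq_vecI)
    fix a assume "a < dim_vec (0\<^sub>v n :: real vec)"
    then have a: "a < n" by simp
    have enV: "en a \<in> V" using en a by (auto simp: bij_betw_def)
    have "(?A *\<^sub>v x) $ a =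
      (\<Sum>b\<in>{0..<n}. (of_bool (a = b) - of_bool (g (en a) = en b)) * of_bool (en b \<in> W))"
      using a by (simp add: step_laplacian_def x_def scalar_prod_def)
    also have "\<dots> = (\<Sum>b\<in>{0..<n}. if b = a then of_bool (en b \<in> W) else 0)
        - (\<Sum>b\<in>{0..<n}. of_bool (g (en a) = en b) * of_bool (en b \<in> W))"
      by (simp only: left_diff_distrib sum_subtractf) (auto intro!: sum.cong arg_cong2[of _ _ _ _ "(-)"])
    also have "(\<Sum>b\<in>{0..<n}. if b = a then of_bool (en b \<in> W) else 0) = (of_bool (en a \<in> W) :: real)"
      using a by simp
    also have "(\<Sum>b\<in>{0..<n}. of_bool (g (en a) = en b) * of_bool (en b \<in> W)) =
        (\<Sum>v\<in>V. of_bool (g (en a) = v) * (of_bool (v \<in> W) :: real))"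
      using en by (rule sum.reindex_bij_betw)
    also have "\<dots> = (\<Sum>v\<in>V. if v = g (en a) then of_bool (v \<in> W) else 0)"
      by (intro sum.cong) auto
    also have "\<dots> = of_bool (g (en a) \<in> W)"
      using en bij_betw_finite by (subst sum.delta) (auto simp: W_def)
    finally show "(?A *\<^sub>v x) $ a = 0\<^sub>v n $ a" using a Wg[OF enV] by simp
  qed (simp add: step_laplacian_def)
  moreover have "x \<noteq> 0\<^sub>v n"
  proof -
    have "w \<in> en ` {0..<n}" using en w by (auto simp: bij_betw_def W_def)
    then obtain a where "a < n" "en a = w" by auto
    then have "x $ a = 1" using w by (simp add: x_def)
    then show ?thesis using \<open>a < n\<close> by auto
  qed
  moreover have "?A \<in> carrier_mat n n" "x \<in> carrier_vec n" by (auto simp: step_laplacian_def x_def)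
  ultimately show ?thesis
    using det_0_iff_vec_prod_zero[of ?A n] by blast
qed

text \<open>A permutation with a non-zero Leibniz term moves a point along \<open>g\<close> or fixes it, so the points
  it moves form a set closed under \<open>g\<close>.\<close>

lemma det_step_laplacian_escapes:
  assumes en: "bij_betw en {0..<n} V" and e: "escapes V g"
  shows "det (step_laplacian n en g) = 1"
proof -
  let ?A = "step_laplacian n en g"
  let ?t = "\<lambda>p. signof p * (\<Prod>i = 0..<n. ?A $$ (i, p i))"
  have V: "en i \<in> V" if "i < n" for i using en that by (auto simp: bij_betw_def)
  have "det ?A = (\<Sum>p | p permutes {0..<n}. ?t p)"
    by (rule det_def') (simp add: step_laplacian_def)
  also have "\<dots> = (\<Sum>p\<in>{id}. ?t p)"
  proof (rule sum.mono_neutral_right)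
    show "\<forall>p\<in>{p. p permutes {0..<n}} - {id}. ?t p = 0"
    proof (rule ballI, rule ccontr)
      fix p assume p: "p \<in> {p. p permutes {0..<n}} - {id}" and nz: "?t p \<noteq> 0"
      from p have perm: "p permutes {0..<n}" by simp
      let ?M = "{i. i < n \<and> p i \<noteq> i}"
      have g: "g (en i) = en (p i)" if "i \<in> ?M" for i
      proof -
        have "p i < n" using perm that permutes_in_image[of p "{0..<n}" i] by auto
        moreover have "?A $$ (i, p i) \<noteq> 0" using nz that by auto
        ultimately show ?thesis using that by (auto simp: step_laplacian_def)
      qed
      have "p i \<in> ?M" if "i \<in> ?M" for i
        using that perm permutes_in_image[of p "{0..<n}" i] permutes_inj[OF perm]
        by (auto dest: injD)
      with g have "g ` en ` ?M \<subseteq> en ` ?M" by auto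
      moreover have "en ` ?M \<subseteq> V" using V by auto
      ultimately have "?M = {}" using escapes_no_closed[OF e] by blast
      then have "p i = i" for i
        using perm by (cases "i < n") (auto simp: permutes_def)
      then show False using p by auto
    qed
  qed (auto simp: finite_permutations permutes_id)
  also have "\<dots> = 1"
    using escapes_fixpoint[OF e V] by (simp add: step_laplacian_def)
  finally show ?thesis .
qed

text \<open>The reduced graph Laplacian: a choice leading out of the enumerated set meets no column
  and so counts only towards the degree on the diagonal.\<close>

definition choice_laplacian :: "nat \<Rightarrow> (nat \<Rightarrow> 'a) \<Rightarrow> ('a \<Rightarrow> 'c set) \<Rightarrow> ('a \<Rightarrow> 'c \<Rightarrow> 'a) \<Rightarrow> real mat" where
  "choice_laplacian n en C nxt =
     mat n n (\<lambda>(a, b). \<Sum>c\<in>C (en a). of_bool (a = b) - of_bool (nxt (en a) c = en b))"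

text \<open>The determinant is multilinear in the rows, so it splits into a sum over all choice
  functions of determinants of one-step matrices, each 1 or 0 according to whether the function
  escapes.\<close>

lemma det_choice_laplacian:
  assumes en: "bij_betw en {0..<n} V" and fin: "\<And>v. v \<in> V \<Longrightarrow> finite (C v)"
  shows "det (choice_laplacian n en C nxt) = real (card (escaping_choices V C nxt))"
proof -
  have finV: "finite V" using en bij_betw_finite by blast
  define dn where "dn = inv_into {0..<n} en"
  have dn: "dn (en i) = i" if "i < n" for i
    using en that by (simp add: dn_def bij_betw_def)
  define t where "t = (\<lambda>p i c. of_bool (i = p i) - of_bool (nxt (en i) c = en (p i)) :: real)"
  have perm: "p i < n" if "p permutes {0..<n}" "i < n" for p i
    using permutes_in_image[OF that(1), of i] that(2) by simp
  \<comment> \<open>Multilinearity is carried out inside the Leibniz formula: for a fixed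
    permutation the product of the row sums distributes over the choice functions.\<close>
  have expand: "(\<Prod>i = 0..<n. choice_laplacian n en C nxt $$ (i, p i)) =
      (\<Sum>f\<in>Pi\<^sub>E V C. \<Prod>i = 0..<n. step_laplacian n en (\<lambda>v. nxt v (f v)) $$ (i, p i))"
    if p: "p permutes {0..<n}" for p
  proof -
    have "(\<Prod>i = 0..<n. choice_laplacian n en C nxt $$ (i, p i)) =
        (\<Prod>i = 0..<n. (\<lambda>v. \<Sum>c\<in>C v. t p (dn v) c) (en i))"
      using perm[OF p] by (intro prod.cong) (auto simp: choice_laplacian_def t_def dn)
    also have "\<dots> = (\<Prod>v\<in>V. \<Sum>c\<in>C v. t p (dn v) c)"
      using en by (rule prod.reindex_bij_betw)
    also have "\<dots> = (\<Sum>f\<in>Pi\<^sub>E V C. \<Prod>v\<in>V. t p (dn v) (f v))"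
      using finV fin by (rule prod_sum_PiE)
    also have "\<dots> = (\<Sum>f\<in>Pi\<^sub>E V C. \<Prod>i = 0..<n. t p (dn (en i)) (f (en i)))"
      by (intro sum.cong refl prod.reindex_bij_betw[OF en, symmetric])
    also have "\<dots> = (\<Sum>f\<in>Pi\<^sub>E V C. \<Prod>i = 0..<n. step_laplacian n en (\<lambda>v. nxt v (f v)) $$ (i, p i))"
      using perm[OF p] by (intro sum.cong refl prod.cong) (auto simp: step_laplacian_def t_def dn)
    finally show ?thesis .
  qed
  have "det (choice_laplacian n en C nxt) =
      (\<Sum>p | p permutes {0..<n}. signof p * (\<Prod>i = 0..<n. choice_laplacian n en C nxt $$ (i, p i)))"
    by (rule det_def') (simp add: choice_laplacian_def)
  also have "\<dots> = (\<Sum>p | p permutes {0..<n}. \<Sum>f\<in>Pi\<^sub>E V C.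
      signof p * (\<Prod>i = 0..<n. step_laplacian n en (\<lambda>v. nxt v (f v)) $$ (i, p i)))"
    by (intro sum.cong refl) (simp add: expand sum_distrib_left)
  also have "\<dots> = (\<Sum>f\<in>Pi\<^sub>E V C. det (step_laplacian n en (\<lambda>v. nxt v (f v))))"
    by (subst sum.swap, intro sum.cong refl det_def'[symmetric]) (simp add: step_laplacian_def)
  also have "\<dots> = (\<Sum>f\<in>Pi\<^sub>E V C. of_bool (f \<in> escaping_choices V C nxt))"
    using det_step_laplacian_escapes[OF en] det_step_laplacian_not_escapes[OF en]
    by (intro sum.cong) (auto simp: escaping_choices_def)
  also have "\<dots> = real (card (escaping_choices V C nxt))"
    using finite_PiE[OF finV fin] by (simp add: escaping_choices_def Int_def flip: of_bool_def) 
  finally show ?thesis .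
qed

text \<open>\<open>P\<close> is a basis of eigenvectors, indexed by \<open>K\<close>, of the Laplacian with rows scaled by \<open>wt\<close>, and \<open>Q\<close>
  its left inverse up to the scalars \<open>w\<close>.\<close>

lemma card_escaping_choices_eigen:
  fixes P :: "'a \<Rightarrow> 'k \<Rightarrow> real"
  assumes finV: "finite V" and fin: "\<And>v. v \<in> V \<Longrightarrow> finite (C v)"
    and K: "finite K" "card K = card V"
    and eig: "\<And>v k. v \<in> V \<Longrightarrow> k \<in> K \<Longrightarrow>
      wt v * (\<Sum>c\<in>C v. P v k - (if nxt v c \<in> V then P (nxt v c) k else 0)) = ev k * P v k"
    and left: "\<And>k l. k \<in> K \<Longrightarrow> l \<in> K \<Longrightarrow> (\<Sum>v\<in>V. Q k v * P v l) = (if k = l then w k else 0)"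
    and w: "\<And>k. k \<in> K \<Longrightarrow> w k \<noteq> 0"
  shows "(\<Prod>v\<in>V. wt v) * real (card (escaping_choices V C nxt)) = (\<Prod>k\<in>K. ev k)"
proof -
  obtain en where en: "bij_betw en {0..<card V} V" using finV ex_bij_betw_nat_finite by blast
  obtain ek where ek: "bij_betw ek {0..<card V} K" using K ex_bij_betw_nat_finite by metis
  let ?n = "card V"
  have enV: "en i \<in> V" and ekK: "ek i \<in> K" if "i < ?n" for i
    using en ek that by (auto simp: bij_betw_def)
  have en_eq: "en i = en j \<longleftrightarrow> i = j" and ek_eq: "ek i = ek j \<longleftrightarrow> i = j" if "i < ?n" "j < ?n" for i j
    using that inj_on_eq_iff[OF bij_betw_imp_inj_on[OF en], of i j]
      inj_on_eq_iff[OF bij_betw_imp_inj_on[OF ek], of i j] by simp_all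
  define L where "L = choice_laplacian ?n en C nxt"
  define PM where "PM = mat ?n ?n (\<lambda>(i, j). P (en i) (ek j))"
  define QM where "QM = mat ?n ?n (\<lambda>(i, j). Q (ek i) (en j))"
  define WM where "WM = mat ?n ?n (\<lambda>(i, j). if i = j then wt (en i) else 0)"
  define EM where "EM = mat ?n ?n (\<lambda>(i, j). if i = j then ev (ek i) else 0)"
  define DM where "DM = mat ?n ?n (\<lambda>(i, j). if i = j then w (ek i) else 0)"
  note mdefs = PM_def QM_def WM_def EM_def DM_def L_def choice_laplacian_def
  have carr: "L \<in> carrier_mat ?n ?n" "PM \<in> carrier_mat ?n ?n" "QM \<in> carrier_mat ?n ?n"
    "WM \<in> carrier_mat ?n ?n" "EM \<in> carrier_mat ?n ?n" "DM \<in> carrier_mat ?n ?n"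
    by (auto simp: mdefs)
  have det_diag: "det (mat ?n ?n (\<lambda>(i, j). if i = j then d i else 0)) = (\<Prod>i = 0..<?n. d i)"
    for d :: "nat \<Rightarrow> real"
    by (subst det_upper_triangular) (auto simp: prod_list_diag_prod)
  have "QM * PM = DM"
  proof (rule eq_matI)
    fix i j assume "i < dim_row DM" "j < dim_col DM"
    then have ij: "i < ?n" "j < ?n" by (auto simp: DM_def)
    have "(QM * PM) $$ (i, j) = (\<Sum>a = 0..<?n. Q (ek i) (en a) * P (en a) (ek j))"
      using ij by (simp add: mdefs scalar_prod_def)
    also have "\<dots> = (\<Sum>v\<in>V. Q (ek i) v * P v (ek j))"
      using en by (rule sum.reindex_bij_betw)
    finally show "(QM * PM) $$ (i, j) = DM $$ (i, j)"
      using ij left[OF ekK ekK, of i j] ek_eq by (simp add: DM_def)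
  qed (auto simp: mdefs)
  then have "det QM * det PM = (\<Prod>i = 0..<?n. w (ek i))"
    using det_mult[OF carr(3,2)] det_diag[of "\<lambda>i. w (ek i)"] by (simp add: DM_def)
  moreover have "(\<Prod>i = 0..<?n. w (ek i)) \<noteq> 0" using w ekK by (simp add: prod_zero_iff)
  ultimately have P0: "det PM \<noteq> 0" by auto
  have LP: "(L * PM) $$ (i, j) =
      (\<Sum>c\<in>C (en i). P (en i) (ek j) - (if nxt (en i) c \<in> V then P (nxt (en i) c) (ek j) else 0))"
    if ij: "i < ?n" "j < ?n" for i j
  proof -
    have "(L * PM) $$ (i, j) = (\<Sum>a = 0..<?n. (\<Sum>c\<in>C (en i).
        of_bool (i = a) - of_bool (nxt (en i) c = en a)) * P (en a) (ek j))"
      using ij by (simp add: mdefs scalar_prod_def)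
    also have "\<dots> = (\<Sum>a = 0..<?n. (\<lambda>v. \<Sum>c\<in>C (en i).
        (if v = en i then P v (ek j) else 0) - (if v = nxt (en i) c then P v (ek j) else 0)) (en a))"
      using ij en_eq by (intro sum.cong refl) (auto simp: sum_distrib_right left_diff_distrib intro!: sum.cong)
    also have "\<dots> = (\<Sum>v\<in>V. \<Sum>c\<in>C (en i).
        (if v = en i then P v (ek j) else 0) - (if v = nxt (en i) c then P v (ek j) else 0))"
      using en by (rule sum.reindex_bij_betw)
    also have "\<dots> = (\<Sum>c\<in>C (en i). (\<Sum>v\<in>V. if v = en i then P v (ek j) else 0)
         - (\<Sum>v\<in>V. if v = nxt (en i) c then P v (ek j) else 0))"
      by (subst sum.swap) (simp only: sum_subtractf)
    finally show ?thesis using finV enV[OF ij(1)] by simp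
  qed
  \<comment> \<open>The columns of \<open>PM\<close> are eigenvectors of the row-scaled matrix. On
    taking determinants \<open>det PM\<close> cancels, so its value never has to be
    computed.\<close>
  have "WM * (L * PM) = PM * EM"
  proof (rule eq_matI)
    fix i j assume "i < dim_row (PM * EM)" "j < dim_col (PM * EM)"
    then have ij: "i < ?n" "j < ?n" by (auto simp: mdefs)
    have "(WM * (L * PM)) $$ (i, j) = (\<Sum>a = 0..<?n. WM $$ (i, a) * (L * PM) $$ (a, j))"
      using ij carr by (simp add: scalar_prod_def)
    also have "\<dots> = (\<Sum>a = 0..<?n. if a = i then wt (en i) * (L * PM) $$ (i, j) else 0)"
      using ij by (intro sum.cong refl) (auto simp: WM_def)
    also have "\<dots> = wt (en i) * (L * PM) $$ (i, j)" using ij by simp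
    also have "\<dots> = ev (ek j) * P (en i) (ek j)"
      unfolding LP[OF ij] using eig[OF enV[OF ij(1)] ekK[OF ij(2)]] .
    also have "\<dots> = (\<Sum>a = 0..<?n. if a = j then ev (ek j) * P (en i) (ek j) else 0)"
      using ij by simp
    also have "\<dots> = (\<Sum>a = 0..<?n. PM $$ (i, a) * EM $$ (a, j))"
      using ij by (intro sum.cong refl) (auto simp: PM_def EM_def)
    also have "\<dots> = (PM * EM) $$ (i, j)"
      using ij carr by (simp add: scalar_prod_def)
    finally show "(WM * (L * PM)) $$ (i, j) = (PM * EM) $$ (i, j)" .
  qed (use carr in auto)
  moreover have "det (WM * (L * PM)) = det WM * (det L * det PM)"
    using det_mult[of WM ?n "L * PM"] det_mult[OF carr(1,2)] carr by simp
  ultimately have "det WM * (det L * det PM) = det PM * det EM"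
    using det_mult[OF carr(2,5)] by metis
  then have "det PM * (det WM * det L) = det PM * det EM" by (simp only: ac_simps)
  with P0 have "det WM * det L = det EM" by simp
  moreover have "det WM = (\<Prod>v\<in>V. wt v)" "det EM = (\<Prod>k\<in>K. ev k)"
    using det_diag[of "\<lambda>i. wt (en i)"] det_diag[of "\<lambda>i. ev (ek i)"]
      prod.reindex_bij_betw[OF en, of wt] prod.reindex_bij_betw[OF ek, of ev]
    by (simp_all add: WM_def EM_def)
  moreover have "det L = real (card (escaping_choices V C nxt))"
    unfolding L_def using en fin by (rule det_choice_laplacian)
  ultimately show ?thesis by simp
qed

section \<open>Eigenfunctions of the square and its triangles\<close>

definition steps :: "(int \<times> int) set" where
  "steps = {(1, 0), (-1, 0), (0, 1), (0, -1)}"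

text \<open>The Dirichlet eigenvectors of the path with inner points 1 to m - 1: they vanish at 0
  and at m.\<close>

definition sine_mode :: "nat \<Rightarrow> nat \<Rightarrow> int \<Rightarrow> real" where
  "sine_mode m j x = sin (of_int x * (real j * pi / real m))"

lemma sine_mode_0 [simp]: "sine_mode m j 0 = 0"
  by (simp add: sine_mode_def)

lemma sine_mode_reflect:
  assumes "m > 0"
  shows "sine_mode m j (int m - x) = - ((-1) ^ j) * sine_mode m j x"
proof -
  have "of_int (int m - x) * (real j * pi / real m) = real j * pi - of_int x * (real j * pi / real m)"
    using assms by (simp add: field_simps)
  then show ?thesis by (simp add: sine_mode_def sin_diff)
qed

lemma sine_mode_end [simp]: "m > 0 \<Longrightarrow> sine_mode m j (int m) = 0"
  using sine_mode_reflect[of m j 0] by simp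

lemma sine_mode_neighbours: "sine_mode m j (x + 1) + sine_mode m j (x - 1) = 2 * cos (real j * pi / real m) * sine_mode m j x"
proof -
  define t where "t = real j * pi / real m"
  show ?thesis
    unfolding sine_mode_def t_def[symmetric] by (simp add: distrib_right left_diff_distrib sin_add sin_diff)
qed

text \<open>Both modes are eigenvectors of the symmetric neighbour operator, and their eigenvalues
  differ because the cosine is injective on [0, pi].\<close>

lemma sine_mode_orthogonal:
  assumes "1 \<le> j" "j < m" "1 \<le> k" "k < m" "j \<noteq> k"
  shows "(\<Sum>x\<in>{1..int m - 1}. sine_mode m j x * sine_mode m k x) = 0"
proof -
  \<comment> \<open>Summation by parts. The modes vanish at 0 and m, so both sums can be extended
    and shifted to one range, where the expression is symmetric in j and k.\<close>
  have shift: "(\<Sum>x\<in>{1..int m - 1}. sine_mode m j x * (sine_mode m k (x + 1) + sine_mode m k (x - 1))) =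
      (\<Sum>x\<in>{0..int m - 1}. sine_mode m j x * sine_mode m k (x + 1) + sine_mode m k x * sine_mode m j (x + 1))"
    if "m > 0" for j k
  proof -
    have "(\<Sum>x\<in>{1..int m - 1}. sine_mode m j x * sine_mode m k (x + 1)) =
        (\<Sum>x\<in>{0..int m - 1}. sine_mode m j x * sine_mode m k (x + 1))"
    proof (rule sum.mono_neutral_left)
      show "\<forall>x\<in>{0..int m - 1} - {1..int m - 1}. sine_mode m j x * sine_mode m k (x + 1) = 0"
      proof
        fix x assume "x \<in> {0..int m - 1} - {1..int m - 1}"
        then have "x = 0" by auto
        then show "sine_mode m j x * sine_mode m k (x + 1) = 0" by simp
      qed
    qed auto
    moreover have "(\<Sum>x\<in>{1..int m - 1}. sine_mode m j x * sine_mode m k (x - 1)) =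
        (\<Sum>x\<in>{1..int m}. sine_mode m j x * sine_mode m k (x - 1))"
    proof (rule sum.mono_neutral_left)
      show "\<forall>x\<in>{1..int m} - {1..int m - 1}. sine_mode m j x * sine_mode m k (x - 1) = 0"
      proof
        fix x assume "x \<in> {1..int m} - {1..int m - 1}"
        then have "x = int m" by auto
        then show "sine_mode m j x * sine_mode m k (x - 1) = 0" using that by simp
      qed
    qed auto
    moreover have "(\<Sum>x\<in>{1..int m}. sine_mode m j x * sine_mode m k (x - 1)) =
        (\<Sum>x\<in>{0..int m - 1}. sine_mode m k x * sine_mode m j (x + 1))"
      by (rule sum.reindex_bij_witness[of _ "\<lambda>x. x + 1" "\<lambda>x. x - 1"]) auto
    ultimately show ?thesis by (simp add: distrib_left sum.distrib)
  qed
  let ?s = "\<Sum>x\<in>{1..int m - 1}. sine_mode m j x * sine_mode m k x"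
  have "2 * cos (real k * pi / real m) * ?s =
      (\<Sum>x\<in>{1..int m - 1}. sine_mode m j x * (sine_mode m k (x + 1) + sine_mode m k (x - 1)))"
    unfolding sine_mode_neighbours sum_distrib_left by (intro sum.cong) auto
  also have "\<dots> = (\<Sum>x\<in>{0..int m - 1}. sine_mode m j x * sine_mode m k (x + 1) + sine_mode m k x * sine_mode m j (x + 1))"
    using assms by (intro shift) auto
  also have "\<dots> = (\<Sum>x\<in>{0..int m - 1}. sine_mode m k x * sine_mode m j (x + 1) + sine_mode m j x * sine_mode m k (x + 1))"
    by (simp add: add.commute)
  also have "\<dots> = (\<Sum>x\<in>{1..int m - 1}. sine_mode m k x * (sine_mode m j (x + 1) + sine_mode m j (x - 1)))"
    using assms by (intro shift[symmetric]) auto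
  also have "\<dots> = 2 * cos (real j * pi / real m) * ?s"
    unfolding sine_mode_neighbours sum_distrib_left by (intro sum.cong) auto
  finally have "cos (real k * pi / real m) * ?s = cos (real j * pi / real m) * ?s" by simp
  moreover have "cos (real k * pi / real m) \<noteq> cos (real j * pi / real m)"
  proof
    assume eq: "cos (real k * pi / real m) = cos (real j * pi / real m)"
    have b: "0 \<le> real i * pi / real m \<and> real i * pi / real m \<le> pi" if "i < m" for i
      using that by (simp add: field_simps)
    have "real k * pi / real m = real j * pi / real m"
      using cos_inj_pi[OF _ _ _ _ eq] b[OF assms(2)] b[OF assms(4)] by blast
    then show False using assms by simp
  qed
  ultimately show ?thesis by simp
qed

lemma sine_mode_norm_pos:
  assumes "1 \<le> j" "j < m"
  shows "(\<Sum>x\<in>{1..int m - 1}. sine_mode m j x * sine_mode m j x) > 0"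
proof (rule sum_pos2[of _ 1])
  have "real j * pi / real m < pi" "0 < real j * pi / real m"
    using assms by (auto simp: field_simps)
  then have "sine_mode m j 1 > 0" by (simp add: sine_mode_def sin_gt_zero)
  then show "0 < sine_mode m j 1 * sine_mode m j 1" by simp
qed (use assms in auto)

text \<open>Reflecting in the antidiagonal turns the first product into the second, including the
  sign (-1)^(j + k); the sum is therefore invariant under this reflection.\<close>

definition square_mode :: "nat \<Rightarrow> nat \<times> nat \<Rightarrow> int \<times> int \<Rightarrow> real" where
  "square_mode m = (\<lambda>(j, k) (x, y). sine_mode m j x * sine_mode m k y + (-1) ^ (j + k) * (sine_mode m k x * sine_mode m j y))"

definition square_eigenvalue :: "nat \<Rightarrow> nat \<times> nat \<Rightarrow> real" where
  "square_eigenvalue m = (\<lambda>(j, k). 4 - 2 * cos (real j * pi / real m) - 2 * cos (real k * pi / real m))"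

lemma square_mode_eigen:
  "4 * square_mode m p (x, y) - square_mode m p (x + 1, y) - square_mode m p (x - 1, y) - square_mode m p (x, y + 1) - square_mode m p (x, y - 1) =
   square_eigenvalue m p * square_mode m p (x, y)"
proof (cases p)
  case (Pair j k)
  have "square_mode m p (x + 1, y) + square_mode m p (x - 1, y) + square_mode m p (x, y + 1) + square_mode m p (x, y - 1) =
      (sine_mode m j (x + 1) + sine_mode m j (x - 1)) * sine_mode m k y
      + (-1) ^ (j + k) * ((sine_mode m k (x + 1) + sine_mode m k (x - 1)) * sine_mode m j y)
      + sine_mode m j x * (sine_mode m k (y + 1) + sine_mode m k (y - 1))
      + (-1) ^ (j + k) * (sine_mode m k x * (sine_mode m j (y + 1) + sine_mode m j (y - 1)))"
    by (simp add: square_mode_def Pair algebra_simps)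
  also have "\<dots> = (2 * cos (real j * pi / real m) + 2 * cos (real k * pi / real m)) * square_mode m p (x, y)"
    unfolding sine_mode_neighbours by (simp add: square_mode_def Pair algebra_simps)
  finally show ?thesis by (simp add: square_eigenvalue_def Pair algebra_simps)
qed

lemma square_mode_0 [simp]: "square_mode m p (0, y) = 0" "square_mode m p (x, 0) = 0"
  by (auto simp: square_mode_def split: prod.splits)

lemma square_mode_antidiagonal:
  assumes "m > 0"
  shows "square_mode m p (int m - y, int m - x) = square_mode m p (x, y)"
proof (cases p)
  case (Pair j k)
  have "((-1) ^ j * (-1) ^ j :: real) = 1" for j by (simp flip: power_add mult_2)
  then have "(-1) ^ j * ((-1) ^ j * z) = (z :: real)" for j z by (simp flip: mult.assoc)
  then show ?thesis
    using assms by (simp add: square_mode_def Pair sine_mode_reflect power_add algebra_simps)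
qed

lemma square_mode_diagonal:
  assumes "even (fst p + snd p)"
  shows "square_mode m p (y, x) = square_mode m p (x, y)"
  using assms by (cases p) (simp add: square_mode_def algebra_simps)

definition square :: "nat \<Rightarrow> (int \<times> int) set" where
  "square m = {1..int m - 1} \<times> {1..int m - 1}"

text \<open>The sum over the square factors into four products of one-dimensional inner products.
  For distinct pairs each product has a vanishing factor.\<close>

lemma square_mode_inner:
  assumes "1 \<le> j" "j \<le> k" "k < m" "1 \<le> j'" "j' \<le> k'" "k' < m"
  shows "(\<Sum>s\<in>square m. square_mode m (j, k) s * square_mode m (j', k') s) = 0 \<longleftrightarrow> (j, k) \<noteq> (j', k')"
proof -
  let ?a = "\<lambda>i i'. \<Sum>x\<in>{1..int m - 1}. sine_mode m i x * sine_mode m i' x"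
  let ?s = "(-1) ^ (j + k) :: real" and ?s' = "(-1) ^ (j' + k') :: real"
  have P: "(\<Sum>x\<in>A. \<Sum>y\<in>A. f x * g y) = (\<Sum>x\<in>A. f x) * (\<Sum>y\<in>A. g y)"
    for A :: "int set" and f g :: "int \<Rightarrow> real"
    by (simp only: sum_product)
  have Pc: "(\<Sum>x\<in>A. \<Sum>y\<in>A. c * (f x * g y)) = c * ((\<Sum>x\<in>A. f x) * (\<Sum>y\<in>A. g y))"
    for A :: "int set" and f g :: "int \<Rightarrow> real" and c
    by (simp only: sum_product) (simp only: sum_distrib_left)
  have "(\<Sum>s\<in>square m. square_mode m (j, k) s * square_mode m (j', k') s) =
     (\<Sum>x\<in>{1..int m - 1}. \<Sum>y\<in>{1..int m - 1}.
        (sine_mode m j x * sine_mode m j' x) * (sine_mode m k y * sine_mode m k' y)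
        + ?s' * ((sine_mode m j x * sine_mode m k' x) * (sine_mode m k y * sine_mode m j' y))
        + ?s * ((sine_mode m k x * sine_mode m j' x) * (sine_mode m j y * sine_mode m k' y))
        + ?s * ?s' * ((sine_mode m k x * sine_mode m k' x) * (sine_mode m j y * sine_mode m j' y)))"
    unfolding square_def sum.cartesian_product'
    by (intro sum.cong refl) (simp add: square_mode_def algebra_simps)
  also have "\<dots> = ?a j j' * ?a k k' + ?s' * (?a j k' * ?a k j')
      + ?s * (?a k j' * ?a j k') + ?s * ?s' * (?a k k' * ?a j j')"
    by (simp only: sum.distrib P Pc)
  finally have *: "(\<Sum>s\<in>square m. square_mode m (j, k) s * square_mode m (j', k') s) =
      ?a j j' * ?a k k' + ?s' * (?a j k' * ?a k j') + ?s * (?a k j' * ?a j k')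
      + ?s * ?s' * (?a k k' * ?a j j')" .
  have orth: "?a i i' = 0" if "i \<noteq> i'" "1 \<le> i" "1 \<le> i'" "i < m" "i' < m" for i i'
    using that by (intro sine_mode_orthogonal) auto
  show ?thesis
  proof (cases "(j, k) = (j', k')")
    case True
    have ss: "?s * ?s = 1" by (simp flip: power_add mult_2)
    have pos: "?a j j > 0" "?a k k > 0" using assms by (auto intro!: sine_mode_norm_pos)
    have "(\<Sum>s\<in>square m. square_mode m (j, k) s * square_mode m (j', k') s) > 0"
    proof (cases "j = k")
      \<comment> \<open>For equal indices the sign is +1, so the two halves of the mode reinforce
        each other and all four terms coincide.\<close>
      case eq: True
      have jk: "j' = j" "k' = j" "k = j" using True eq by auto
      have s1: "(-1) ^ (j + j) = (1 :: real)" by (simp flip: mult_2)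
      have "(\<Sum>s\<in>square m. square_mode m (j, k) s * square_mode m (j', k') s) = 4 * (?a j j * ?a j j)"
        unfolding * unfolding jk s1 by simp
      with pos show ?thesis by simp
    next
      case False
      then have "?a j k = 0" using assms by (intro orth) auto
      with True ss pos show ?thesis unfolding * by simp
    qed
    with True show ?thesis by simp
  next
    case False
    then have "j \<noteq> j' \<or> k \<noteq> k'" by auto
    then have 1: "?a j j' * ?a k k' = 0" using assms orth by auto
    \<comment> \<open>The ordering of the indices enters here: j = k' and k = j' together with j
      \<le> k and j' \<le> k' would make the pairs equal.\<close>
    from False assms have "j \<noteq> k' \<or> k \<noteq> j'" by auto
    then have "?a j k' = 0 \<or> ?a k j' = 0" using assms orth[of j k'] orth[of k j'] by auto
    then have 2: "?a j k' * ?a k j' = 0" by auto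
    have 3: "?a k k' * ?a j j' = 0" using 1 by auto
    have 4: "?a k j' * ?a j k' = 0" using 2 by auto
    show ?thesis unfolding * 1 2 3 4 using False by simp
  qed
qed

text \<open>Encodes two kinds of boundary: a step out of \<open>W\<close> is not offered (free
  boundary), while a step to a point of \<open>W\<close> outside the vertex set is offered and ends
  in the root (Dirichlet boundary).\<close>

definition region_choices :: "(int \<times> int) set \<Rightarrow> int \<times> int \<Rightarrow> (int \<times> int) set" where
  "region_choices W v = {d \<in> steps. v + d \<in> W}"

lemma finite_region_choices [simp]: "finite (region_choices W v)"
  by (simp add: region_choices_def steps_def)

text \<open>\<open>fold\<close> retracts the square onto a fundamental domain of a group of reflections, and \<open>emb\<close>
  places the vertex set \<open>V\<close> as that domain.\<close>

lemma card_escaping_choices_square: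
  fixes V W :: "(int \<times> int) set" and emb fold :: "int \<times> int \<Rightarrow> int \<times> int"
  assumes finV: "finite V" and K: "finite K" "card K = card V"
    and KK: "\<And>j k. (j, k) \<in> K \<Longrightarrow> 1 \<le> j \<and> j \<le> k \<and> k < m"
    and fold: "\<And>s. s \<in> square m \<Longrightarrow> fold s \<in> V"
    and inv: "\<And>s p. s \<in> square m \<Longrightarrow> p \<in> K \<Longrightarrow> square_mode m p (emb (fold s)) = square_mode m p s"
    and eig: "\<And>v p. v \<in> V \<Longrightarrow> p \<in> K \<Longrightarrow>
      wt v * (\<Sum>d\<in>region_choices W v. square_mode m p (emb v) - square_mode m p (emb (v + d))) =
      square_eigenvalue m p * square_mode m p (emb v)"
    and dir: "\<And>v p. v \<in> W - V \<Longrightarrow> p \<in> K \<Longrightarrow> square_mode m p (emb v) = 0"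
  shows "(\<Prod>v\<in>V. wt v) * real (card (escaping_choices V (region_choices W) (+))) = (\<Prod>p\<in>K. square_eigenvalue m p)"
proof (rule card_escaping_choices_eigen[where P = "\<lambda>v p. square_mode m p (emb v)"
      and Q = "\<lambda>p v. \<Sum>s | s \<in> square m \<and> fold s = v. square_mode m p s"
      and w = "\<lambda>p. \<Sum>s\<in>square m. square_mode m p s * square_mode m p s"])
  have fs: "finite (square m)" by (simp add: square_def)
  fix p q assume p: "p \<in> K" and q: "q \<in> K"
  \<comment> \<open>The fibre sums in \<open>Q\<close> spread each point of \<open>V\<close> over
    its mirror images, so the pairing with \<open>P\<close> becomes the inner product on the full
    square.\<close>
  have "(\<Sum>v\<in>V. (\<Sum>s | s \<in> square m \<and> fold s = v. square_mode m p s) * square_mode m q (emb v)) =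
      (\<Sum>v\<in>V. \<Sum>s | s \<in> square m \<and> fold s = v. square_mode m p s * square_mode m q (emb (fold s)))"
    by (simp add: sum_distrib_right)
  also have "\<dots> = (\<Sum>s\<in>square m. square_mode m p s * square_mode m q (emb (fold s)))"
    using fold by (intro sum.group fs finV) auto
  also have "\<dots> = (\<Sum>s\<in>square m. square_mode m p s * square_mode m q s)"
    using inv q by (intro sum.cong) auto
  also have "\<dots> = (if p = q then \<Sum>s\<in>square m. square_mode m p s * square_mode m p s else 0)"
    using square_mode_inner[of "fst p" "snd p" m "fst q" "snd q"] KK[of "fst p" "snd p"] KK[of "fst q" "snd q"] p q
    by auto
  finally show "(\<Sum>v\<in>V. (\<Sum>s | s \<in> square m \<and> fold s = v. square_mode m p s) * square_mode m q (emb v)) =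
      (if p = q then \<Sum>s\<in>square m. square_mode m p s * square_mode m p s else 0)" .
next
  fix p assume "p \<in> K"
  then show "(\<Sum>s\<in>square m. square_mode m p s * square_mode m p s) \<noteq> 0"
    using square_mode_inner[of "fst p" "snd p" m "fst p" "snd p"] KK[of "fst p" "snd p"] by auto
next
  fix v p assume v: "v \<in> V" and p: "p \<in> K"
  have "(\<Sum>d\<in>region_choices W v. square_mode m p (emb v) - (if v + d \<in> V then square_mode m p (emb (v + d)) else 0)) =
      (\<Sum>d\<in>region_choices W v. square_mode m p (emb v) - square_mode m p (emb (v + d)))"
    using dir p by (intro sum.cong) (auto simp: region_choices_def)
  then show "wt v * (\<Sum>d\<in>region_choices W v. square_mode m p (emb v) - (if v + d \<in> V then square_mode m p (emb (v + d)) else 0)) =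
      square_eigenvalue m p * square_mode m p (emb v)"
    using eig[OF v p] by simp
qed (use finV K in auto)

lemma sum_region_choices_all:
  assumes "\<And>d. d \<in> steps \<Longrightarrow> (x, y) + d \<in> W"
  shows "(\<Sum>d\<in>region_choices W (x, y). c - f ((x, y) + d)) =
    4 * c - f (x + 1, y) - f (x - 1, y) - f (x, y + 1) - (f (x, y - 1) :: real)"
proof -
  have "region_choices W (x, y) = steps" using assms by (auto simp: region_choices_def)
  then show ?thesis by (simp add: steps_def)
qed

section \<open>The determinants of the quarter and of the half diamond\<close>

definition quadrant :: "nat \<Rightarrow> (int \<times> int) set" where
  "quadrant n = {(x, y). 1 \<le> x \<and> 1 \<le> y \<and> x + y \<le> int n}"

definition closed_quadrant :: "nat \<Rightarrow> (int \<times> int) set" where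
  "closed_quadrant n = {(x, y). 0 \<le> x \<and> 0 \<le> y \<and> x + y \<le> int n}"

definition half :: "nat \<Rightarrow> (int \<times> int) set" where
  "half n = {(x, y). 1 \<le> y \<and> \<bar>x\<bar> + y \<le> int n}"

definition closed_half :: "nat \<Rightarrow> (int \<times> int) set" where
  "closed_half n = {(x, y). 0 \<le> y \<and> \<bar>x\<bar> + y \<le> int n}"

lemma finite_box: "A \<subseteq> {- int n..int n} \<times> {- int n..int n} \<Longrightarrow> finite A"
  by (rule finite_subset) auto

lemma finite_quadrant: "finite (quadrant n)"
  by (rule finite_box[of _ n]) (auto simp: quadrant_def)

lemma finite_half: "finite (half n)"
  by (rule finite_box[of _ n]) (auto simp: half_def)

text \<open>The quarter is the square of side n folded along its antidiagonal. The axes are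
  Dirichlet; the slanted side is free.\<close>

lemma card_escaping_choices_quadrant:
  assumes n: "n \<ge> 1"
  shows "2 ^ (n - 1) * real (card (escaping_choices (quadrant n) (region_choices (closed_quadrant n)) (+))) =
    (\<Prod>p\<in>{(j, k). 1 \<le> j \<and> j \<le> k \<and> k \<le> n - 1}. square_eigenvalue n p)"
proof -
  let ?K = "{(j, k). 1 \<le> j \<and> j \<le> k \<and> k \<le> n - 1}"
  define wt :: "int \<times> int \<Rightarrow> real" where "wt = (\<lambda>(x, y). if x + y = int n then 2 else 1)"
  define fold where "fold = (\<lambda>(x, y). if x + y \<le> int n then (x, y) else (int n - y, int n - x))"
  have "(\<Prod>v\<in>quadrant n. wt v) * real (card (escaping_choices (quadrant n) (region_choices (closed_quadrant n)) (+))) =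
      (\<Prod>p\<in>?K. square_eigenvalue n p)"
  proof (rule card_escaping_choices_square[where emb = "\<lambda>v. v" and fold = fold])
    show "finite (quadrant n)" by (rule finite_quadrant)
    have "?K \<subseteq> {0..n} \<times> {0..n}" by auto
    then show "finite ?K" by (rule finite_subset) auto
    have "bij_betw (\<lambda>(j, k). (int j, int n - int k)) ?K (quadrant n)"
    proof (rule bij_betw_byWitness[where f' = "\<lambda>(x, y). (nat x, nat (int n - y))"])
      show "(\<lambda>(j, k). (int j, int n - int k)) ` ?K \<subseteq> quadrant n"
        using n by (auto simp: quadrant_def)
      show "(\<lambda>(x, y). (nat x, nat (int n - y))) ` quadrant n \<subseteq> ?K"
        using n by (auto simp: quadrant_def)
    qed (auto simp: quadrant_def)
    then show "card ?K = card (quadrant n)" by (rule bij_betw_same_card)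
    show "1 \<le> j \<and> j \<le> k \<and> k < n" if "(j, k) \<in> ?K" for j k using that n by auto
    show "fold s \<in> quadrant n" if "s \<in> square n" for s
      using that by (auto simp: fold_def square_def quadrant_def split: if_splits)
    show "square_mode n p (fold s) = square_mode n p s" for s p
      using n square_mode_antidiagonal[of n p] by (auto simp: fold_def split: prod.splits)
    show "square_mode n p v = 0" if "v \<in> closed_quadrant n - quadrant n" for v p
    proof -
      obtain x y where v: "v = (x, y)" by fastforce
      have "x = 0 \<or> y = 0" using that by (auto simp: v closed_quadrant_def quadrant_def)
      then show ?thesis by (auto simp: v)
    qed
    show "wt v * (\<Sum>d\<in>region_choices (closed_quadrant n) v. square_mode n p v - square_mode n p (v + d)) =
        square_eigenvalue n p * square_mode n p v" if v: "v \<in> quadrant n" for v p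
    proof (cases v)
      case (Pair x y)
      with v have xy: "1 \<le> x" "1 \<le> y" "x + y \<le> int n" by (auto simp: quadrant_def)
      show ?thesis
      proof (cases "x + y = int n")
        case False
        then have "(x, y) + d \<in> closed_quadrant n" if "d \<in> steps" for d
          using that xy by (auto simp: steps_def closed_quadrant_def)
        with False show ?thesis
          unfolding Pair by (subst sum_region_choices_all) (auto simp: wt_def square_mode_eigen)
      next
        \<comment> \<open>On the slanted side (x + 1, y) is the mirror image of (x, y - 1), and (x,
          y + 1) that of (x - 1, y), so the sum over all four neighbours is twice the sum over the
          two that remain.\<close>
        case True
        then have y: "y = int n - x" by simp
        from True have "region_choices (closed_quadrant n) (x, y) = {(-1, 0), (0, -1)}"
          using xy by (auto simp: region_choices_def steps_def closed_quadrant_def)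
        moreover have "square_mode n p (x + 1, y) = square_mode n p (x, y - 1)"
          using square_mode_antidiagonal[of n p "y - 1" x] n by (simp add: y algebra_simps)
        moreover have "square_mode n p (x, y + 1) = square_mode n p (x - 1, y)"
          using square_mode_antidiagonal[of n p y "x - 1"] n by (simp add: y algebra_simps)
        ultimately show ?thesis
          using square_mode_eigen[of n p x y] True by (simp add: Pair wt_def algebra_simps)
      qed
    qed
  qed
  moreover have "(\<Prod>v\<in>quadrant n. wt v) = 2 ^ (n - 1)"
  proof -
    let ?D = "(\<lambda>i. (int i, int n - int i)) ` {1..n - 1}"
    have "(\<Prod>v\<in>quadrant n. wt v) = (\<Prod>v\<in>?D. wt v)"
    proof (rule prod.mono_neutral_right[OF finite_quadrant])
      show "\<forall>v\<in>quadrant n - ?D. wt v = 1"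
      proof (rule ballI, rule ccontr)
        fix v assume v: "v \<in> quadrant n - ?D" "wt v \<noteq> 1"
        obtain x y where xy: "v = (x, y)" by fastforce
        from v have *: "1 \<le> x" "1 \<le> y" "x + y = int n"
          by (auto simp: xy quadrant_def wt_def split: if_splits)
        then have "v \<in> ?D" unfolding xy by (intro image_eqI[of _ _ "nat x"]) auto
        with v show False by blast
      qed
    qed (use n in \<open>auto simp: quadrant_def\<close>)
    also have "\<dots> = (\<Prod>i\<in>{1..n - 1}. 2)"
      by (subst prod.reindex) (auto simp: inj_on_def wt_def)
    finally show ?thesis by simp
  qed
  ultimately show ?thesis by simp
qed

text \<open>Shifted by n, the half is the triangle under both diagonals of the square of side 2n,
  with Dirichlet base and two free sides. At the apex both reflections act, and one neighbour stands
  for four.\<close>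

lemma card_escaping_choices_half:
  assumes n: "n \<ge> 1"
  shows "2 ^ (2 * n) * real (card (escaping_choices (half n) (region_choices (closed_half n)) (+))) =
    (\<Prod>p\<in>{(j, k). 1 \<le> j \<and> j \<le> k \<and> k \<le> 2 * n - 1 \<and> even (j + k)}. square_eigenvalue (2 * n) p)"
proof -
  let ?K = "{(j, k). 1 \<le> j \<and> j \<le> k \<and> k \<le> 2 * n - 1 \<and> even (j + k)}"
  let ?m = "2 * n"
  define wt :: "int \<times> int \<Rightarrow> real" where
    "wt = (\<lambda>(x, y). if \<bar>x\<bar> + y = int n then if x = 0 then 4 else 2 else 1)"
  \<comment> \<open>The fold along the antidiagonal followed by the shift back to the coordinates of
    \<open>half n\<close>; the fold along the diagonal is the exchange of coordinates in
    \<open>fold\<close>.\<close>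
  define flip :: "int \<times> int \<Rightarrow> int \<times> int" where
    "flip = (\<lambda>(x, y). if x + y \<le> 2 * int n then (x - int n, y) else (int n - y, 2 * int n - x))"
  define fold where "fold = (\<lambda>(x, y). if y \<le> x then flip (x, y) else flip (y, x))"
  define emb :: "int \<times> int \<Rightarrow> int \<times> int" where "emb = (\<lambda>(x, y). (x + int n, y))"
  have "(\<Prod>v\<in>half n. wt v) * real (card (escaping_choices (half n) (region_choices (closed_half n)) (+))) =
      (\<Prod>p\<in>?K. square_eigenvalue ?m p)"
  proof (rule card_escaping_choices_square[where emb = emb and fold = fold])
    show "finite (half n)" by (rule finite_half)
    have "?K \<subseteq> {0..2 * n} \<times> {0..2 * n}" by auto
    then show "finite ?K" by (rule finite_subset) auto
    \<comment> \<open>A rotation by 45 degrees: j + k = 2 (x + n) and k - j = 2 (y - 1), which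
      accounts for the parity and the order of the pair.\<close>
    have "bij_betw (\<lambda>(x, y). (nat (x + int n - y + 1), nat (x + int n + y - 1))) (half n) ?K"
    proof (rule bij_betw_byWitness[where
          f' = "\<lambda>(j, k). ((int j + int k) div 2 - int n, (int k - int j) div 2 + 1)"])
      show "(\<lambda>(x, y). (nat (x + int n - y + 1), nat (x + int n + y - 1))) ` half n \<subseteq> ?K"
      proof (rule image_subsetI)
        fix v assume "v \<in> half n"
        then obtain x y where v: "v = (x, y)" and *: "1 \<le> y" "\<bar>x\<bar> + y \<le> int n"
          by (cases v) (auto simp: half_def)
        have "even (nat (x + int n - y + 1) + nat (x + int n + y - 1)) \<longleftrightarrow>
            even (x + int n - y + 1 + (x + int n + y - 1))"
          using * by (subst nat_add_distrib[symmetric]) (auto simp: even_nat_iff)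
        then show "(case v of (x, y) \<Rightarrow> (nat (x + int n - y + 1), nat (x + int n + y - 1))) \<in> ?K"
          using * n by (auto simp: v)
      qed
      have ex: "\<exists>a b. int j = b - a \<and> int k = b + a \<and> 0 \<le> a \<and> a < b \<and> a + b < 2 * int n"
        if "(j, k) \<in> ?K" for j k
      proof -
        from that have "even (j + k)" by simp
        then obtain b where b: "j + k = 2 * b" by (elim evenE)
        show ?thesis
          by (rule exI[of _ "int b - int j"], rule exI[of _ "int b"]) (use that b n in auto)
      qed
      show "(\<lambda>(j, k). ((int j + int k) div 2 - int n, (int k - int j) div 2 + 1)) ` ?K \<subseteq> half n"
      proof (rule image_subsetI)
        fix p assume "p \<in> ?K"
        then obtain j k where p: "p = (j, k)" "(j, k) \<in> ?K" by (cases p) auto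
        from ex[OF p(2)] obtain a b where
          ab: "int j = b - a" "int k = b + a" "0 \<le> a" "a < b" "a + b < 2 * int n" by blast
        have "(int j + int k) div 2 = b" "(int k - int j) div 2 = a" unfolding ab by simp_all
        then show "(case p of (j, k) \<Rightarrow> ((int j + int k) div 2 - int n, (int k - int j) div 2 + 1)) \<in> half n"
          using ab by (auto simp: p half_def)
      qed
      show "\<forall>p\<in>?K. (case (case p of (j, k) \<Rightarrow> ((int j + int k) div 2 - int n, (int k - int j) div 2 + 1)) of
          (x, y) \<Rightarrow> (nat (x + int n - y + 1), nat (x + int n + y - 1))) = p"
      proof
        fix p assume "p \<in> ?K"
        then obtain j k where p: "p = (j, k)" "(j, k) \<in> ?K" by (cases p) auto
        from ex[OF p(2)] obtain a b where
          ab: "int j = b - a" "int k = b + a" by blast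
        have "(int j + int k) div 2 = b" "(int k - int j) div 2 = a" unfolding ab by simp_all
        then show "(case (case p of (j, k) \<Rightarrow> ((int j + int k) div 2 - int n, (int k - int j) div 2 + 1)) of
          (x, y) \<Rightarrow> (nat (x + int n - y + 1), nat (x + int n + y - 1))) = p"
          using ab by (auto simp: p)
      qed
    qed (auto simp: half_def)
    then show "card ?K = card (half n)" by (rule bij_betw_same_card[symmetric])
    show "1 \<le> j \<and> j \<le> k \<and> k < ?m" if "(j, k) \<in> ?K" for j k using that n by auto
    show "fold s \<in> half n" if "s \<in> square ?m" for s
      using that by (cases s) (auto simp: fold_def flip_def square_def half_def)
    have diag: "square_mode ?m p (y, x) = square_mode ?m p (x, y)" if "p \<in> ?K" for p x y
      using that by (intro square_mode_diagonal) auto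
    have anti: "square_mode ?m p (2 * int n - y, 2 * int n - x) = square_mode ?m p (x, y)" for p x y
      using square_mode_antidiagonal[of ?m p y x] n by simp
    have flip: "square_mode ?m p (emb (flip (x, y))) = square_mode ?m p (x, y)" for p x y
      using anti[of p y x] by (auto simp: flip_def emb_def algebra_simps)
    show "square_mode ?m p (emb (fold s)) = square_mode ?m p s" if "p \<in> ?K" for s p
      using diag[OF that] flip by (cases s) (auto simp: fold_def)
    show "square_mode ?m p (emb v) = 0" if "v \<in> closed_half n - half n" for v p
    proof -
      obtain x y where v: "v = (x, y)" by fastforce
      then have "y = 0" using that by (auto simp: closed_half_def half_def)
      then show ?thesis by (simp add: v emb_def)
    qed
    show "wt v * (\<Sum>d\<in>region_choices (closed_half n) v. square_mode ?m p (emb v) - square_mode ?m p (emb (v + d))) =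
        square_eigenvalue ?m p * square_mode ?m p (emb v)" if v: "v \<in> half n" and p: "p \<in> ?K" for v p
    proof (cases v)
      case (Pair x y)
      with v have xy: "1 \<le> y" "\<bar>x\<bar> + y \<le> int n" by (auto simp: half_def)
      note eig = square_mode_eigen[of ?m p "x + int n" y]
      consider "\<bar>x\<bar> + y < int n" | "x > 0" "y = int n - x" | "x < 0" "y = int n + x" | "x = 0" "y = int n"
        using xy by linarith
      then show ?thesis
      proof cases
        case 1
        then have "(x, y) + d \<in> closed_half n" if "d \<in> steps" for d
          using that xy by (auto simp: steps_def closed_half_def)
        with 1 eig show ?thesis
          unfolding Pair
          by (subst sum_region_choices_all[where f = "\<lambda>v. square_mode ?m p (emb v)"])
            (auto simp: wt_def emb_def algebra_simps)
      next
        case 2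
        then have "region_choices (closed_half n) (x, y) = {(-1, 0), (0, -1)}"
          using xy by (auto simp: region_choices_def steps_def closed_half_def)
        moreover have "square_mode ?m p (x + int n + 1, y) = square_mode ?m p (x + int n, y - 1)"
          using anti[of p "y - 1" "x + int n"] by (simp add: 2(2) algebra_simps)
        moreover have "square_mode ?m p (x + int n, y + 1) = square_mode ?m p (x + int n - 1, y)"
          using anti[of p y "x + int n - 1"] by (simp add: 2(2) algebra_simps)
        ultimately show ?thesis
          using eig 2(1) by (simp add: Pair wt_def emb_def 2(2) algebra_simps)
      next
        case 3
        then have "region_choices (closed_half n) (x, y) = {(1, 0), (0, -1)}"
          using xy by (auto simp: region_choices_def steps_def closed_half_def)
        moreover have "square_mode ?m p (x + int n - 1, y) = square_mode ?m p (x + int n, y - 1)"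
          using diag[OF p, of "y - 1" y] by (simp add: 3(2) algebra_simps)
        moreover have "square_mode ?m p (x + int n, y + 1) = square_mode ?m p (x + int n + 1, y)"
          using diag[OF p, of y "y + 1"] by (simp add: 3(2) algebra_simps)
        ultimately show ?thesis
          using eig 3(1) by (simp add: Pair wt_def emb_def 3(2) algebra_simps)
      next
        \<comment> \<open>At the apex the diagonal identifies left with below and above with right,
          the antidiagonal right with below, so all four neighbours share one value.\<close>
        case 4
        then have "region_choices (closed_half n) (x, y) = {(0, -1)}"
          using xy by (auto simp: region_choices_def steps_def closed_half_def)
        moreover have "square_mode ?m p (int n - 1, int n) = square_mode ?m p (int n, int n - 1)"
          by (rule diag[OF p])
        moreover have "square_mode ?m p (int n, int n + 1) = square_mode ?m p (int n + 1, int n)"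
          by (rule diag[OF p])
        moreover have "square_mode ?m p (int n + 1, int n) = square_mode ?m p (int n, int n - 1)"
          using anti[of p "int n - 1" "int n"] by (simp add: algebra_simps)
        ultimately show ?thesis
          using eig 4 by (simp add: Pair wt_def emb_def algebra_simps)
      qed
    qed
  qed
  moreover have "(\<Prod>v\<in>half n. wt v) = 2 ^ (2 * n)"
  proof -
    let ?I = "{- (int n - 1)..int n - 1}"
    let ?D = "(\<lambda>x. (x, int n - \<bar>x\<bar>)) ` ?I"
    have "(\<Prod>v\<in>half n. wt v) = (\<Prod>v\<in>?D. wt v)"
      by (rule prod.mono_neutral_right[OF finite_half]) (auto simp: half_def wt_def image_iff)
    also have "\<dots> = (\<Prod>x\<in>?I. if x = 0 then 4 else 2)"
      by (subst prod.reindex) (auto simp: inj_on_def wt_def)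
    \<comment> \<open>The free boundary has 2n - 1 points; the apex contributes 4 = 2 * 2, hence the
      exponent 2n.\<close>
    also have "\<dots> = 4 * (\<Prod>x\<in>?I - {0}. if x = 0 then 4 else 2)"
      using n by (subst prod.remove[of _ 0]) auto
    also have "(\<Prod>x\<in>?I - {0}. if x = 0 then 4 else 2 :: real) = (\<Prod>x\<in>?I - {0}. 2)"
      by (intro prod.cong) auto
    also have "\<dots> = 2 ^ (2 * n - 2)"
      using n by (simp add: nat_diff_distrib')
    also have "4 * \<dots> = (2 :: real) ^ (2 * n)"
      using n by (cases n) (auto simp: power_add)
    finally show ?thesis .
  qed
  ultimately show ?thesis by simp
qed

section \<open>Temperley's bijection\<close>

definition same_class :: "int \<times> int \<Rightarrow> int \<times> int \<Rightarrow> bool" where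
  "same_class p q \<longleftrightarrow> even (fst p - fst q) \<and> even (snd p - snd q)"

lemma same_class_steps:
  assumes "d \<in> steps" "d' \<in> steps" "same_class (p + d) (p + d')"
  shows "d' = d \<or> d' = - d"
  using assms by (auto simp: steps_def same_class_def)

lemma steps_uminus: "d \<in> steps \<Longrightarrow> - d \<in> steps"
  by (auto simp: steps_def)

lemma steps_double: "d \<in> steps \<Longrightarrow> d + d \<noteq> 0"
  by (auto simp: steps_def zero_prod_def)

lemma same_class_sym: "same_class p q \<Longrightarrow> same_class q p"
  by (auto simp: same_class_def)

lemma same_class_trans: "same_class p q \<Longrightarrow> same_class q r \<Longrightarrow> same_class p r"
  unfolding same_class_def by presburger

lemma same_class_double_step: "d \<in> steps \<Longrightarrow> same_class (p + d + d) q \<longleftrightarrow> same_class p q"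
  by (cases p; cases d) (auto simp: same_class_def)

text \<open>A discrete form of having no holes. An upward ray avoiding \<open>R\<close> rules out
  crossings directly; a rightward one is followed until every crossing lies to the left.\<close>

definition right_up_convex :: "(int \<times> int) set \<Rightarrow> bool" where
  "right_up_convex R \<longleftrightarrow>
     (\<forall>p. p \<notin> R \<longrightarrow> (\<forall>k::nat. p + (0, int k) \<notin> R) \<or> (\<forall>k::nat. p + (int k, 0) \<notin> R))"

locale matched_region =
  fixes R :: "(int \<times> int) set" and mu :: "int \<times> int \<Rightarrow> int \<times> int"
  assumes finR: "finite R"
    and outside: "right_up_convex R"
    and mu_in: "p \<in> R \<Longrightarrow> mu p \<in> R"
    and mu_mu: "p \<in> R \<Longrightarrow> mu (mu p) = p"
    and mu_adj: "p \<in> R \<Longrightarrow> mu p - p \<in> steps"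
begin

text \<open>Passes through the partner to the opposite point, so the parity class is kept: vertices
  lead to vertices and faces to faces.\<close>

definition nx :: "int \<times> int \<Rightarrow> int \<times> int" where
  "nx p = p + (mu p - p) + (mu p - p)"

text \<open>The partners \<open>Z\<close> of a set stable under \<open>nx\<close> form closed curves. The points encircled an odd
  number of times (\<open>inside\<close>, counted by the crossings of the vertical ray upwards) lie in the opposite
  parity class, cannot be left by \<open>nx\<close>, and lie strictly lower.\<close>

context
  fixes S c
  assumes S: "S \<subseteq> R" "S \<noteq> {}" "nx ` S = S" and Sc: "\<And>s. s \<in> S \<Longrightarrow> same_class s c"
begin

definition Z where "Z = mu ` S"

definition inside :: "int \<times> int \<Rightarrow> bool" where
  "inside p \<longleftrightarrow> odd (card {k::nat. p + (0, 2 * int k + 1) \<in> Z})"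

lemma Z_R: "Z \<subseteq> R" using S mu_in by (auto simp: Z_def)

lemma finite_Z: "finite Z" using Z_R finR finite_subset by blast

lemma inj_nx: "inj_on nx S"
  using S(1,3) finR finite_subset by (metis eq_card_imp_inj_on)

text \<open>The two are the partner of \<open>q\<close> and the partner of its predecessor under
  \<open>nx\<close>, which permutes the finite set \<open>S\<close>. They differ since
  \<open>mu\<close> is an involution.\<close>

lemma Z_neighbours_in:
  assumes q: "q \<in> S"
  shows "\<exists>a\<in>steps. \<exists>b\<in>steps. a \<noteq> b \<and> (\<forall>d\<in>steps. q + d \<in> Z \<longleftrightarrow> d = a \<or> d = b)"
proof -
  have "q \<in> nx ` S" using S(3) q by simp
  then obtain q' where q': "q' \<in> S" "nx q' = q" by (elim imageE) simp
  define a where "a = mu q - q"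
  define d' where "d' = mu q' - q'"
  have R: "q \<in> R" "q' \<in> R" using q q' S by auto
  have a: "a \<in> steps" and d': "d' \<in> steps" using R mu_adj by (simp_all add: a_def d'_def)
  have mq: "mu q = q + a" and mq': "mu q' = q' + d'" by (simp_all add: a_def d'_def)
  have q_eq: "q = q' + d' + d'" using q'(2) by (simp add: nx_def d'_def)
  define b where "b = - d'"
  have b: "b \<in> steps" using d' by (simp add: b_def steps_uminus)
  have qb: "q + b = mu q'" by (simp add: b_def q_eq mq')
  have "a \<noteq> b"
  proof
    assume "a = b"
    then have "mu q = mu q'" using qb mq by simp
    then have "q = q'" using mu_mu R by metis
    then show False using q_eq steps_double[OF d'] by (simp add: add.assoc)
  qed
  moreover have "q + d \<in> Z \<longleftrightarrow> d = a \<or> d = b" if d: "d \<in> steps" for d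
  proof
    assume "q + d \<in> Z"
    then obtain s where s: "s \<in> S" "q + d = mu s" by (auto simp: Z_def)
    have sR: "s \<in> R" using s S by auto
    define e where "e = mu s - s"
    have e: "e \<in> steps" using sR mu_adj by (simp add: e_def)
    have s_eq: "s = q + d - e" using s(2) by (simp add: e_def)
    have "same_class s q" using Sc s(1) q same_class_sym same_class_trans by blast
    then have "same_class (q + e) (q + d)"
      unfolding s_eq by (auto simp: same_class_def)
    from same_class_steps[OF e d this] show "d = a \<or> d = b"
    proof
      assume "d = e"
      then have "s = q" using s_eq by simp
      then have "q + d = q + a" using s(2) mq by simp
      then show ?thesis by simp
    next
      assume de: "d = - e"
      have "nx s = s + e + e" by (simp add: nx_def e_def)
      also have "\<dots> = q" by (simp add: s_eq de)
      finally have "nx s = nx q'" using q' by simp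
      then have "s = q'" using inj_nx s(1) q'(1) by (auto dest: inj_onD)
      then have "q + d = q + b" using s(2) qb by simp
      then show ?thesis by simp
    qed
  next
    assume "d = a \<or> d = b"
    then have "q + d = mu q \<or> q + d = mu q'" using mq qb by auto
    then show "q + d \<in> Z" using q q' by (auto simp: Z_def)
  qed
  ultimately show ?thesis using a b by blast
qed

lemma Z_neighbours_out:
  assumes q: "same_class q c" "q \<notin> S" and d: "d \<in> steps"
  shows "q + d \<notin> Z"
proof
  assume "q + d \<in> Z"
  then obtain s where s: "s \<in> S" "q + d = mu s" by (auto simp: Z_def)
  have sR: "s \<in> R" using s S by auto
  define e where "e = mu s - s"
  have e: "e \<in> steps" using sR mu_adj by (simp add: e_def)
  have s_eq: "s = q + d - e" using s(2) by (simp add: e_def)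
  have "same_class s q" using Sc s(1) q same_class_sym same_class_trans by blast
  then have "same_class (q + e) (q + d)"
    unfolding s_eq by (auto simp: same_class_def)
  from same_class_steps[OF e d this] show False
  proof
    assume "d = e"
    then have "s = q" using s_eq by simp
    then show False using s q by simp
  next
    assume de: "d = - e"
    have "nx s = s + e + e" by (simp add: nx_def e_def)
    also have "\<dots> = q" by (simp add: s_eq de)
    finally show False using S(3) s(1) q(2) by blast
  qed
qed

text \<open>The nested equivalences say that an even number of the four neighbours lies in
  \<open>Z\<close>: two at points of \<open>S\<close>, none at other points of the class.\<close>

lemma Z_even_degree:
  assumes "same_class q c"
  shows "(q + (1, 0) \<in> Z) \<longleftrightarrow> ((q + (-1, 0) \<in> Z) \<longleftrightarrow> ((q + (0, 1) \<in> Z) \<longleftrightarrow> (q + (0, -1) \<in> Z)))"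
proof (cases "q \<in> S")
  case True
  from Z_neighbours_in[OF this] obtain a b where ab: "a \<in> steps" "b \<in> steps" "a \<noteq> b"
    "\<forall>d\<in>steps. q + d \<in> Z \<longleftrightarrow> d = a \<or> d = b" by (elim bexE conjE)
  have m: "(1, 0) \<in> steps" "(-1, 0) \<in> steps" "(0, 1) \<in> steps" "(0, -1) \<in> steps"
    by (simp_all add: steps_def)
  from ab(1-3) show ?thesis
    unfolding m[THEN ab(4)[rule_format]] unfolding steps_def by (elim insertE emptyE) simp_all
next
  case False
  then show ?thesis using Z_neighbours_out[OF assms False] by (auto simp: steps_def)
qed

lemma inside_above: "inside p \<Longrightarrow> \<exists>k::nat. p + (0, 2 * int k + 1) \<in> Z"
  by (rule ccontr) (simp add: inside_def)

lemma inside_up: "inside p \<longleftrightarrow> (inside (p + (0, 2)) \<longleftrightarrow> p + (0, 1) \<notin> Z)"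
proof -
  let ?A = "\<lambda>p. {k::nat. p + (0, 2 * int k + 1) \<in> Z}"
  have fin: "finite (?A p)" for p
  proof (rule finite_imageD)
    show "finite ((\<lambda>k. p + (0, 2 * int k + 1)) ` ?A p)"
      by (rule finite_subset[OF _ finite_Z]) auto
  qed (auto simp: inj_on_def)
  have eq: "p + (0, 2 * int (Suc k) + 1) = p + (0, 2) + (0, 2 * int k + 1)" for k
    by (cases p) simp
  have "?A p = {k. k = 0 \<and> p + (0, 1) \<in> Z} \<union> Suc ` ?A (p + (0, 2))"
  proof (rule Set.set_eqI)
    fix k
    show "k \<in> ?A p \<longleftrightarrow> k \<in> {k. k = 0 \<and> p + (0, 1) \<in> Z} \<union> Suc ` ?A (p + (0, 2))"
    proof (cases k)
      case 0
      then show ?thesis by auto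
    next
      case (Suc j)
      have "k \<in> ?A p \<longleftrightarrow> j \<in> ?A (p + (0, 2))" unfolding Suc mem_Collect_eq eq ..
      then show ?thesis using Suc by (simp add: inj_image_mem_iff)
    qed
  qed
  then have "card (?A p) = card {k::nat. k = 0 \<and> p + (0, 1) \<in> Z} + card (?A (p + (0, 2)))"
    using fin by (simp add: card_Un_disjoint card_image disjoint_iff)
  moreover have "card {k::nat. k = 0 \<and> p + (0, 1) \<in> Z} = of_bool (p + (0, 1) \<in> Z)"
    by auto
  ultimately show ?thesis by (auto simp: inside_def)
qed

text \<open>The crossing rule for horizontal moves, although \<open>inside\<close> counts along
  vertical rays. The induction starts above all of \<open>Z\<close> and goes down; the even number
  of crossings around p + (1, 1) makes the four corners about it consistent.\<close>

lemma inside_right: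
  assumes "same_class (p + (1, 1)) c"
  shows "inside p \<longleftrightarrow> (inside (p + (2, 0)) \<longleftrightarrow> p + (1, 0) \<notin> Z)"
proof -
  have "bdd_above (snd ` Z)" using finite_Z by simp
  then obtain H where "\<forall>w\<in>Z. snd w \<le> H" by (auto simp: bdd_above_def)
  then have H: "snd w < H + 1" if "w \<in> Z" for w using that by fastforce
  show ?thesis using assms
  proof (induction "nat (H + 1 - snd p)" arbitrary: p rule: less_induct)
    case less
    show ?case
    proof (cases "snd p \<ge> H + 1")
      case True
      have no: "w \<notin> Z" if "snd w \<ge> snd p" for w using H[of w] that True by auto
      have "\<not> inside r" if "snd r = snd p" for r
      proof
        assume "inside r"
        then obtain k :: nat where "r + (0, 2 * int k + 1) \<in> Z" using inside_above by blast
        with no[of "r + (0, 2 * int k + 1)"] that show False by simp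
      qed
      then have "\<not> inside p" "\<not> inside (p + (2, 0))" by simp_all
      moreover have "p + (1, 0) \<notin> Z" by (rule no) simp
      ultimately show ?thesis by simp
    next
      case False
      let ?p = "p + (0, 2)" and ?q = "p + (1, 1)"
      have "same_class (?p + (1, 1)) c" using less.prems by (cases p) (auto simp: same_class_def)
      then have "inside ?p \<longleftrightarrow> (inside (?p + (2, 0)) \<longleftrightarrow> ?p + (1, 0) \<notin> Z)"
        using False by (intro less.hyps) auto
      moreover have eqs: "?q + (1, 0) = p + (2, 0) + (0, 1)" "?q + (-1, 0) = p + (0, 1)"
        "?q + (0, 1) = ?p + (1, 0)" "?q + (0, -1) = p + (1, 0)"
        by (cases p, simp)+
      moreover have eq: "p + (2, 0) + (0, 2) = ?p + (2, 0)" by (cases p) simp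
      ultimately show ?thesis
        using Z_even_degree[OF less.prems, unfolded eqs] inside_up[of p]
          inside_up[of "p + (2, 0)", unfolded eq] by argo
    qed
  qed
qed

lemma inside_step:
  assumes p: "same_class (p + (1, 1)) c" and d: "d \<in> steps"
  shows "inside (p + d + d) \<longleftrightarrow> (inside p \<longleftrightarrow> p + d \<notin> Z)"
proof -
  obtain x y where xy: "p = (x, y)" by fastforce
  have left: "same_class ((x - 2, y) + (1, 1)) c" using p by (auto simp: xy same_class_def)
  from d consider "d = (1, 0)" | "d = (-1, 0)" | "d = (0, 1)" | "d = (0, -1)"
    unfolding steps_def by blast
  then show ?thesis
  proof cases
    case 1
    then show ?thesis using inside_right[OF p] by (auto simp: xy add.commute)
  next
    case 2
    then show ?thesis using inside_right[OF left] by (auto simp: xy)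
  next
    case 3
    then show ?thesis using inside_up[of p] by (auto simp: xy add.commute)
  next
    case 4
    then show ?thesis using inside_up[of "(x, y - 2)"] by (auto simp: xy)
  qed
qed

text \<open>Seen from a point outside \<open>R\<close>, a free upward ray carries no crossing; along
  a free rightward ray the property of being inside would persist beyond the last column of
  \<open>Z\<close>.\<close>

lemma inside_R:
  assumes p: "same_class (p + (1, 1)) c" and i: "inside p"
  shows "p \<in> R"
proof (rule ccontr)
  assume "p \<notin> R"
  with outside consider "\<forall>k::nat. p + (0, int k) \<notin> R" | "\<forall>k::nat. p + (int k, 0) \<notin> R"
    unfolding right_up_convex_def by blast
  then show False
  proof cases
    case 1
    from inside_above[OF i] obtain k :: nat where "p + (0, 2 * int k + 1) \<in> Z" by blast
    then show False using 1[rule_format, of "2 * k + 1"] Z_R by (auto simp: add_ac)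
  next
    case 2
    have "inside (p + (2 * int k, 0))" for k :: nat
    proof (induction k)
      case 0
      then show ?case using i by (cases p) simp
    next
      case (Suc k)
      let ?p = "p + (2 * int k, 0)"
      have "?p + (1, 0) = p + (int (2 * k + 1), 0)" by (cases p) simp
      then have "?p + (1, 0) \<notin> Z" using 2 Z_R by (metis subsetD)
      moreover have "same_class (?p + (1, 1)) c" using p by (auto simp: same_class_def)
      moreover have eq: "p + (2 * int (Suc k), 0) = ?p + (2, 0)" by (cases p) simp
      ultimately show ?case unfolding eq using inside_right[of ?p] Suc by blast
    qed
    note right = this
    have "bdd_above (fst ` Z)" using finite_Z by simp
    then obtain B where B: "\<forall>w\<in>Z. fst w \<le> B" by (auto simp: bdd_above_def)
    from inside_above[OF right[of "nat (B - fst p + 1)"]] obtain k :: nat where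
      "p + (2 * int (nat (B - fst p + 1)), 0) + (0, 2 * int k + 1) \<in> Z" by blast
    from B[rule_format, OF this] have "fst p + 2 * int (nat (B - fst p + 1)) \<le> B" by simp
    moreover have "inside p" by (rule i)
    then obtain k :: nat where "p + (0, 2 * int k + 1) \<in> Z" using inside_above by blast
    from B[rule_format, OF this] have "fst p \<le> B" by simp
    ultimately show False by simp
  qed
qed

text \<open>The witness is the set of enclosed points of the opposite class. Their partners are not
  in \<open>Z\<close>, whose points are matched to \<open>S\<close>, so \<open>nx\<close> never
  crosses the curves.\<close>

lemma descent:
  "\<exists>A\<subseteq>R. A \<noteq> {} \<and> nx ` A \<subseteq> A \<and> (\<forall>p\<in>A. same_class p (c + (1, 1))) \<and> Max (snd ` A) < Max (snd ` S)"
proof -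
  let ?A = "{p. same_class (p + (1, 1)) c \<and> inside p}"
  have AR: "?A \<subseteq> R" using inside_R by blast
  have finS: "finite S" using S finR finite_subset by blast
  have "Max (snd ` S) \<in> snd ` S" using finS S(2) by (intro Max_in) auto
  then obtain t where t: "t \<in> S" "snd t = Max (snd ` S)" by (elim imageE) simp
  have tmax: "snd s \<le> snd t" if "s \<in> S" for s using t finS that by simp
  have Zmax: "snd w \<le> snd t + 1" if w: "w \<in> Z" for w
  proof -
    obtain s where s: "s \<in> S" "w = mu s" using w by (auto simp: Z_def)
    have "snd d \<le> 1" if "d \<in> steps" for d using that by (auto simp: steps_def)
    moreover have "mu s - s \<in> steps" using mu_adj s S by blast
    ultimately have "snd (mu s - s) \<le> 1" by blast
    then show ?thesis using tmax[OF s(1)] s(2) by simp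
  qed
  have closed: "nx ` ?A \<subseteq> ?A"
  proof (rule image_subsetI)
    fix p assume p: "p \<in> ?A"
    then have pR: "p \<in> R" using AR by blast
    let ?d = "mu p - p"
    have "p + ?d \<notin> Z"
    proof
      assume "p + ?d \<in> Z"
      then obtain s where s: "s \<in> S" "mu p = mu s" by (auto simp: Z_def)
      then have "p = s" using mu_mu pR S by (metis subsetD)
      then show False using Sc[OF s(1)] p by (auto simp: same_class_def)
    qed
    then have "inside (nx p)"
      using inside_step[of p ?d] p mu_adj[OF pR] by (simp add: nx_def)
    moreover have "same_class (nx p + (1, 1)) c"
    proof -
      have "same_class (p + (1, 1) + ?d + ?d) c"
        using p mu_adj[OF pR] by (simp only: same_class_double_step) simp
      then show ?thesis by (simp add: nx_def add_ac)
    qed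
    ultimately show "nx p \<in> ?A" by simp
  qed
  have ne: "?A \<noteq> {}"
  proof -
    from Z_neighbours_in[OF t(1)] obtain a b where ab: "a \<in> steps" "b \<in> steps" "a \<noteq> b"
      "\<forall>d\<in>steps. t + d \<in> Z \<longleftrightarrow> d = a \<or> d = b" by blast
    \<comment> \<open>Otherwise the next point of the class above \<open>t\<close> would have a
      neighbour in \<open>Z\<close>, hence lie in \<open>S\<close>, although \<open>t\<close> is
      topmost.\<close>
    have up: "t + (0, 1) \<notin> Z"
    proof
      assume z: "t + (0, 1) \<in> Z"
      have "t + (0, 2) \<in> S"
      proof (rule ccontr)
        assume "t + (0, 2) \<notin> S"
        moreover have "same_class (t + (0, 2)) c" using Sc[OF t(1)] by (auto simp: same_class_def)
        ultimately have "t + (0, 2) + (0, -1) \<notin> Z"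
          by (intro Z_neighbours_out) (auto simp: steps_def)
        moreover have "t + (0, 2) + (0, -1) = t + (0, 1)" by (cases t) simp
        ultimately show False using z by simp
      qed
      then show False using tmax[of "t + (0, 2)"] by simp
    qed
    \<comment> \<open>At least one of the two neighbours of \<open>t\<close> in \<open>Z\<close> is
      therefore horizontal, and the point directly below that neighbour has it as its only
      crossing.\<close>
    then have "\<exists>e\<in>{1, -1}. t + (e, 0) \<in> Z" using ab by (auto simp: steps_def)
    then obtain e where e: "e \<in> {1, -1}" "t + (e, 0) \<in> Z" by blast
    let ?p = "t + (e, -1)"
    have "\<not> inside (?p + (0, 2))"
    proof
      assume "inside (?p + (0, 2))"
      then obtain k :: nat where "?p + (0, 2) + (0, 2 * int k + 1) \<in> Z" using inside_above by blast
      from Zmax[OF this] show False by simp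
    qed
    moreover have "?p + (0, 1) = t + (e, 0)" by (cases t) simp
    with e(2) have "?p + (0, 1) \<in> Z" by (simp only:)
    ultimately have "inside ?p" using inside_up[of ?p] by blast
    moreover have "same_class (?p + (1, 1)) c" using Sc[OF t(1)] e by (auto simp: same_class_def)
    ultimately show ?thesis by blast
  qed
  \<comment> \<open>Some crossing lies above \<open>p\<close>, at height at most snd t + 1; equal
    heights are excluded by parity.\<close>
  have low: "snd p < snd t" if p: "p \<in> ?A" for p
  proof -
    obtain k :: nat where "p + (0, 2 * int k + 1) \<in> Z" using p inside_above by blast
    from Zmax[OF this] have "snd p \<le> snd t" by simp
    moreover have "snd p \<noteq> snd t" using p Sc[OF t(1)] by (auto simp: same_class_def)
    ultimately show ?thesis by simp
  qed
  have finA: "finite ?A" using AR finR finite_subset by blast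
  have "Max (snd ` ?A) < Max (snd ` S)"
    unfolding t(2)[symmetric] using low ne finA by (subst Max_less_iff) auto
  moreover have "\<forall>p\<in>?A. same_class p (c + (1, 1))" by (auto simp: same_class_def)
  ultimately show ?thesis using AR ne closed by blast
qed

end

text \<open>Infinite descent: a closed set in one class yields a lower one in the opposite class,
  and heights in \<open>R\<close> are bounded below. This replaces the usual count that a cycle
  encloses an odd number of points, which no matching can cover.\<close>

theorem no_closed_class:
  assumes "A \<subseteq> R" "nx ` A \<subseteq> A" "\<And>p. p \<in> A \<Longrightarrow> same_class p c"
  shows "A = {}"
proof -
  have "bdd_below (snd ` R)" using finR by simp
  then obtain L where L: "\<forall>p\<in>R. L \<le> snd p" by (auto simp: bdd_below_def)
  have False if "A \<subseteq> R" "A \<noteq> {}" "nx ` A \<subseteq> A" "\<forall>p\<in>A. same_class p c" for A c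
    using that
  proof (induction "nat (Max (snd ` A) - L)" arbitrary: A c rule: less_induct)
    case less
    have finA: "finite A" using less.prems finR finite_subset by blast
    from exists_stable_subset[OF finA less.prems(2,3)] obtain S where
      S: "S \<subseteq> A" "S \<noteq> {}" "nx ` S = S" by (elim exE conjE)
    have SR: "S \<subseteq> R" using S(1) less.prems(1) by (rule subset_trans)
    have Sc: "same_class s c" if "s \<in> S" for s using that S(1) less.prems(4) by blast
    have "\<exists>B\<subseteq>R. B \<noteq> {} \<and> nx ` B \<subseteq> B \<and> (\<forall>p\<in>B. same_class p (c + (1, 1))) \<and>
        Max (snd ` B) < Max (snd ` S)"
      using SR S(2,3) Sc by (rule descent)
    then obtain B where
      B: "B \<subseteq> R" "B \<noteq> {}" "nx ` B \<subseteq> B" "\<forall>p\<in>B. same_class p (c + (1, 1))"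
      "Max (snd ` B) < Max (snd ` S)" by (elim exE conjE)
    have "Max (snd ` S) \<le> Max (snd ` A)" using S finA by (intro Max_mono) auto
    moreover have "L \<le> Max (snd ` B)"
    proof -
      have "finite B" using B finR finite_subset by blast
      with B(2) have "Max (snd ` B) \<in> snd ` B" by (intro Max_in) auto
      then obtain b where "b \<in> B" "Max (snd ` B) = snd b" by (elim imageE)
      then show ?thesis using L B(1) by auto
    qed
    ultimately have "nat (Max (snd ` B) - L) < nat (Max (snd ` A) - L)" using B(5) by simp
    from less.hyps[OF this B(1-4)] show False .
  qed
  with assms show ?thesis by blast
qed

end

section \<open>Perfect matchings as partner functions, and the map from matchings to forests\<close>

lemma grid_adj_steps: "grid_adj p q \<longleftrightarrow> q - p \<in> steps"
proof -
  have "\<bar>a\<bar> + \<bar>b\<bar> = 1 \<longleftrightarrow> (a, b) \<in> steps" for a b :: int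
    by (auto simp: steps_def)
  from this[of "fst q - fst p" "snd q - snd p"] show ?thesis
    by (cases p; cases q) (simp add: grid_adj_def abs_minus_commute)
qed

lemma grid_edge_iff: "{p, q} \<in> edges (grid_graph R) \<longleftrightarrow> p \<in> R \<and> q \<in> R \<and> q - p \<in> steps"
proof -
  have "p - q \<in> steps \<longleftrightarrow> q - p \<in> steps" for p q :: "int \<times> int"
    using steps_uminus[of "p - q"] steps_uminus[of "q - p"] by auto
  then show ?thesis
    unfolding grid_graph_def grid_adj_steps snd_conv mem_Collect_eq doubleton_eq_iff by metis
qed

lemma grid_edgeE:
  assumes "e \<in> edges (grid_graph R)"
  obtains p q where "e = {p, q}" "p \<in> R" "q \<in> R" "q - p \<in> steps"
  using assms by (auto simp: grid_graph_def grid_adj_steps)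

lemma verts_grid [simp]: "verts (grid_graph R) = R"
  by (simp add: grid_graph_def)

definition partner :: "(int \<times> int) set set \<Rightarrow> int \<times> int \<Rightarrow> int \<times> int" where
  "partner X u = (SOME w. {u, w} \<in> X)"

lemma partner_perfect_matching:
  assumes X: "X \<in> perfect_matchings (grid_graph R)"
  shows "u \<in> R \<Longrightarrow> {u, partner X u} \<in> X"
    and "u \<in> R \<Longrightarrow> {u, w} \<in> X \<Longrightarrow> w = partner X u"
    and "u \<in> R \<Longrightarrow> partner X u \<in> R"
    and "u \<in> R \<Longrightarrow> partner X (partner X u) = u"
    and "u \<in> R \<Longrightarrow> partner X u - u \<in> steps"
proof -
  have sub: "X \<subseteq> edges (grid_graph R)" and uniq: "\<exists>!e. e \<in> X \<and> u \<in> e" if "u \<in> R" for u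
    using X that by (auto simp: perfect_matchings_def)
  have 1: "{u, partner X u} \<in> X" if "u \<in> R" for u
  proof -
    obtain e where e: "e \<in> X" "u \<in> e" using uniq[OF \<open>u \<in> R\<close>] by blast
    with sub[OF that] obtain p q where "e = {p, q}" by (meson grid_edgeE subsetD)
    with e have "{u, q} \<in> X \<or> {u, p} \<in> X" by (auto simp: insert_commute)
    then have "\<exists>w. {u, w} \<in> X" by blast
    then show ?thesis unfolding partner_def by (rule someI_ex)
  qed
  have 2: "w = partner X u" if u: "u \<in> R" and w: "{u, w} \<in> X" for u w
  proof -
    have "{u, w} = {u, partner X u}" using uniq[OF u] w 1[OF u] by blast
    then show ?thesis by (auto simp: doubleton_eq_iff)
  qed
  show "u \<in> R \<Longrightarrow> {u, partner X u} \<in> X" by (rule 1)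
  show "u \<in> R \<Longrightarrow> {u, w} \<in> X \<Longrightarrow> w = partner X u" by (rule 2)
  have e: "{u, partner X u} \<in> edges (grid_graph R)" if "u \<in> R" for u using 1 sub that by blast
  show 3: "u \<in> R \<Longrightarrow> partner X u \<in> R" using e by (auto simp: grid_edge_iff)
  show "u \<in> R \<Longrightarrow> partner X u - u \<in> steps" using e by (auto simp: grid_edge_iff)
  show "u \<in> R \<Longrightarrow> partner X (partner X u) = u"
    using 2[of "partner X u" u] 1[of u] 3 by (simp add: insert_commute)
qed

lemma perfect_matching_eq_partner:
  assumes X: "X \<in> perfect_matchings (grid_graph R)"
  shows "X = (\<lambda>u. {u, partner X u}) ` R"
proof
  show "(\<lambda>u. {u, partner X u}) ` R \<subseteq> X" using partner_perfect_matching[OF X] by blast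
  show "X \<subseteq> (\<lambda>u. {u, partner X u}) ` R"
  proof
    fix e assume e: "e \<in> X"
    with X have "e \<in> edges (grid_graph R)" by (auto simp: perfect_matchings_def)
    then obtain p q where pq: "e = {p, q}" "p \<in> R" by (elim grid_edgeE)
    with partner_perfect_matching(2)[OF X, of p q] e show "e \<in> (\<lambda>u. {u, partner X u}) ` R" by auto
  qed
qed

text \<open>The points of \<open>R\<close> in the parity class of \<open>a\<close> are the vertices \<open>V\<close> of a planar graph, those in the
  class of \<open>a + (1, 1)\<close> its bounded faces \<open>F\<close>, and the remaining ones its edges \<open>E\<close>. Vertices outside \<open>R\<close>
  form the root and faces outside \<open>R\<close> the outer face; \<open>pair\<close> gives \<open>card E = card V + card F\<close>.\<close>

locale temperley =
  fixes R :: "(int \<times> int) set" and a :: "int \<times> int"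
  assumes finR: "finite R"
    and outside: "right_up_convex R"
    and pair: "(x, y) \<in> R \<Longrightarrow> (x, if even y then y + 1 else y - 1) \<in> R"
    and corner: "v \<in> R \<Longrightarrow> same_class v a \<Longrightarrow> d \<in> steps \<Longrightarrow> e \<in> steps \<Longrightarrow>
      v + d + e \<in> R \<Longrightarrow> same_class (v + d + e) (a + (1, 1)) \<Longrightarrow> v + d \<in> R"
begin

definition V where "V = {p \<in> R. same_class p a}"
definition F where "F = {p \<in> R. same_class p (a + (1, 1))}"
definition E where "E = R - (V \<union> F)"

lemma finite_VFE: "finite V" "finite F" "finite E"
  using finR by (auto simp: V_def F_def E_def)

lemma V_F_disjoint: "V \<inter> F = {}"
  by (auto simp: V_def F_def same_class_def)

lemma VF_iff: "p \<in> V \<union> F \<longleftrightarrow> p \<in> R \<and> even (fst p + snd p - (fst a + snd a))"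
  by (auto simp: V_def F_def same_class_def)

lemma VF_step_E: "p \<in> V \<union> F \<Longrightarrow> d \<in> steps \<Longrightarrow> p + d \<in> R \<Longrightarrow> p + d \<in> E"
  by (auto simp: E_def VF_iff[of p, simplified] VF_iff[of "p + d", simplified] steps_def V_def F_def same_class_def)

lemma E_step_VF: "p \<in> E \<Longrightarrow> d \<in> steps \<Longrightarrow> p + d \<in> R \<Longrightarrow> p + d \<in> V \<union> F"
  by (auto simp: E_def steps_def V_def F_def same_class_def)

lemma E_iff: "p \<in> E \<longleftrightarrow> p \<in> R \<and> odd (fst p + snd p - (fst a + snd a))"
  unfolding E_def Diff_iff VF_iff by blast

text \<open>The vertical dominoes given by \<open>pair\<close> tile \<open>R\<close>, and each of
  them contains one point of \<open>E\<close> and one of \<open>V\<close> or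
  \<open>F\<close>.\<close>

lemma card_E: "card E = card (V \<union> F)"
proof -
  let ?t = "\<lambda>(x, y). (x, if even y then y + 1 else y - 1) :: int \<times> int"
  have t: "?t p \<in> R" if "p \<in> R" for p using pair that by (cases p) auto
  have tt: "?t (?t p) = p" for p by (cases p) auto
  have parity: "even (fst (?t p) + snd (?t p) - c) \<longleftrightarrow> odd (fst p + snd p - c)" for p c
    by (cases p) auto
  have "bij_betw ?t E (V \<union> F)"
  proof (rule bij_betw_byWitness[where f' = ?t])
    show "?t ` E \<subseteq> V \<union> F"
      using t parity by (intro image_subsetI) (simp only: VF_iff E_iff simp_thms)
    show "?t ` (V \<union> F) \<subseteq> E"
      using t parity by (intro image_subsetI) (simp only: VF_iff E_iff simp_thms)
  qed (use tt in blast)+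
  then show ?thesis by (rule bij_betw_same_card)
qed

definition choice_of :: "(int \<times> int) set set \<Rightarrow> int \<times> int \<Rightarrow> int \<times> int" where
  "choice_of X = restrict (\<lambda>v. partner X v - v) V"

abbreviation nxt :: "int \<times> int \<Rightarrow> int \<times> int \<Rightarrow> int \<times> int" where "nxt \<equiv> \<lambda>v d. v + d + d"

abbreviation forests where "forests \<equiv> escaping_choices V (region_choices R) nxt"

lemma matched:
  assumes "X \<in> perfect_matchings (grid_graph R)"
  shows "matched_region R (partner X)"
  using partner_perfect_matching[OF assms] finR outside by unfold_locales

lemma choice_of_forest:
  assumes X: "X \<in> perfect_matchings (grid_graph R)"
  shows "choice_of X \<in> forests"
proof -
  interpret matched_region R "partner X" using X by (rule matched)
  have "choice_of X v \<in> region_choices R v" if "v \<in> V" for v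
    using that mu_in[of v] mu_adj[of v] by (auto simp: choice_of_def region_choices_def V_def)
  then have "choice_of X \<in> Pi\<^sub>E V (region_choices R)" by (auto simp: choice_of_def)
  moreover have "escapes V (\<lambda>v. nxt v (choice_of X v))"
  proof (rule escapesI_closed)
    fix A assume A: "A \<subseteq> V" "A \<noteq> {}" "(\<lambda>v. nxt v (choice_of X v)) ` A \<subseteq> A"
    have "nx ` A = (\<lambda>v. nxt v (choice_of X v)) ` A"
    proof (rule image_cong[OF refl])
      fix v assume "v \<in> A"
      with A(1) have "v \<in> V" by blast
      then show "nx v = nxt v (choice_of X v)" by (simp add: nx_def choice_of_def)
    qed
    with A(3) have "nx ` A \<subseteq> A" by simp
    moreover have "A \<subseteq> R" "\<And>p. p \<in> A \<Longrightarrow> same_class p a" using A(1) by (auto simp: V_def)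
    ultimately show False using no_closed_class[of A a] A(2) by blast
  qed
  ultimately show ?thesis by (simp add: escaping_choices_def)
qed

text \<open>The faces on which two matchings with the same forest differ are closed under \<open>nx\<close>.\<close>

lemma inj_choice_of: "inj_on choice_of (perfect_matchings (grid_graph R))"
proof (rule inj_onI)
  fix X Y assume X: "X \<in> perfect_matchings (grid_graph R)" and Y: "Y \<in> perfect_matchings (grid_graph R)"
    and eq: "choice_of X = choice_of Y"
  interpret X: matched_region R "partner X" using X by (rule matched)
  interpret Y: matched_region R "partner Y" using Y by (rule matched)
  have eqV: "partner X v = partner Y v" if "v \<in> V" for v
    using fun_cong[OF eq, of v] that by (simp add: choice_of_def)
  define D where "D = {f \<in> F. partner X f \<noteq> partner Y f}"
  have "Y.nx ` D \<subseteq> D"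
  proof (rule image_subsetI)
    fix f assume f: "f \<in> D"
    then have fF: "f \<in> F" and fR: "f \<in> R" and ne: "partner X f \<noteq> partner Y f"
      by (auto simp: D_def F_def)
    define e where "e = partner Y f"
    define g where "g = partner X e"
    have eR: "e \<in> R" using Y.mu_in fR by (simp add: e_def)
    have "f + (partner Y f - f) \<in> E" using fF Y.mu_adj[OF fR] eR by (intro VF_step_E) (auto simp: e_def)
    then have eE: "e \<in> E" by (simp add: e_def)
    have gR: "g \<in> R" using X.mu_in eR by (simp add: g_def)
    have "e + (g - e) \<in> V \<union> F" using eE X.mu_adj[OF eR] gR by (intro E_step_VF) (auto simp: g_def)
    then have gVF: "g \<in> V \<union> F" by simp
    have Xg: "partner X g = e" using X.mu_mu[OF eR] by (simp add: g_def)
    have Ye: "partner Y e = f" using Y.mu_mu[OF fR] by (simp add: e_def)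
    have square_mode: "g \<noteq> f" using Xg ne by (auto simp: e_def)
    \<comment> \<open>The matchings agree on vertices: were \<open>g\<close> a vertex, its partner
      would be \<open>e\<close> in both, yet \<open>Y\<close> matches \<open>e\<close> with the face
      \<open>f\<close>.\<close>
    have gF: "g \<in> F"
    proof (rule ccontr)
      assume "g \<notin> F"
      then have gV: "g \<in> V" using gVF by blast
      then have "partner Y g = e" using Xg eqV by simp
      then have "g = f" using Ye Y.mu_mu[OF gR] by simp
      with square_mode show False by simp
    qed
    have "partner Y g \<noteq> e" using Ye Y.mu_mu[OF gR] square_mode by auto
    then have gD: "g \<in> D" using gF Xg by (auto simp: D_def)
    have d1: "g - e \<in> steps" using X.mu_adj[OF eR] by (simp add: g_def)
    have d2: "f - e \<in> steps" using Y.mu_adj[OF eR] by (simp add: Ye)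
    have "same_class (e + (g - e)) (e + (f - e))"
      using gF fF by (auto simp: F_def same_class_def)
    from same_class_steps[OF d1 d2 this] square_mode have "f - e = - (g - e)" by auto
    then have "g = e + (e - f)" by (simp add: algebra_simps)
    then have "g = Y.nx f" by (simp add: Y.nx_def e_def)
    with gD show "Y.nx f \<in> D" by simp
  qed
  then have "D = {}" by (rule Y.no_closed_class[of _ "a + (1, 1)", rotated]) (auto simp: D_def F_def)
  then have eqVF: "partner X v = partner Y v" if "v \<in> V \<union> F" for v
    using that eqV unfolding D_def by blast
  have "partner X u = partner Y u" if u: "u \<in> R" for u
  proof (cases "u \<in> V \<union> F")
    case False
    define w where "w = partner X u"
    have wR: "w \<in> R" using X.mu_in u by (simp add: w_def)
    have "u + (w - u) \<in> V \<union> F"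
      using False u X.mu_adj[OF u] wR by (intro E_step_VF) (auto simp: w_def E_def)
    then have "partner Y w = u" using eqVF[of w] X.mu_mu[OF u] by (simp add: w_def)
    then show ?thesis using Y.mu_mu[OF wR] by (simp add: w_def)
  qed (rule eqVF)
  then show "X = Y"
    using perfect_matching_eq_partner[OF X] perfect_matching_eq_partner[OF Y] by (metis (no_types, lifting) image_cong)
qed

end

section \<open>Surjectivity: the dual tree of a forest\<close>

context temperley
begin

context
  fixes f assumes f: "f \<in> forests"
begin

definition T where "T = (\<lambda>v. v + f v) ` V"

lemma f_choice: "v \<in> V \<Longrightarrow> f v \<in> steps" "v \<in> V \<Longrightarrow> v + f v \<in> R"
  using f by (auto simp: escaping_choices_def region_choices_def dest!: PiE_mem)

lemma f_escapes: "escapes V (\<lambda>v. nxt v (f v))"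
  using f by (simp add: escaping_choices_def)

text \<open>The neighbours of v + d in the class of \<open>v\<close> are its two ends
  \<open>v\<close> and v + d + d, so an edge of \<open>T\<close> not chosen at one end is chosen at
  the other.\<close>

lemma T_meets:
  assumes v: "v \<in> V" and d: "d \<in> steps" and T: "v + d \<in> T" and ne: "f v \<noteq> d"
  shows "v + d + d \<in> V \<and> f (v + d + d) = - d"
proof -
  obtain u where u: "u \<in> V" "v + d = u + f u" using T by (auto simp: T_def)
  have u_eq: "u = v + d - f u" using u(2) by (simp add: algebra_simps)
  have "same_class u v" using u(1) v by (auto simp: V_def same_class_def)
  then have "same_class (v + d - f u) v" using u_eq by simp
  then have "same_class (v + f u) (v + d)" by (auto simp: same_class_def)
  from same_class_steps[OF f_choice(1)[OF u(1)] d this] have "d = f u \<or> d = - f u" .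
  then show ?thesis
  proof
    assume "d = f u"
    then have "u = v" using u_eq by simp
    with ne \<open>d = f u\<close> show ?thesis by simp
  next
    assume "d = - f u"
    then have fu: "f u = - d" by simp
    then have "u = v + d + d" using u_eq by simp
    with u(1) fu show ?thesis by simp
  qed
qed

text \<open>The edge set bounding the faces that cannot reach the outer face across edges off the tree \<open>T\<close>
  lies in \<open>T\<close> and has even degree at every vertex, so each of its edges \<open>v + f v\<close> would have a predecessor
  in it, against the acyclicity of \<open>f\<close>.\<close>

definition reach where
  "reach S = {s \<in> F. \<exists>d\<in>steps. s + d \<in> R - T \<and> (s + d + d \<in> F \<longrightarrow> s + d + d \<in> S)}"

text \<open>Breadth-first search in the dual graph: the faces at most \<open>k\<close> crossings
  away from the outer face.\<close>

definition lev where "lev k = (reach ^^ k) {}"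

definition unreached where "unreached = F - (\<Union>k. lev k)"

lemma unreached_boundary:
  assumes s: "s \<in> unreached" and d: "d \<in> steps" "s + d \<in> R" "s + d + d \<notin> unreached"
  shows "s + d \<in> T"
proof (rule ccontr)
  assume nT: "s + d \<notin> T"
  have "\<exists>k. s + d + d \<in> F \<longrightarrow> s + d + d \<in> lev k" using d(3) unfolding unreached_def by blast
  then obtain k where "s + d + d \<in> F \<longrightarrow> s + d + d \<in> lev k" by blast
  with s d nT have "s \<in> lev (Suc k)" by (auto simp: lev_def reach_def unreached_def)
  with s show False unfolding unreached_def by blast
qed

text \<open>\<open>prod.swap d\<close> is perpendicular to a unit step \<open>d\<close>, so the
  faces on the two sides of the edge v + d are compared.\<close>

definition boundary :: "int \<times> int \<Rightarrow> int \<times> int \<Rightarrow> bool" where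
  "boundary v d \<longleftrightarrow> (v + d + prod.swap d \<in> unreached) \<noteq> (v + d - prod.swap d \<in> unreached)"

text \<open>Going once round the four faces at \<open>v\<close>, membership in
  \<open>unreached\<close> changes an even number of times.\<close>

lemma boundary_even:
  assumes "d \<in> steps" "boundary v d"
  shows "\<exists>d'\<in>steps. d' \<noteq> d \<and> boundary v d'"
proof -
  obtain x y where v: "v = (x, y)" by fastforce
  let ?c = "\<lambda>i j. (x + i, y + j) \<in> unreached"
  have b: "boundary v (1, 0) \<longleftrightarrow> ?c 1 1 \<noteq> ?c 1 (-1)" "boundary v (-1, 0) \<longleftrightarrow> ?c (-1) (-1) \<noteq> ?c (-1) 1"
    "boundary v (0, 1) \<longleftrightarrow> ?c 1 1 \<noteq> ?c (-1) 1" "boundary v (0, -1) \<longleftrightarrow> ?c (-1) (-1) \<noteq> ?c 1 (-1)"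
    by (simp_all add: boundary_def v)
  from assms show ?thesis unfolding steps_def by (elim insertE emptyE) (auto simp: b)
qed

lemma boundary_flip: "boundary (v + d + d) (- d) \<longleftrightarrow> boundary v d"
proof -
  have "v + d + d + - d + prod.swap (- d) = v + d - prod.swap d"
    "v + d + d + - d - prod.swap (- d) = v + d + prod.swap d"
    by (cases v; cases d; simp)+
  then show ?thesis by (auto simp: boundary_def)
qed

text \<open>By \<open>corner\<close> an edge at \<open>v\<close> that borders a face of
  \<open>F\<close> lies in the region; the unreached face could cross it unless it belonged to
  \<open>T\<close>.\<close>

lemma boundary_T:
  assumes v: "v \<in> V" and d: "d \<in> steps" and b: "boundary v d"
  shows "v + d \<in> T"
proof -
  have "\<exists>e\<in>steps. v + d + e \<in> unreached \<and> v + d - e \<notin> unreached"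
  proof (cases "v + d + prod.swap d \<in> unreached")
    case True
    then show ?thesis using b d
      by (intro bexI[of _ "prod.swap d"]) (auto simp: boundary_def steps_def)
  next
    case False
    then show ?thesis using b d
      by (intro bexI[of _ "- prod.swap d"]) (auto simp: boundary_def steps_def)
  qed
  then obtain e where e: "e \<in> steps" "v + d + e \<in> unreached" "v + d - e \<notin> unreached" by blast
  have "v + d + e \<in> F" using e(2) by (simp add: unreached_def)
  then have "v + d \<in> R"
    using v by (intro corner[of v d e] d e(1)) (auto simp: V_def F_def)
  moreover have "v + d + e + - e = v + d" "v + d + e + - e + - e = v + d - e" by simp_all
  ultimately show ?thesis
    using unreached_boundary[OF e(2) steps_uminus[OF e(1)]] e(3) by metis
qed

lemma no_boundary: "v \<in> V \<Longrightarrow> \<not> boundary v (f v)"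
proof -
  let ?W = "{v \<in> V. boundary v (f v)}"
  have "?W \<subseteq> (\<lambda>v. nxt v (f v)) ` ?W"
  proof
    fix v assume v: "v \<in> ?W"
    then have vV: "v \<in> V" by simp
    from v boundary_even[OF f_choice(1)[OF vV]] obtain d where
      d: "d \<in> steps" "d \<noteq> f v" "boundary v d" by blast
    let ?u = "v + d + d"
    from T_meets[OF vV d(1) boundary_T[OF vV d(1,3)]] d(2)
    have u: "?u \<in> V" "f ?u = - d" by auto
    then have "?u \<in> ?W" using boundary_flip d(3) by simp
    moreover have "v = nxt ?u (f ?u)" by (simp add: u(2))
    ultimately show "v \<in> (\<lambda>v. nxt v (f v)) ` ?W" by blast
  qed
  then have "?W = {}"
    using f_escapes finite_VFE(1) by (intro escapes_no_covered[of V "\<lambda>v. nxt v (f v)"]) auto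
  then show "v \<in> V \<Longrightarrow> \<not> boundary v (f v)" by blast
qed

text \<open>An unreached face, extremal in a direction where an edge is sure to exist, has that edge
  between itself and no unreached face. The edge is then chosen by some vertex and lies on the
  boundary.\<close>

lemma all_reached: "unreached = {}"
proof (rule ccontr)
  assume ne: "unreached \<noteq> {}"
  have fin: "finite unreached" using finite_VFE by (simp add: unreached_def)
  \<comment> \<open>The sign is the direction in which \<open>pair\<close> places the domino partner
    of a face, read off the parity of its height; so \<open>s + e\<close> lies in
    \<open>R\<close>.\<close>
  define \<epsilon> :: int where "\<epsilon> = (if even (snd a) then -1 else 1)"
  let ?g = "\<lambda>s. \<epsilon> * snd s"
  have "Max (?g ` unreached) \<in> ?g ` unreached" using ne fin by (intro Max_in) auto
  then obtain s where s: "s \<in> unreached" "?g s = Max (?g ` unreached)" by (elim imageE) simp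
  define e :: "int \<times> int" where "e = (0, \<epsilon>)"
  have e: "e \<in> steps" by (simp add: e_def \<epsilon>_def steps_def)
  have sF: "s \<in> F" using s by (simp add: unreached_def)
  have "s + e \<in> R"
  proof -
    obtain x y where xy: "s = (x, y)" by fastforce
    then have "(x, if even y then y + 1 else y - 1) \<in> R" using pair sF by (auto simp: F_def)
    moreover have "(if even y then y + 1 else y - 1) = y + \<epsilon>"
      using sF by (auto simp: \<epsilon>_def F_def xy same_class_def)
    ultimately show ?thesis by (simp add: xy e_def)
  qed
  moreover have out: "s + e + e \<notin> unreached"
  proof
    assume "s + e + e \<in> unreached"
    then have "?g (s + e + e) \<le> ?g s" unfolding s(2) by (intro Max_ge finite_imageI fin imageI)
    then show False by (auto simp: e_def \<epsilon>_def split: if_splits)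
  qed
  ultimately have "s + e \<in> T" using unreached_boundary[OF s(1) e] by blast
  then obtain v where v: "v \<in> V" "s + e = v + f v" by (auto simp: T_def)
  have "same_class (v + f v - e) (v + (1, 1))"
    unfolding v(2)[symmetric] using sF v(1) by (auto simp: F_def V_def same_class_def e_def)
  then have "f v = (1, 0) \<or> f v = (-1, 0)"
    using f_choice(1)[OF v(1)] by (auto simp: steps_def same_class_def e_def \<epsilon>_def split: if_splits)
  then have "prod.swap (f v) = e \<or> prod.swap (f v) = - e"
    by (auto simp: e_def \<epsilon>_def split: if_splits)
  moreover have "v + f v + e = s + e + e" "v + f v - e = s" "v + f v + - e = s" "v + f v - - e = s + e + e"
    unfolding v(2)[symmetric] by simp_all
  ultimately have "boundary v (f v)"
    unfolding boundary_def using s(1) out by metis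
  with no_boundary v(1) show False by blast
qed

text \<open>Each face takes the first step of a shortest dual path to the outer face, with
  \<open>r\<close> the distance.\<close>

lemma face_choice:
  "\<exists>m r. \<forall>s\<in>F. m s \<in> steps \<and> s + m s \<in> R - T \<and> (s + m s + m s \<in> F \<longrightarrow> r (s + m s + m s) < (r s :: nat))"
proof -
  define r where "r s = (LEAST k. s \<in> lev k)" for s
  have "\<exists>d. d \<in> steps \<and> s + d \<in> R - T \<and> (s + d + d \<in> F \<longrightarrow> r (s + d + d) < r s)" if s: "s \<in> F" for s
  proof -
    have "\<exists>k. s \<in> lev k" using all_reached s unfolding unreached_def by blast
    then have rs: "s \<in> lev (r s)" unfolding r_def by (rule LeastI_ex)
    then obtain k where k: "r s = Suc k" by (cases "r s") (auto simp: lev_def)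
    from rs obtain d where d: "d \<in> steps" "s + d \<in> R - T" "s + d + d \<in> F \<longrightarrow> s + d + d \<in> lev k"
      unfolding k by (auto simp: lev_def reach_def)
    have "r (s + d + d) < r s" if "s + d + d \<in> F"
      using d(3) that unfolding k by (auto simp: r_def less_Suc_eq_le intro: Least_le)
    with d show ?thesis by blast
  qed
  then have "\<forall>s\<in>F. \<exists>d. d \<in> steps \<and> s + d \<in> R - T \<and> (s + d + d \<in> F \<longrightarrow> r (s + d + d) < r s)" by blast
  from bchoice[OF this] show ?thesis by blast
qed

text \<open>Vertices are matched along the forest, faces along the dual tree. No edge is claimed
  twice, and since the numbers agree each is claimed.\<close>

lemma exists_matching: "\<exists>X\<in>perfect_matchings (grid_graph R). choice_of X = f"
proof -
  from face_choice obtain m and r :: "int \<times> int \<Rightarrow> nat" where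
    m: "\<And>s. s \<in> F \<Longrightarrow> m s \<in> steps" "\<And>s. s \<in> F \<Longrightarrow> s + m s \<in> R - T"
    "\<And>s. s \<in> F \<Longrightarrow> s + m s + m s \<in> F \<Longrightarrow> r (s + m s + m s) < r s" by metis
  define t where "t x = x + (if x \<in> V then f x else m x)" for x
  have tV: "t v = v + f v" if "v \<in> V" for v using that by (simp add: t_def)
  have tF: "t s = s + m s" if "s \<in> F" for s using that V_F_disjoint by (auto simp: t_def)
  have t_steps: "t x - x \<in> steps" if "x \<in> V \<union> F" for x
    using that tV tF f_choice(1) m(1) by (cases "x \<in> V") auto
  have t_R: "t x \<in> R" if "x \<in> V \<union> F" for x
    using that tV tF f_choice(2) m(2) by (cases "x \<in> V") auto
  have t_E: "t x \<in> E" if "x \<in> V \<union> F" for x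
    using VF_step_E[OF that t_steps[OF that]] t_R[OF that] by simp
  have opposite: "y = t x + (t x - x)"
    if "x \<in> C" "y \<in> C" "x \<noteq> y" "t x = t y" "C = V \<or> C = F" for x y C
  proof -
    have sc: "same_class (t x + (x - t x)) (t x + (y - t x))"
      using that by (auto simp: V_def F_def same_class_def)
    have sx: "x - t x \<in> steps" using t_steps[of x] steps_uminus[of "t x - x"] that by auto
    have sy: "y - t x \<in> steps" using t_steps[of y] steps_uminus[of "t y - y"] that by auto
    from same_class_steps[OF sx sy sc] \<open>x \<noteq> y\<close> have "y - t x = - (x - t x)" by auto
    then have "y = t x + (- (x - t x))" by (simp only: diff_eq_eq add.commute)
    then show ?thesis by simp
  qed
  have inj: "inj_on t (V \<union> F)"
  proof (rule inj_onI, rule ccontr)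
    fix x y assume xy: "x \<in> V \<union> F" "y \<in> V \<union> F" "t x = t y" "x \<noteq> y"
    \<comment> \<open>Edges of \<open>T\<close> are claimed by vertices, the others by faces, so a
      collision is between two ends of one kind: a 2-cycle of \<open>f\<close>, or two distances
      each below the other.\<close>
    have T_iff: "t z \<in> T \<longleftrightarrow> z \<in> V" if "z \<in> V \<union> F" for z
    proof (cases "z \<in> V")
      case True
      then show ?thesis using tV by (auto simp: T_def)
    next
      case False
      then have "z \<in> F" using that by blast
      then show ?thesis using False m(2) tF by simp
    qed
    from xy(1,2) T_iff[OF xy(1)] T_iff[OF xy(2)] xy(3) consider "x \<in> V" "y \<in> V" | "x \<in> F" "y \<in> F"
      by auto
    then show False
    proof cases
      case 1
      have "y = nxt x (f x)" using opposite[OF 1 xy(4,3)] 1 tV by (simp add: add_ac)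
      moreover have "x = nxt y (f y)" using opposite[OF 1(2,1)] xy 1 tV by (simp add: add_ac)
      ultimately show False using escapes_no_2cycle[OF f_escapes 1(1)] 1(2) by metis
    next
      case 2
      have "y = x + m x + m x" using opposite[OF 2 xy(4,3)] 2 tF by (simp add: add_ac)
      moreover have "x = y + m y + m y" using opposite[OF 2(2,1)] xy 2 tF by (simp add: add_ac)
      ultimately have "r y < r x" "r x < r y" using m(3)[OF 2(1)] m(3)[OF 2(2)] 2 by metis+
      then show False by simp
    qed
  qed
  have onto: "t ` (V \<union> F) = E"
  proof (rule card_subset_eq[OF finite_VFE(3)])
    show "t ` (V \<union> F) \<subseteq> E" using t_E by blast
    show "card (t ` (V \<union> F)) = card E" using inj card_E by (simp add: card_image)
  qed
  let ?X = "(\<lambda>x. {x, t x}) ` (V \<union> F)"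
  have VFR: "x \<in> R" if "x \<in> V \<union> F" for x using that by (auto simp: V_def F_def)
  have unique: "\<exists>!e. e \<in> ?X \<and> u \<in> e" if u: "u \<in> R" for u
  proof (cases "u \<in> V \<union> F")
    case True
    show ?thesis
    proof (rule ex1I[of _ "{u, t u}"])
      show "{u, t u} \<in> ?X \<and> u \<in> {u, t u}" using True by blast
      fix e assume e: "e \<in> ?X \<and> u \<in> e"
      then obtain x where x: "x \<in> V \<union> F" "e = {x, t x}" by blast
      have "u \<noteq> t x" using t_E[OF x(1)] True by (auto simp: E_def)
      with e x show "e = {u, t u}" by auto
    qed
  next
    case False
    then have "u \<in> t ` (V \<union> F)" unfolding onto using u by (simp add: E_def)
    then obtain x where x: "x \<in> V \<union> F" "u = t x" by blast
    show ?thesis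
    proof (rule ex1I[of _ "{x, t x}"])
      show "{x, t x} \<in> ?X \<and> u \<in> {x, t x}" using x by blast
      fix e assume e: "e \<in> ?X \<and> u \<in> e"
      then obtain y where y: "y \<in> V \<union> F" "e = {y, t y}" by blast
      with e False have "t x = t y" using x(2) by auto
      then have "x = y" using inj_onD[OF inj] x(1) y(1) by blast
      then show "e = {x, t x}" using y by simp
    qed
  qed
  have "?X \<subseteq> edges (grid_graph R)" using VFR t_R t_steps by (auto simp: grid_edge_iff)
  then have X: "?X \<in> perfect_matchings (grid_graph R)"
    using unique by (simp add: perfect_matchings_def)
  have "choice_of ?X = f"
  proof (rule ext)
    fix v
    show "choice_of ?X v = f v"
    proof (cases "v \<in> V")
      case True
      then have "{v, t v} \<in> ?X" by blast
      then have "t v = partner ?X v"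
        using partner_perfect_matching(2)[OF X, of v "t v"] VFR True by blast
      then show ?thesis using True tV by (simp add: choice_of_def algebra_simps)
    next
      case False
      have "f \<in> Pi\<^sub>E V (region_choices R)" using f by (simp add: escaping_choices_def)
      from PiE_arb[OF this False] False show ?thesis by (simp add: choice_of_def)
    qed
  qed
  with X show ?thesis by blast
qed

end

theorem num_matchings_forests: "num_matchings (grid_graph R) = card forests"
proof -
  have "choice_of ` perfect_matchings (grid_graph R) = forests"
    using choice_of_forest exists_matching by (blast intro: sym)
  then show ?thesis
    using card_image[OF inj_choice_of] by (simp add: num_matchings_def)
qed

end

section \<open>The regions \<open>C\<close> and \<open>A\<close>\<close>

lemma class_0_1: "same_class (i, j) (0, 1) \<Longrightarrow> \<exists>x y. i = 2 * x \<and> j = 2 * y + 1"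
  unfolding same_class_def fst_conv snd_conv by presburger

lemma class_1_0: "same_class (i, j) (1, 0) \<Longrightarrow> \<exists>x y. i = 2 * x + 1 \<and> j = 2 * y"
  unfolding same_class_def fst_conv snd_conv by presburger

lemma half_le: "2 * a \<le> 2 * b + 1 \<Longrightarrow> a \<le> (b :: int)"
  by presburger

definition C_region :: "nat \<Rightarrow> (int \<times> int) set" where
  "C_region n = {(i, j). 0 \<le> j \<and> \<bar>i\<bar> \<le> 2 * int n - 2 - 2 * (j div 2)}"

text \<open>Splitting off the even part lets \<open>div\<close> be evaluated on a concrete
  remainder, after which membership is linear.\<close>

lemma C_region_mem: "(k, 2 * y + l) \<in> C_region n \<longleftrightarrow>
    0 \<le> 2 * y + l \<and> k \<le> 2 * int n - 2 - 2 * y - 2 * (l div 2) \<and>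
    - k \<le> 2 * int n - 2 - 2 * y - 2 * (l div 2)"
proof -
  have "(2 * y + l) div 2 = y + l div 2" by simp
  then show ?thesis by (auto simp: C_region_def)
qed

lemma aztec_C_region: "n \<ge> 1 \<Longrightarrow> aztec_C (2 * n - 1) = grid_graph (C_region n)"
  by (simp add: aztec_C_def C_region_def of_nat_diff)

text \<open>Vertices have even abscissa and odd height, and the missing row at height -1 is the
  root. Rows 2t and 2t + 1 have equal width, which gives the dominoes; widths shrink upwards, so
  missing points not below the base see infinity above them.\<close>

lemma temperley_C: "temperley (C_region n) (0, 1)"
proof
  show "finite (C_region n)"
  proof (rule finite_box[of _ "2 * n"], rule subsetI)
    fix p assume p: "p \<in> C_region n"
    obtain i j where ij: "p = (i, j)" by fastforce
    have "j - 1 \<le> 2 * (j div 2)" by presburger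
    then show "p \<in> {- int (2 * n)..int (2 * n)} \<times> {- int (2 * n)..int (2 * n)}"
      using p unfolding ij C_region_def by (simp add: abs_le_iff)
  qed
  show "right_up_convex (C_region n)"
    unfolding right_up_convex_def
  proof (intro allI impI)
    fix p assume p: "p \<notin> C_region n"
    obtain i j where ij: "p = (i, j)" by fastforce
    show "(\<forall>k::nat. p + (0, int k) \<notin> C_region n) \<or> (\<forall>k::nat. p + (int k, 0) \<notin> C_region n)"
    proof (cases "j < 0")
      case True
      then have "p + (int k, 0) \<notin> C_region n" for k by (simp add: ij C_region_def)
      then show ?thesis by blast
    next
      case False
      have "p + (0, int k) \<notin> C_region n" for k
      proof -
        have "j div 2 \<le> (j + int k) div 2" by (rule zdiv_mono1) auto
        then show ?thesis using p False unfolding ij C_region_def by simp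
      qed
      then show ?thesis by blast
    qed
  qed
  show "(x, if even y then y + 1 else y - 1) \<in> C_region n" if "(x, y) \<in> C_region n" for x y
  proof -
    have y: "0 \<le> y" "\<bar>x\<bar> \<le> 2 * int n - 2 - 2 * (y div 2)" using that by (simp_all add: C_region_def)
    show ?thesis
    proof (cases "even y")
      case True
      then have "(y + 1) div 2 = y div 2" by presburger
      with y have "(x, y + 1) \<in> C_region n" unfolding C_region_def by simp
      with True show ?thesis by simp
    next
      case False
      then have "(y - 1) div 2 = y div 2" "0 \<le> y - 1" using y(1) by presburger+
      with y have "(x, y - 1) \<in> C_region n" unfolding C_region_def by simp
      with False show ?thesis by simp
    qed
  qed
  show "v + d \<in> C_region n"
    if "v \<in> C_region n" "same_class v (0, 1)" "d \<in> steps" "e \<in> steps" "v + d + e \<in> C_region n"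
      "same_class (v + d + e) ((0, 1) + (1, 1))" for v d e
  proof -
    obtain i j where ij: "v = (i, j)" by fastforce
    with that(2) obtain x y where "i = 2 * x" "j = 2 * y + 1" using class_0_1 by blast
    with ij have v: "v = (2 * x, 2 * y + 1)" by simp
    obtain da db ea eb where de: "d = (da, db)" "e = (ea, eb)" by fastforce
    have vd: "v + d = (2 * x + da, 2 * y + (1 + db))" by (simp add: v de)
    have vde: "v + d + e = (2 * x + (da + ea), 2 * y + (1 + (db + eb)))" by (simp add: v de)
    have "odd (da + ea)" "odd (db + eb)"
      using that(6) unfolding vde by (auto simp: same_class_def)
    then have cases: "(db = 0 \<and> (da = 1 \<or> da = -1) \<and> ea = 0 \<and> (eb = 1 \<or> eb = -1)) \<or>
        (da = 0 \<and> (db = 1 \<or> db = -1) \<and> eb = 0 \<and> (ea = 1 \<or> ea = -1))"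
      using that(3,4) by (auto simp: steps_def de)
    have A: "0 \<le> y" "x \<le> int n - 1 - y" "- x \<le> int n - 1 - y"
      using that(1) unfolding v C_region_mem by simp_all
    note B = that(5)[unfolded vde C_region_mem]
    show ?thesis
    proof (cases "db = 0")
      case True
      with cases have c: "ea = 0" "eb = 1 \<or> eb = -1" by auto
      from c(2) show ?thesis
        using B A unfolding vd C_region_mem True c(1) by (elim disjE) simp_all
    next
      case False
      with cases have c: "da = 0" "eb = 0" "db = 1 \<or> db = -1" "ea = 1 \<or> ea = -1" by auto
      from c(3) show ?thesis
      proof
        assume db: "db = -1"
        show ?thesis unfolding vd C_region_mem c(1) db using A by simp
      next
        assume db: "db = 1"
        \<comment> \<open>The bound of the upper row is even, so a face at the odd abscissa 2 * x +
          ea within it forces the even abscissa 2 * x to be within it as well.\<close>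
        have "2 * x + ea \<le> 2 * (int n - 2 - y)" "- (2 * x + ea) \<le> 2 * (int n - 2 - y)"
          using B by (simp_all add: c(1,2) db)
        with c(4) have "2 * x \<le> 2 * (int n - 2 - y) + 1" "2 * (- x) \<le> 2 * (int n - 2 - y) + 1" by auto
        from this[THEN half_le] show ?thesis unfolding vd C_region_mem c(1) db using A by simp
      qed
    qed
  qed
qed

lemma half_mem: "(i, j) \<in> half n \<longleftrightarrow> 1 \<le> j \<and> i \<le> int n - j \<and> - i \<le> int n - j"
  unfolding half_def mem_Collect_eq prod.case by linarith

lemma num_matchings_C:
  assumes n: "n \<ge> 1"
  shows "num_matchings (aztec_C (2 * n - 1)) = card (escaping_choices (half n) (region_choices (closed_half n)) (+))"
proof -
  interpret temperley "C_region n" "(0, 1)" by (rule temperley_C)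
  let ?h = "\<lambda>(x, y). (2 * x, 2 * y - 1) :: int \<times> int"
  have "card (escaping_choices (half n) (region_choices (closed_half n)) (+)) = card forests"
  proof (rule card_escaping_choices_iso[of ?h id])
    show "inj ?h" by (auto simp: inj_def)
    show "V = ?h ` half n"
    proof (intro equalityI subsetI)
      fix p assume p: "p \<in> V"
      obtain i j where ij: "p = (i, j)" by fastforce
      have "same_class (i, j) (0, 1)" using p by (simp add: ij V_def)
      then obtain x y where xy: "i = 2 * x" "j = 2 * y + 1" using class_0_1 by blast
      have "0 \<le> y" "x \<le> int n - 1 - y" "- x \<le> int n - 1 - y"
        using p unfolding ij xy V_def mem_Collect_eq C_region_mem by simp_all
      then have "(x, y + 1) \<in> half n" by (simp add: half_def)
      moreover have "p = ?h (x, y + 1)" by (simp add: ij xy)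
      ultimately show "p \<in> ?h ` half n" by blast
    next
      fix p assume "p \<in> ?h ` half n"
      then obtain x y where xy: "p = (2 * x, 2 * (y - 1) + 1)" "(x, y) \<in> half n" by auto
      have "1 \<le> y" "x \<le> int n - y" "- x \<le> int n - y" using xy(2) unfolding half_mem by simp_all
      then show "p \<in> V" unfolding V_def xy(1) mem_Collect_eq C_region_mem
        by (simp add: same_class_def)
    qed
    show "region_choices (C_region n) (?h v) = id ` region_choices (closed_half n) v"
      if v': "v \<in> half n" for v
    proof -
      obtain x y where v: "v = (x, y)" by fastforce
      have y: "1 \<le> y" and x: "x \<le> int n - y" "- x \<le> int n - y"
        using v' unfolding v half_mem by simp_all
      \<comment> \<open>A horizontal edge point has odd abscissa while the row bound is even, so it
        is in the region exactly when the vertex beyond it is in the half diamond.\<close>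
      have right: "2 * x + 1 \<le> 2 * M \<and> - (2 * x + 1) \<le> 2 * M \<longleftrightarrow> x + 1 \<le> M \<and> - (x + 1) \<le> M"
        and left: "2 * x - 1 \<le> 2 * M \<and> - (2 * x - 1) \<le> 2 * M \<longleftrightarrow> x - 1 \<le> M \<and> - (x - 1) \<le> M"
        if "x \<le> M" "- x \<le> M" for M
        using that by presburger+
      have up: "2 * x \<le> 2 * M \<and> - (2 * x) \<le> 2 * M \<longleftrightarrow> x \<le> M \<and> - x \<le> M" for M
        by presburger
      have closed_mem: "(i, j) \<in> closed_half n \<longleftrightarrow> 0 \<le> j \<and> i \<le> int n - j \<and> - i \<le> int n - j" for i j
        unfolding closed_half_def mem_Collect_eq prod.case by linarith
      have key: "(2 * x + da, 2 * (y - 1) + (1 + db)) \<in> C_region n \<longleftrightarrow> (x + da, y + db) \<in> closed_half n"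
        if "(da, db) \<in> steps" for da db
      proof -
        from that consider "da = 1" "db = 0" | "da = -1" "db = 0" | "da = 0" "db = 1" | "da = 0" "db = -1"
          unfolding steps_def by auto
        then show ?thesis
        proof cases
          case 1
          show ?thesis unfolding C_region_mem closed_mem 1 using right[OF x] y by (simp add: algebra_simps)
        next
          case 2
          show ?thesis unfolding C_region_mem closed_mem 2 using left[OF x] y by (simp add: algebra_simps)
        next
          case 3
          show ?thesis unfolding C_region_mem closed_mem 3
            using up[of "int n - (y + 1)"] y by (simp add: algebra_simps)
        next
          case 4
          show ?thesis unfolding C_region_mem closed_mem 4 using x y by simp
        qed
      qed
      have "?h v + d \<in> C_region n \<longleftrightarrow> v + d \<in> closed_half n" if "d \<in> steps" for d
      proof -
        obtain da db where d: "d = (da, db)" by fastforce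
        have "?h v + d = (2 * x + da, 2 * (y - 1) + (1 + db))" by (simp add: v d)
        moreover have "v + d = (x + da, y + db)" by (simp add: v d)
        ultimately show ?thesis using key that unfolding d by metis
      qed
      then show ?thesis by (auto simp: region_choices_def)
    qed
    show "?h v + id d + id d = ?h (v + d)" for v d
      by (cases v; cases d) simp
  qed simp
  then show ?thesis
    unfolding aztec_C_region[OF n] using num_matchings_forests by simp
qed

definition A_region :: "nat \<Rightarrow> (int \<times> int) set" where
  "A_region n = {(i, j). 0 \<le> i \<and> i \<le> 2 * int n - 1 \<and> 2 * (i div 2) \<le> j \<and> j \<le> 2 * int n - 1}"

lemma A_region_mem: "(2 * x + k, l) \<in> A_region n \<longleftrightarrow>
    0 \<le> 2 * x + k \<and> 2 * x + k \<le> 2 * int n - 1 \<and> 2 * x + 2 * (k div 2) \<le> l \<and>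
    l \<le> 2 * int n - 1"
proof -
  have "(2 * x + k) div 2 = x + k div 2" by simp
  then show ?thesis by (simp add: A_region_def)
qed

text \<open>Vertices have odd abscissa and even height. The missing column at -1 and the missing row
  at height 2n are the root, the staircase is the free side. Missing points under the staircase see
  infinity to the right, the others above.\<close>

lemma temperley_A: "temperley (A_region n) (1, 0)"
proof
  show "finite (A_region n)"
  proof (rule finite_box[of _ "2 * n"], rule subsetI)
    fix p assume p: "p \<in> A_region n"
    obtain i j where ij: "p = (i, j)" by fastforce
    have "i - 1 \<le> 2 * (i div 2)" by presburger
    then show "p \<in> {- int (2 * n)..int (2 * n)} \<times> {- int (2 * n)..int (2 * n)}"
      using p unfolding ij A_region_def by simp
  qed
  show "right_up_convex (A_region n)"
    unfolding right_up_convex_def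
  proof (intro allI impI)
    fix p assume p: "p \<notin> A_region n"
    obtain i j where ij: "p = (i, j)" by fastforce
    show "(\<forall>k::nat. p + (0, int k) \<notin> A_region n) \<or> (\<forall>k::nat. p + (int k, 0) \<notin> A_region n)"
    proof (cases "0 \<le> i \<and> i \<le> 2 * int n - 1 \<and> j < 2 * (i div 2)")
      case True
      have "p + (int k, 0) \<notin> A_region n" for k
      proof -
        have "i div 2 \<le> (i + int k) div 2" by (rule zdiv_mono1) auto
        then show ?thesis using p True unfolding ij A_region_def by simp
      qed
      then show ?thesis by blast
    next
      case False
      then have "p + (0, int k) \<notin> A_region n" for k using p by (simp add: ij A_region_def) linarith
      then show ?thesis by blast
    qed
  qed
  show "(x, if even y then y + 1 else y - 1) \<in> A_region n" if "(x, y) \<in> A_region n" for x y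
  proof -
    have "y + 1 \<noteq> 2 * int n" if "even y" using that by presburger
    moreover have "2 * (x div 2) \<noteq> y" if "odd y" using that by presburger
    ultimately show ?thesis using that by (auto simp: A_region_def)
  qed
  show "v + d \<in> A_region n"
    if "v \<in> A_region n" "same_class v (1, 0)" "d \<in> steps" "e \<in> steps" "v + d + e \<in> A_region n"
      "same_class (v + d + e) ((1, 0) + (1, 1))" for v d e
  proof -
    obtain i j where ij: "v = (i, j)" by fastforce
    with that(2) obtain x y where "i = 2 * x + 1" "j = 2 * y" using class_1_0 by blast
    with ij have v: "v = (2 * x + 1, 2 * y)" by simp
    obtain da db ea eb where de: "d = (da, db)" "e = (ea, eb)" by fastforce
    have vd: "v + d = (2 * x + (1 + da), 2 * y + db)" by (simp add: v de)
    have vde: "v + d + e = (2 * x + (1 + (da + ea)), 2 * y + (db + eb))" by (simp add: v de)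
    have "odd (da + ea)" "odd (db + eb)"
      using that(6) unfolding vde by (auto simp: same_class_def)
    then have cases: "(db = 0 \<and> (da = 1 \<or> da = -1) \<and> ea = 0 \<and> (eb = 1 \<or> eb = -1)) \<or>
        (da = 0 \<and> (db = 1 \<or> db = -1) \<and> eb = 0 \<and> (ea = 1 \<or> ea = -1))"
      using that(3,4) by (auto simp: steps_def de)
    have A: "0 \<le> x" "x \<le> y" "y \<le> int n - 1" using that(1) unfolding v A_region_mem by simp_all
    note B = that(5)[unfolded vde A_region_mem]
    show ?thesis
    proof (cases "db = 0")
      case True
      with cases have c: "ea = 0" "eb = 1 \<or> eb = -1" by auto
      have "2 * (x + (1 + da) div 2) \<le> 2 * y + eb" using B by (simp add: c(1) True)
      with c(2) have "2 * (x + (1 + da) div 2) \<le> 2 * y + 1" by auto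
      from half_le[OF this] B A show ?thesis unfolding vd A_region_mem True c(1) by simp
    next
      case False
      with cases have c: "da = 0" "eb = 0" "ea = 1 \<or> ea = -1" by auto
      from c(3) show ?thesis
        using B A unfolding vd A_region_mem c(1,2) by (elim disjE) simp_all
    qed
  qed
qed

lemma quadrant_mem: "(i, j) \<in> quadrant n \<longleftrightarrow> 1 \<le> i \<and> 1 \<le> j \<and> i + j \<le> int n"
  by (simp add: quadrant_def)

lemma num_matchings_A:
  assumes n: "n \<ge> 1"
  shows "num_matchings (aztec_A (n - 1)) =
    card (escaping_choices (quadrant n) (region_choices (closed_quadrant n)) (+))"
proof -
  obtain N where N: "n = Suc N" using n by (cases n) auto
  interpret temperley "A_region N" "(1, 0)" by (rule temperley_A)
  \<comment> \<open>The second coordinate is reversed: the axes go just beyond the left and the top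
    side of \<open>A_region N\<close>, the slanted side to the staircase. Steps are reflected
    accordingly by \<open>?k\<close>.\<close>
  let ?h = "\<lambda>(x, y). (2 * (x - 1) + 1, 2 * (int N - y)) :: int \<times> int"
  let ?k = "\<lambda>(x, y). (x, - y) :: int \<times> int"
  have "card (escaping_choices (quadrant n) (region_choices (closed_quadrant n)) (+)) = card forests"
  proof (rule card_escaping_choices_iso[of ?h ?k])
    show "inj ?h" by (auto simp: inj_def)
    show "bij ?k" by (rule involuntory_imp_bij) auto
    show "V = ?h ` quadrant n"
    proof (intro equalityI subsetI)
      fix p assume p: "p \<in> V"
      obtain i j where ij: "p = (i, j)" by fastforce
      have "same_class (i, j) (1, 0)" using p by (simp add: ij V_def)
      then obtain x y where xy: "i = 2 * x + 1" "j = 2 * y" using class_1_0 by blast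
      have "0 \<le> x" "x \<le> y" "y \<le> int N - 1"
        using p unfolding ij xy V_def mem_Collect_eq A_region_mem by simp_all
      then have "(x + 1, int N - y) \<in> quadrant n" by (simp add: quadrant_mem N)
      moreover have "p = ?h (x + 1, int N - y)" by (simp add: ij xy)
      ultimately show "p \<in> ?h ` quadrant n" by blast
    next
      fix p assume "p \<in> ?h ` quadrant n"
      then obtain x y where xy: "p = (2 * (x - 1) + 1, 2 * (int N - y))" "(x, y) \<in> quadrant n" by auto
      have "1 \<le> x" "1 \<le> y" "x + y \<le> int N + 1" using xy(2) unfolding quadrant_mem N by simp_all
      then show "p \<in> V" unfolding V_def xy(1) mem_Collect_eq A_region_mem
        by (simp add: same_class_def)
    qed
    show "region_choices (A_region N) (?h v) = ?k ` region_choices (closed_quadrant n) v"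
      if v': "v \<in> quadrant n" for v
    proof -
      obtain x y where v: "v = (x, y)" by fastforce
      have xy: "1 \<le> x" "1 \<le> y" "x + y \<le> int N + 1"
        using v' unfolding v quadrant_mem N by simp_all
      have closed_mem: "(i, j) \<in> closed_quadrant n \<longleftrightarrow> 0 \<le> i \<and> 0 \<le> j \<and> i + j \<le> int N + 1" for i j
        unfolding closed_quadrant_def N by (simp add: add.commute)
      have down: "2 * (x - 1) \<le> 2 * (int N - y) - 1 \<longleftrightarrow> x - 1 \<le> int N - y - 1" by presburger
      have key: "(2 * (x - 1) + (1 + da), 2 * (int N - y) - db) \<in> A_region N \<longleftrightarrow>
          (x + da, y + db) \<in> closed_quadrant n" if "(da, db) \<in> steps" for da db
      proof -
        from that consider "da = 1" "db = 0" | "da = -1" "db = 0" | "da = 0" "db = 1" | "da = 0" "db = -1"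
          unfolding steps_def by auto
        then show ?thesis
        proof cases
          case 1
          show ?thesis unfolding A_region_mem closed_mem 1 using xy by auto
        next
          case 2
          show ?thesis unfolding A_region_mem closed_mem 2 using xy by simp
        next
          case 3
          show ?thesis unfolding A_region_mem closed_mem 3 using xy down by auto
        next
          case 4
          show ?thesis unfolding A_region_mem closed_mem 4 using xy by simp
        qed
      qed
      have eq: "?h v + ?k d \<in> A_region N \<longleftrightarrow> v + d \<in> closed_quadrant n" if "d \<in> steps" for d
      proof -
        obtain da db where d: "d = (da, db)" by fastforce
        have "?h v + ?k d = (2 * (x - 1) + (1 + da), 2 * (int N - y) - db)" by (simp add: v d)
        moreover have "v + d = (x + da, y + db)" by (simp add: v d)
        ultimately show ?thesis using key that unfolding d by metis
      qed
      have kk: "?k (?k d) = d" for d by (cases d) simp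
      have ks: "?k d \<in> steps" if "d \<in> steps" for d using that by (auto simp: steps_def)
      show ?thesis
      proof (intro equalityI subsetI)
        fix d assume "d \<in> region_choices (A_region N) (?h v)"
        then have d: "d \<in> steps" "?h v + d \<in> A_region N" by (auto simp: region_choices_def)
        have "?k d \<in> region_choices (closed_quadrant n) v"
          using eq[OF ks[OF d(1)]] d(2) ks[OF d(1)] unfolding kk region_choices_def by blast
        then have "?k (?k d) \<in> ?k ` region_choices (closed_quadrant n) v" by (rule imageI)
        then show "d \<in> ?k ` region_choices (closed_quadrant n) v" unfolding kk .
      next
        fix d assume "d \<in> ?k ` region_choices (closed_quadrant n) v"
        then obtain d' where d': "d = ?k d'" "d' \<in> region_choices (closed_quadrant n) v" by (elim imageE)
        then have "d' \<in> steps" "v + d' \<in> closed_quadrant n" unfolding region_choices_def by blast+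
        then show "d \<in> region_choices (A_region N) (?h v)"
          unfolding region_choices_def d'(1) using eq ks by blast
      qed
    qed
    show "?h v + ?k d + ?k d = ?h (v + d)" for v d
      by (cases v; cases d) simp
  qed
  moreover have "aztec_A (n - 1) = grid_graph (A_region N)"
    by (simp add: N aztec_A_def A_region_def)
  ultimately show ?thesis using num_matchings_forests by simp
qed

section \<open>Trees as parent functions\<close>

text \<open>A tree oriented towards \<open>r\<close>: a walk that stays in \<open>W\<close> and
  escapes from W - {r} arrives at \<open>r\<close>.\<close>

definition parent_fun :: "'a set \<Rightarrow> 'a \<Rightarrow> ('a \<Rightarrow> 'a) \<Rightarrow> bool" where
  "parent_fun W r \<pi> \<longleftrightarrow> (\<forall>v\<in>W - {r}. \<pi> v \<in> W) \<and> escapes (W - {r}) \<pi>"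

definition parent_edges :: "'a set \<Rightarrow> 'a \<Rightarrow> ('a \<Rightarrow> 'a) \<Rightarrow> 'a set set" where
  "parent_edges W r \<pi> = (\<lambda>v. {v, \<pi> v}) ` (W - {r})"

lemma parent_edges_cong:
  "(\<And>v. v \<in> W - {r} \<Longrightarrow> \<pi> v = \<pi>' v) \<Longrightarrow> parent_edges W r \<pi> = parent_edges W r \<pi>'"
  unfolding parent_edges_def by (intro image_cong) auto

text \<open>Every edge joins a vertex to its parent of smaller rank, so at a vertex of largest rank
  on a cycle both cycle neighbours would be its parent.\<close>

lemma is_tree_parent_edges:
  assumes r: "r \<in> W" and p: "parent_fun W r \<pi>"
  shows "is_tree (W, parent_edges W r \<pi>)"
proof -
  let ?T = "parent_edges W r \<pi>"
  let ?R = "{(a, b). {a, b} \<in> ?T}"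
  from p have cl: "\<And>v. v \<in> W - {r} \<Longrightarrow> \<pi> v \<in> W" and e: "escapes (W - {r}) \<pi>"
    by (auto simp: parent_fun_def)
  have edge: "{v, \<pi> v} \<in> ?T" if "v \<in> W - {r}" for v using that by (auto simp: parent_edges_def)
  have "{v \<in> W. (v, r) \<notin> ?R\<^sup>*} = {}"
  proof (rule escapes_no_closed[OF e])
    show "{v \<in> W. (v, r) \<notin> ?R\<^sup>*} \<subseteq> W - {r}" by auto
    show "\<pi> ` {v \<in> W. (v, r) \<notin> ?R\<^sup>*} \<subseteq> {v \<in> W. (v, r) \<notin> ?R\<^sup>*}"
    proof (rule image_subsetI)
      fix v assume v: "v \<in> {v \<in> W. (v, r) \<notin> ?R\<^sup>*}"
      then have vW: "v \<in> W - {r}" by auto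
      have "(v, \<pi> v) \<in> ?R" using edge[OF vW] by simp
      then have "(\<pi> v, r) \<notin> ?R\<^sup>*" using v by (auto intro: converse_rtrancl_into_rtrancl)
      then show "\<pi> v \<in> {v \<in> W. (v, r) \<notin> ?R\<^sup>*}" using cl[OF vW] by simp
    qed
  qed
  then have to_r: "(v, r) \<in> ?R\<^sup>*" if "v \<in> W" for v using that by blast
  have "sym ?R" by (auto simp: sym_def insert_commute)
  then have from_r: "(r, v) \<in> ?R\<^sup>*" if "v \<in> W" for v
    using to_r[OF that] by (meson sym_rtrancl symD)
  have "connected_graph (W, ?T)"
    unfolding connected_graph_def using r to_r from_r by (auto intro: rtrancl_trans)
  moreover have "\<not> is_cycle (W, ?T) c" for c
  proof
    assume c: "is_cycle (W, ?T) c"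
    let ?L = "length c"
    from c have L: "3 \<le> ?L" and dist: "distinct c"
      and ce: "\<And>i. i < ?L \<Longrightarrow> {c ! i, c ! (Suc i mod ?L)} \<in> ?T"
      by (auto simp: is_cycle_def)
    obtain \<rho> :: "'a \<Rightarrow> nat" where \<rho>: "\<And>v. v \<in> W - {r} \<Longrightarrow> \<rho> (\<pi> v) < \<rho> v"
      using escapes_rank[OF e] by blast
    have up: "y = \<pi> x" if "{x, y} \<in> ?T" "\<rho> y \<le> \<rho> x" for x y
    proof -
      from that(1) obtain u where u: "u \<in> W - {r}" "{x, y} = {u, \<pi> u}" by (auto simp: parent_edges_def)
      then show ?thesis using \<rho>[OF u(1)] that(2) by (auto simp: doubleton_eq_iff)
    qed
    let ?M = "Max ((\<lambda>i. \<rho> (c ! i)) ` {..<?L})"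
    have "?M \<in> (\<lambda>i. \<rho> (c ! i)) ` {..<?L}" using L by (intro Max_in) (auto simp: lessThan_empty_iff)
    then obtain i where i: "i < ?L" "\<rho> (c ! i) = ?M" by auto
    have max: "\<rho> (c ! j) \<le> \<rho> (c ! i)" if "j < ?L" for j
      unfolding i(2) using that by (intro Max_ge) auto
    define j where "j = (if i = 0 then ?L - 1 else i - 1)"
    have j: "j < ?L" "Suc j mod ?L = i" using i(1) L by (auto simp: j_def)
    let ?k = "Suc i mod ?L"
    have k: "?k < ?L" using L by (intro mod_less_divisor) auto
    have "c ! ?k = \<pi> (c ! i)" using ce[OF i(1)] max[OF k] by (rule up)
    moreover have "c ! j = \<pi> (c ! i)"
      using ce[OF j(1)] max[OF j(1)] by (intro up) (simp_all add: j(2) insert_commute)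
    ultimately have "?k = j" using dist k j(1) nth_eq_iff_index_eq by metis
    then show False using i(1) L by (cases "Suc i = ?L") (auto simp: j_def split: if_splits)
  qed
  ultimately show ?thesis by (simp add: is_tree_def)
qed

lemma rtrancl_distinct_path:
  assumes "(a, b) \<in> {(x, y). {x, y} \<in> T}\<^sup>*"
  shows "\<exists>p. p \<noteq> [] \<and> hd p = a \<and> last p = b \<and> distinct p \<and>
    (\<forall>i. Suc i < length p \<longrightarrow> {p ! i, p ! Suc i} \<in> T)"
  using assms
proof (induction rule: rtrancl_induct)
  case base
  show ?case by (rule exI[of _ "[a]"]) simp
next
  case (step y z)
  then obtain p where p: "p \<noteq> []" "hd p = a" "last p = y" "distinct p"
    "\<And>i. Suc i < length p \<Longrightarrow> {p ! i, p ! Suc i} \<in> T" by blast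
  show ?case
  proof (cases "z \<in> set p")
    case True
    then obtain i where i: "i < length p" "p ! i = z" by (auto simp: in_set_conv_nth)
    let ?p = "take (Suc i) p"
    have "last ?p = z" using i p(1) by (simp add: last_conv_nth)
    moreover have "hd ?p = a" using p(1,2) by (simp add: hd_take)
    ultimately show ?thesis using p i by (intro exI[of _ ?p]) auto
  next
    case False
    have "{(p @ [z]) ! i, (p @ [z]) ! Suc i} \<in> T" if "Suc i < length (p @ [z])" for i
    proof (cases "Suc i = length p")
      case True
      then have "p ! i = y" using p(1,3) by (metis diff_Suc_1 last_conv_nth)
      then show ?thesis using True step.hyps(2) by (simp add: nth_append)
    next
      case False
      then show ?thesis using that p(5)[of i] by (simp add: nth_append)
    qed
    then show ?thesis using p False by (intro exI[of _ "p @ [z]"]) auto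
  qed
qed

text \<open>The parent is a neighbour strictly closer to \<open>r\<close>. The edges to parents
  already form a tree, in which any further edge of \<open>T\<close> would close a cycle.\<close>

lemma tree_parent_edges:
  assumes tree: "is_tree (W, T)" and r: "r \<in> W"
    and T: "\<And>e. e \<in> T \<Longrightarrow> \<exists>a b. e = {a, b} \<and> a \<in> W \<and> b \<in> W \<and> a \<noteq> b"
  shows "\<exists>\<pi>. parent_fun W r \<pi> \<and> T = parent_edges W r \<pi>"
proof -
  let ?R = "{(a, b). {a, b} \<in> T}"
  have TW: "a \<in> W \<and> b \<in> W \<and> a \<noteq> b" if "{a, b} \<in> T" for a b
    using T[OF that] by (auto simp: doubleton_eq_iff)
  have conn: "(v, r) \<in> ?R\<^sup>*" if "v \<in> W" for v
    using tree r that by (auto simp: is_tree_def connected_graph_def)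
  define \<delta> where "\<delta> v = (LEAST k. (v, r) \<in> ?R ^^ k)" for v
  have "\<exists>w. {v, w} \<in> T \<and> \<delta> w < \<delta> v" if v: "v \<in> W - {r}" for v
  proof -
    have "\<exists>k. (v, r) \<in> ?R ^^ k" using conn v by (auto simp: rtrancl_power)
    then have *: "(v, r) \<in> ?R ^^ \<delta> v" unfolding \<delta>_def by (rule LeastI_ex)
    then obtain k where k: "\<delta> v = Suc k" using v by (cases "\<delta> v") auto
    from * obtain w where w: "(v, w) \<in> ?R" "(w, r) \<in> ?R ^^ k"
      unfolding k using relpow_Suc_D2 by metis
    then have "\<delta> w \<le> k" unfolding \<delta>_def by (intro Least_le)
    then have "\<delta> w < \<delta> v" using k by simp
    with w(1) show ?thesis by blast
  qed
  then have "\<forall>v\<in>W - {r}. \<exists>w. {v, w} \<in> T \<and> \<delta> w < \<delta> v" by blast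
  from bchoice[OF this] obtain \<pi> where \<pi>: "\<And>v. v \<in> W - {r} \<Longrightarrow> {v, \<pi> v} \<in> T"
    "\<And>v. v \<in> W - {r} \<Longrightarrow> \<delta> (\<pi> v) < \<delta> v" by blast
  have p: "parent_fun W r \<pi>"
    unfolding parent_fun_def using \<pi> TW by (auto intro: escapes_if_rank[of _ \<delta>])
  let ?T = "parent_edges W r \<pi>"
  have sub: "?T \<subseteq> T" using \<pi>(1) by (auto simp: parent_edges_def)
  have "T \<subseteq> ?T"
  proof (rule subsetI, rule ccontr)
    fix e assume e: "e \<in> T" "e \<notin> ?T"
    then obtain a b where ab: "e = {a, b}" "a \<in> W" "b \<in> W" "a \<noteq> b" using T by blast
    have "is_tree (W, ?T)" using r p by (rule is_tree_parent_edges)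
    then have "(a, b) \<in> {(x, y). {x, y} \<in> ?T}\<^sup>*"
      using ab(2,3) by (auto simp: is_tree_def connected_graph_def)
    from rtrancl_distinct_path[OF this] obtain c where
      c: "c \<noteq> []" "hd c = a" "last c = b" "distinct c"
      "\<And>i. Suc i < length c \<Longrightarrow> {c ! i, c ! Suc i} \<in> ?T" by blast
    have c0: "c ! 0 = a" using c(1,2) by (simp add: hd_conv_nth)
    have cl: "c ! (length c - 1) = b" using c(1,3) by (simp add: last_conv_nth)
    have "length c \<noteq> 1" using c0 cl ab(4) by auto
    moreover have "length c \<noteq> 2"
    proof
      assume "length c = 2"
      then have "{a, b} \<in> ?T" using c(5)[of 0] c0 cl by simp
      with e(2) ab(1) show False by simp
    qed
    ultimately have len: "3 \<le> length c" using c(1) by (cases "length c") auto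
    have edges: "{c ! i, c ! (Suc i mod length c)} \<in> T" if i: "i < length c" for i
    proof (cases "Suc i = length c")
      case True
      then have "i = length c - 1" by simp
      then have "{c ! i, c ! (Suc i mod length c)} = {b, a}" using True c0 cl by simp
      then show ?thesis using e(1) ab(1) by (simp add: insert_commute)
    next
      case False
      then show ?thesis using c(5)[of i] i sub by auto
    qed
    have "set c \<subseteq> W" using TW[OF edges] by (auto simp: in_set_conv_nth)
    then have "is_cycle (W, T) c" using len c(4) edges by (simp add: is_cycle_def)
    with tree show False by (auto simp: is_tree_def)
  qed
  with sub p show ?thesis by blast
qed

text \<open>Where the functions differ at \<open>v\<close>, the edge to \<pi>' v is used by \<pi> in
  the other direction. As \<pi>' has no 2-cycle they differ at \<pi>' v too, so the disagreements
  are closed under \<pi>'.\<close>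

lemma parent_fun_unique:
  assumes p: "parent_fun W r \<pi>" and p': "parent_fun W r \<pi>'"
    and eq: "parent_edges W r \<pi> = parent_edges W r \<pi>'" and v: "v \<in> W - {r}"
  shows "\<pi> v = \<pi>' v"
proof -
  let ?D = "{v \<in> W - {r}. \<pi> v \<noteq> \<pi>' v}"
  have e': "escapes (W - {r}) \<pi>'" using p' by (simp add: parent_fun_def)
  have "?D = {}"
  proof (rule escapes_no_closed[OF e'])
    show "\<pi>' ` ?D \<subseteq> ?D"
    proof (rule image_subsetI)
      fix v assume v: "v \<in> ?D"
      then have "{v, \<pi>' v} \<in> parent_edges W r \<pi>" unfolding eq by (auto simp: parent_edges_def)
      then obtain u where u: "u \<in> W - {r}" "{v, \<pi>' v} = {u, \<pi> u}" by (auto simp: parent_edges_def)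
      then have u': "u = \<pi>' v" "\<pi> u = v" using v by (auto simp: doubleton_eq_iff)
      have "\<pi>' u \<noteq> v" using escapes_no_2cycle[OF e', of v] v u(1) u' by auto
      then show "\<pi>' v \<in> ?D" using u(1) u' by auto
    qed
  qed auto
  with v show ?thesis by blast
qed

section \<open>Trees invariant under reflections\<close>

text \<open>\<open>A\<close> is the union of the mirrors, on which an invariant parent function is forced to be \<open>tow\<close>; \<open>V\<close> is
  a fundamental domain for \<open>H\<close> off the mirrors, reached from \<open>v\<close> by the element \<open>sel v\<close> of \<open>H\<close>.\<close>

locale mirror =
  fixes W V A Wp :: "(int \<times> int) set" and H :: "(int \<times> int \<Rightarrow> int \<times> int) set"
    and tow :: "int \<times> int \<Rightarrow> int \<times> int" and sel :: "int \<times> int \<Rightarrow> int \<times> int \<Rightarrow> int \<times> int"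
  assumes root: "0 \<in> A" and AW: "A \<subseteq> W" and VW: "V \<subseteq> W - A"
    and H_W: "\<tau> \<in> H \<Longrightarrow> v \<in> W \<Longrightarrow> \<tau> v \<in> W"
    and H_A: "\<tau> \<in> H \<Longrightarrow> v \<in> A \<Longrightarrow> \<tau> v \<in> A"
    and H_root: "\<tau> \<in> H \<Longrightarrow> \<tau> 0 = 0"
    and H_inv: "\<tau> \<in> H \<Longrightarrow> \<tau> (\<tau> v) = v"
    and H_comm: "\<sigma> \<in> H \<Longrightarrow> \<tau> \<in> H \<Longrightarrow> \<sigma> (\<tau> v) = \<tau> (\<sigma> v)"
    and H_adj: "\<tau> \<in> H \<Longrightarrow> q - p \<in> steps \<Longrightarrow> \<tau> q - \<tau> p \<in> steps"
    and sel_H: "v \<in> W - A \<Longrightarrow> sel v \<in> H"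
    and sel_V: "v \<in> W - A \<Longrightarrow> sel v v \<in> V"
    and sel_id: "v \<in> V \<Longrightarrow> sel v w = w"
    and sel_eq: "v \<in> W - A \<Longrightarrow> \<tau> \<in> H \<Longrightarrow> sel (\<tau> v) w = sel v (\<tau> w)"
    and Wp: "v \<in> V \<Longrightarrow> d \<in> steps \<Longrightarrow> v + d \<in> Wp \<longleftrightarrow> v + d \<in> W"
    and nbr: "v \<in> V \<Longrightarrow> d \<in> steps \<Longrightarrow> v + d \<in> W \<Longrightarrow> v + d \<in> V \<union> A"
    and tow_A: "v \<in> A - {0} \<Longrightarrow> tow v \<in> A"
    and tow_adj: "v \<in> A - {0} \<Longrightarrow> tow v - v \<in> steps"
    and tow_H: "v \<in> A \<Longrightarrow> \<tau> \<in> H \<Longrightarrow> tow (\<tau> v) = \<tau> (tow v)"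
    and tow_escapes: "escapes (A - {0}) tow"
    and forced: "parent_fun W 0 \<pi> \<Longrightarrow> (\<And>v. v \<in> W - {0} \<Longrightarrow> \<pi> v - v \<in> steps) \<Longrightarrow>
      (\<And>v \<tau>. v \<in> W - {0} \<Longrightarrow> \<tau> \<in> H \<Longrightarrow> \<pi> (\<tau> v) = \<tau> (\<pi> v)) \<Longrightarrow> v \<in> A - {0} \<Longrightarrow> \<pi> v = tow v"
begin

text \<open>Off the mirrors the forest step is taken at the representative in \<open>V\<close> and
  carried back; the same \<open>sel v\<close> does both, being an involution.\<close>

definition ext :: "(int \<times> int \<Rightarrow> int \<times> int) \<Rightarrow> int \<times> int \<Rightarrow> int \<times> int" where
  "ext f v = (if v \<in> A then tow v else sel v (sel v v + f (sel v v)))"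

abbreviation forests where "forests \<equiv> escaping_choices V (region_choices Wp) (+)"

abbreviation inv_trees where
  "inv_trees \<equiv> {T \<in> spanning_trees (grid_graph W). invariant_under H T}"

lemma H_nonzero: "\<tau> \<in> H \<Longrightarrow> v \<in> W - {0} \<Longrightarrow> \<tau> v \<in> W - {0}"
  using H_W H_root H_inv by (metis Diff_iff singletonD singletonI)

lemma H_notA: "\<tau> \<in> H \<Longrightarrow> v \<in> W - A \<Longrightarrow> \<tau> v \<in> W - A"
  using H_W H_A H_inv by (metis Diff_iff)

context
  fixes f assumes f: "f \<in> forests"
begin

lemma f_step: "v \<in> V \<Longrightarrow> f v \<in> steps" "v \<in> V \<Longrightarrow> v + f v \<in> W"
proof -
  assume v: "v \<in> V"
  then have "f v \<in> region_choices Wp v" using f by (auto simp: escaping_choices_def)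
  then have *: "f v \<in> steps" "v + f v \<in> Wp" by (simp_all add: region_choices_def)
  then show "f v \<in> steps" "v + f v \<in> W" using Wp[OF v *(1)] by blast+
qed

lemma f_VA: "v \<in> V \<Longrightarrow> v + f v \<in> V \<union> A"
  using nbr f_step by blast

lemma ext_step: "v \<in> W - {0} \<Longrightarrow> ext f v \<in> W \<and> ext f v - v \<in> steps"
proof (cases "v \<in> A")
  case True
  assume "v \<in> W - {0}"
  with True have v: "v \<in> A - {0}" by blast
  then have "tow v \<in> W" "tow v - v \<in> steps" using tow_A AW tow_adj by blast+
  with True show ?thesis by (simp add: ext_def)
next
  case False
  assume "v \<in> W - {0}"
  with False have v: "v \<in> W - A" by blast
  let ?u = "sel v v"
  have u: "?u \<in> V" and s: "sel v \<in> H" using sel_V sel_H v by auto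
  have "sel v (?u + f ?u) \<in> W" using H_W[OF s] f_step(2)[OF u] .
  moreover have "sel v (?u + f ?u) - sel v ?u \<in> steps"
    using f_step(1)[OF u] by (intro H_adj[OF s]) simp
  ultimately show ?thesis using False H_inv[OF s] by (simp add: ext_def)
qed

text \<open>A closed set avoids the mirrors, where \<open>tow\<close> leads to the root. Folded into
  \<open>V\<close> it would be closed under the forest.\<close>

lemma ext_escapes: "escapes (W - {0}) (ext f)"
proof (rule escapesI_closed)
  fix B assume B: "B \<subseteq> W - {0}" "B \<noteq> {}" "ext f ` B \<subseteq> B"
  have "tow ` (B \<inter> A) \<subseteq> B \<inter> A"
  proof (rule image_subsetI)
    fix v assume v: "v \<in> B \<inter> A"
    then have "ext f v \<in> B" using B(3) by blast
    moreover have "v \<in> A - {0}" using v B(1) by blast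
    ultimately show "tow v \<in> B \<inter> A" using v tow_A by (auto simp: ext_def)
  qed
  from escapes_no_closed[OF tow_escapes _ this] B(1) have BA: "B \<inter> A = {}" by blast
  let ?B = "(\<lambda>v. sel v v) ` B"
  have BW: "v \<in> W - A" if "v \<in> B" for v using that B(1) BA by blast
  have "(\<lambda>u. u + f u) ` ?B \<subseteq> ?B"
  proof (rule image_subsetI)
    fix u assume "u \<in> ?B"
    then obtain v where v: "v \<in> B" "u = sel v v" by blast
    have s: "sel v \<in> H" and u: "u \<in> V" using sel_H sel_V BW[OF v(1)] v(2) by auto
    have x: "ext f v = sel v (u + f u)" using BW[OF v(1)] by (simp add: ext_def v(2))
    then have xB: "sel v (u + f u) \<in> B" using B(3) v(1) by auto
    then have "sel v (u + f u) \<in> W - A" by (rule BW)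
    then have "u + f u \<notin> A" using H_A[OF s] by blast
    then have uV: "u + f u \<in> V" using f_VA[OF u] by blast
    then have "u + f u \<in> W - A" using VW by blast
    from sel_eq[OF this s] have "sel (sel v (u + f u)) (sel v (u + f u)) = sel (u + f u) (sel v (sel v (u + f u)))" .
    also have "\<dots> = u + f u" using H_inv[OF s] sel_id[OF uV] by simp
    finally have "sel (sel v (u + f u)) (sel v (u + f u)) = u + f u" .
    with xB show "u + f u \<in> ?B" by (metis (no_types, lifting) image_eqI)
  qed
  moreover have "?B \<subseteq> V" using sel_V BW by blast
  moreover have "escapes V (\<lambda>u. u + f u)" using f by (simp add: escaping_choices_def)
  ultimately have "?B = {}" using escapes_no_closed by blast
  with B(2) show False by blast
qed

lemma ext_parent_fun: "parent_fun W 0 (ext f)"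
  using ext_step ext_escapes by (simp add: parent_fun_def)

lemma ext_equivariant:
  assumes v: "v \<in> W - {0}" and t: "\<tau> \<in> H"
  shows "ext f (\<tau> v) = \<tau> (ext f v)"
proof (cases "v \<in> A")
  case True
  then show ?thesis using H_A[OF t] tow_H[OF _ t] by (simp add: ext_def)
next
  case False
  with v have vA: "v \<in> W - A" by blast
  then have s: "sel v \<in> H" by (rule sel_H)
  have "sel (\<tau> v) (\<tau> v) = sel v v" using sel_eq[OF vA t] H_inv[OF t] by simp
  then have "ext f (\<tau> v) = sel v (\<tau> (sel v v + f (sel v v)))"
    using H_notA[OF t vA] sel_eq[OF vA t] by (simp add: ext_def)
  then show ?thesis using H_comm[OF s t] False by (simp add: ext_def)
qed

lemma ext_tree: "parent_edges W 0 (ext f) \<in> inv_trees"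
proof -
  let ?T = "parent_edges W 0 (ext f)"
  have r: "0 \<in> W" using root AW by blast
  have "?T \<subseteq> edges (grid_graph W)"
  proof
    fix e assume "e \<in> ?T"
    then obtain v where v: "v \<in> W - {0}" "e = {v, ext f v}" unfolding parent_edges_def by (elim imageE)
    then show "e \<in> edges (grid_graph W)" using ext_step[OF v(1)] by (simp add: grid_edge_iff)
  qed
  moreover have "is_tree (W, ?T)" using r ext_parent_fun by (rule is_tree_parent_edges)
  moreover have "invariant_under H ?T"
    unfolding invariant_under_def
  proof
    fix \<tau> assume t: "\<tau> \<in> H"
    have im: "(\<lambda>e. \<tau> ` e) ` ?T \<subseteq> ?T"
    proof (rule image_subsetI)
      fix e assume "e \<in> ?T"
      then obtain v where v: "v \<in> W - {0}" "e = {v, ext f v}" by (auto simp: parent_edges_def)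
      have "\<tau> ` e = {\<tau> v, ext f (\<tau> v)}" using v(2) ext_equivariant[OF v(1) t] by simp
      then show "\<tau> ` e \<in> ?T" using H_nonzero[OF t v(1)] by (auto simp: parent_edges_def)
    qed
    have tt: "\<tau> ` \<tau> ` e = e" for e using H_inv[OF t] by (simp add: image_image)
    have "e \<in> (\<lambda>e. \<tau> ` e) ` ?T" if "e \<in> ?T" for e
    proof (rule image_eqI)
      show "e = \<tau> ` \<tau> ` e" by (simp only: tt)
      show "\<tau> ` e \<in> ?T" using im that by blast
    qed
    with im show "(\<lambda>e. \<tau> ` e) ` ?T = ?T" by blast
  qed
  ultimately show ?thesis by (simp add: spanning_trees_def)
qed

end

lemma ext_V: "v \<in> V \<Longrightarrow> ext f v = v + f v"
  using VW sel_id by (auto simp: ext_def)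

lemma inj_tree: "inj_on (\<lambda>f. parent_edges W 0 (ext f)) forests"
proof (rule inj_onI)
  fix f g assume f: "f \<in> forests" and g: "g \<in> forests"
    and eq: "parent_edges W 0 (ext f) = parent_edges W 0 (ext g)"
  have fg: "f \<in> Pi\<^sub>E V (region_choices Wp)" "g \<in> Pi\<^sub>E V (region_choices Wp)"
    using f g by (simp_all add: escaping_choices_def)
  show "f = g"
  proof (rule PiE_ext[OF fg])
    fix v assume v: "v \<in> V"
    then have "v \<in> W - {0}" using VW root by blast
    from parent_fun_unique[OF ext_parent_fun[OF f] ext_parent_fun[OF g] eq this]
    show "f v = g v" using ext_V v by simp
  qed
qed

lemma tree_is_ext:
  assumes T: "T \<in> inv_trees"
  shows "\<exists>f\<in>forests. parent_edges W 0 (ext f) = T"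
proof -
  have r: "0 \<in> W" using root AW by blast
  have tree: "is_tree (W, T)" and TE: "T \<subseteq> edges (grid_graph W)" and inv: "invariant_under H T"
    using T by (auto simp: spanning_trees_def)
  have "\<exists>a b. e = {a, b} \<and> a \<in> W \<and> b \<in> W \<and> a \<noteq> b" if "e \<in> T" for e
  proof -
    have "e \<in> edges (grid_graph W)" using TE that by blast
    then obtain p q where "e = {p, q}" "p \<in> W" "q \<in> W" "q - p \<in> steps" by (elim grid_edgeE)
    moreover have "p \<noteq> q" using \<open>q - p \<in> steps\<close> by (auto simp: steps_def zero_prod_def)
    ultimately show ?thesis by blast
  qed
  from tree_parent_edges[OF tree r this] obtain \<pi> where
    p: "parent_fun W 0 \<pi>" and T_eq: "T = parent_edges W 0 \<pi>" by blast
  have step: "\<pi> v - v \<in> steps" if "v \<in> W - {0}" for v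
  proof -
    have "{v, \<pi> v} \<in> edges (grid_graph W)" using TE that unfolding T_eq parent_edges_def by blast
    then show ?thesis by (simp add: grid_edge_iff)
  qed
  have pW: "\<pi> v \<in> W" if "v \<in> W - {0}" for v using p that by (simp add: parent_fun_def)
  \<comment> \<open>Conjugation by \<tau> gives a parent function of the same invariant tree, and
    parent functions are unique.\<close>
  have equi: "\<pi> (\<tau> v) = \<tau> (\<pi> v)" if v: "v \<in> W - {0}" and t: "\<tau> \<in> H" for v \<tau>
  proof -
    let ?p = "\<lambda>v. \<tau> (\<pi> (\<tau> v))"
    have im: "\<tau> ` (W - {0}) = W - {0}"
    proof (intro equalityI subsetI)
      fix w assume "w \<in> W - {0}"
      then have "\<tau> (\<tau> w) \<in> \<tau> ` (W - {0})" using H_nonzero[OF t] by (intro imageI)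
      then show "w \<in> \<tau> ` (W - {0})" by (simp only: H_inv[OF t])
    next
      fix w assume "w \<in> \<tau> ` (W - {0})"
      then obtain u where "u \<in> W - {0}" "w = \<tau> u" by (elim imageE)
      then show "w \<in> W - {0}" using H_nonzero[OF t] by (simp only:)
    qed
    have "parent_fun W 0 ?p"
      unfolding parent_fun_def
    proof
      show "\<forall>v\<in>W - {0}. ?p v \<in> W" by (intro ballI H_W[OF t] pW H_nonzero[OF t])
      show "escapes (W - {0}) ?p"
      proof (rule escapesI_closed)
        fix B assume B: "B \<subseteq> W - {0}" "B \<noteq> {}" "?p ` B \<subseteq> B"
        have "\<pi> ` \<tau> ` B \<subseteq> \<tau> ` B"
        proof (rule image_subsetI)
          fix u assume "u \<in> \<tau> ` B"
          then obtain b where b: "b \<in> B" "u = \<tau> b" by blast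
          then have "\<tau> (\<pi> u) \<in> B" using B(3) by blast
          then have "\<tau> (\<tau> (\<pi> u)) \<in> \<tau> ` B" by (rule imageI)
          then show "\<pi> u \<in> \<tau> ` B" using H_inv[OF t] by simp
        qed
        moreover have "\<tau> ` B \<subseteq> W - {0}"
        proof (rule image_subsetI)
          fix b assume "b \<in> B"
          then have "b \<in> W - {0}" using B(1) by blast
          then show "\<tau> b \<in> W - {0}" by (rule H_nonzero[OF t])
        qed
        moreover have "escapes (W - {0}) \<pi>" using p by (simp add: parent_fun_def)
        ultimately have "\<tau> ` B = {}" using escapes_no_closed by blast
        with B(2) show False by blast
      qed
    qed
    moreover have "parent_edges W 0 ?p = parent_edges W 0 \<pi>"
    proof -
      have "parent_edges W 0 ?p = (\<lambda>v. \<tau> ` {\<tau> v, \<pi> (\<tau> v)}) ` (W - {0})"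
        unfolding parent_edges_def using H_inv[OF t] by simp
      also have "\<dots> = (\<lambda>e. \<tau> ` e) ` (\<lambda>v. {v, \<pi> v}) ` \<tau> ` (W - {0})"
        by (simp add: image_image)
      also have "\<dots> = (\<lambda>e. \<tau> ` e) ` T" by (simp only: im T_eq parent_edges_def)
      also have "\<dots> = T" using inv t by (simp add: invariant_under_def)
      finally show ?thesis by (simp add: T_eq)
    qed
    ultimately have "?p v = \<pi> v"
      using parent_fun_unique[where \<pi> = ?p and \<pi>' = \<pi>, OF _ p _ v] by simp
    then have "\<tau> (?p v) = \<tau> (\<pi> v)" by (rule arg_cong)
    then show ?thesis by (simp only: H_inv[OF t])
  qed
  define f where "f = restrict (\<lambda>v. \<pi> v - v) V"
  have fV: "v + f v = \<pi> v" if "v \<in> V" for v using that by (simp add: f_def)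
  have V0: "v \<in> W - {0}" if "v \<in> V" for v using that VW root by blast
  have "f \<in> forests"
  proof -
    have "\<pi> v - v \<in> region_choices Wp v" if "v \<in> V" for v
      using Wp[OF that step[OF V0[OF that]]] step[OF V0[OF that]] pW[OF V0[OF that]]
      by (simp add: region_choices_def)
    then have "f \<in> Pi\<^sub>E V (region_choices Wp)" by (simp add: f_def restrict_PiE_iff)
    moreover have "escapes V (\<lambda>v. v + f v)"
    proof (rule escapesI_closed)
      fix B assume B: "B \<subseteq> V" "B \<noteq> {}" "(\<lambda>v. v + f v) ` B \<subseteq> B"
      have "(\<lambda>v. v + f v) ` B = \<pi> ` B" using B(1) fV by (intro image_cong) auto
      moreover have "B \<subseteq> W - {0}" using B(1) V0 by blast
      moreover have "escapes (W - {0}) \<pi>" using p by (simp add: parent_fun_def)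
      ultimately show False using escapes_no_closed B(2,3) by metis
    qed
    ultimately show ?thesis by (simp add: escaping_choices_def)
  qed
  moreover have "ext f v = \<pi> v" if v: "v \<in> W - {0}" for v
  proof (cases "v \<in> A")
    case True
    then show ?thesis using forced[OF p step equi] v by (simp add: ext_def)
  next
    case False
    with v have vA: "v \<in> W - A" by blast
    have s: "sel v \<in> H" and u: "sel v v \<in> V" using sel_H sel_V vA by auto
    have "ext f v = sel v (\<pi> (sel v v))" using False fV[OF u] by (simp add: ext_def)
    also have "\<dots> = sel v (sel v (\<pi> v))" using equi[OF v s] by simp
    finally show ?thesis using H_inv[OF s] by simp
  qed
  then have "parent_edges W 0 (ext f) = T" unfolding T_eq by (intro parent_edges_cong)
  ultimately show ?thesis by blast
qed

theorem card_inv_trees: "card inv_trees = card forests"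
proof -
  have "bij_betw (\<lambda>f. parent_edges W 0 (ext f)) forests inv_trees"
    unfolding bij_betw_def
  proof
    show "(\<lambda>f. parent_edges W 0 (ext f)) ` forests = inv_trees"
    proof (intro equalityI subsetI)
      fix T assume "T \<in> (\<lambda>f. parent_edges W 0 (ext f)) ` forests"
      then show "T \<in> inv_trees" using ext_tree by (elim imageE) (simp only:)
    next
      fix T assume "T \<in> inv_trees"
      from tree_is_ext[OF this] show "T \<in> (\<lambda>f. parent_edges W 0 (ext f)) ` forests" by blast
    qed
  qed (rule inj_tree)
  then have "card forests = card inv_trees" by (rule bij_betw_same_card)
  then show ?thesis by (rule sym)
qed

end

section \<open>The diamond and its axes as mirrors\<close>

definition diamond :: "nat \<Rightarrow> (int \<times> int) set" where
  "diamond n = {(x, y). \<bar>x\<bar> + \<bar>y\<bar> \<le> int n}"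

definition inward :: "int \<times> int \<Rightarrow> int \<times> int" where
  "inward = (\<lambda>(x, y). (x - sgn x, y - sgn y))"

text \<open>Along a ray from the root that the parent function preserves, the outermost vertex has to point
  inwards, and then so does every other vertex, as otherwise two of them would point at each other.\<close>

lemma parent_on_ray:
  assumes p: "parent_fun W r \<pi>"
    and ray: "\<And>k. 1 \<le> k \<Longrightarrow> k \<le> n \<Longrightarrow> p k \<in> W - {r}" and out: "p (Suc n) \<notin> W"
    and nb: "\<And>k. 1 \<le> k \<Longrightarrow> k \<le> n \<Longrightarrow> \<pi> (p k) = p (k - 1) \<or> \<pi> (p k) = p (Suc k)"
    and k: "1 \<le> k" "k \<le> n"
  shows "\<pi> (p k) = p (k - 1)"
  using k(2,1)
proof (induction rule: inc_induct)
  case base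
  then have "\<pi> (p n) \<in> W" using p ray[of n] by (simp add: parent_fun_def)
  with out have "\<pi> (p n) \<noteq> p (Suc n)" by auto
  then show ?case using nb[of n] base by auto
next
  case (step k)
  then have IH: "\<pi> (p (Suc k)) = p k" by simp
  have "\<pi> (p k) \<noteq> p (Suc k)"
  proof
    assume eq: "\<pi> (p k) = p (Suc k)"
    have "escapes (W - {r}) \<pi>" using p by (simp add: parent_fun_def)
    then have "\<pi> (\<pi> (p k)) \<noteq> p k"
      by (rule escapes_no_2cycle) (use ray[of k] ray[of "Suc k"] step eq in auto)
    with eq IH show False by simp
  qed
  then show ?case using nb[of k] step by auto
qed

lemma parent_on_axis:
  assumes p: "parent_fun (diamond n) 0 \<pi>" and u: "u \<in> steps"
    and nb: "\<And>k. 1 \<le> k \<Longrightarrow> k \<le> n \<Longrightarrow>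
      \<pi> (int k * fst u, int k * snd u) = (int (k - 1) * fst u, int (k - 1) * snd u) \<or>
      \<pi> (int k * fst u, int k * snd u) = (int (Suc k) * fst u, int (Suc k) * snd u)"
    and k: "1 \<le> k" "k \<le> n"
  shows "\<pi> (int k * fst u, int k * snd u) = inward (int k * fst u, int k * snd u)"
proof -
  have "\<pi> (int k * fst u, int k * snd u) = (int (k - 1) * fst u, int (k - 1) * snd u)"
  proof (rule parent_on_ray[where p = "\<lambda>k. (int k * fst u, int k * snd u)" and n = n, OF p])
    show "(int k * fst u, int k * snd u) \<in> diamond n - {0}" if "1 \<le> k" "k \<le> n" for k
      using u that by (auto simp: steps_def diamond_def zero_prod_def)
    show "(int (Suc n) * fst u, int (Suc n) * snd u) \<notin> diamond n"
      using u by (auto simp: steps_def diamond_def)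
  qed (use nb k in auto)
  also have "\<dots> = inward (int k * fst u, int k * snd u)"
    using u k by (auto simp: steps_def inward_def of_nat_diff)
  finally show ?thesis .
qed

text \<open>Axis points are fixed by the reflection, hence by equivariance so are their parents. The
  axis is preserved, and the ray argument applies to both of its halves.\<close>

lemma refl_h_equivariant_axis:
  assumes p: "parent_fun (diamond n) 0 \<pi>"
    and step: "\<And>v. v \<in> diamond n - {0} \<Longrightarrow> \<pi> v - v \<in> steps"
    and equi: "\<And>v. v \<in> diamond n - {0} \<Longrightarrow> \<pi> (refl_h v) = refl_h (\<pi> v)"
    and x: "(x, 0) \<in> diamond n - {0}"
  shows "\<pi> (x, 0) = inward (x, 0)"
proof -
  have axis: "\<pi> (x, 0) = (x - 1, 0) \<or> \<pi> (x, 0) = (x + 1, 0)" if x: "(x, 0) \<in> diamond n - {0}" for x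
  proof -
    obtain a b where ab: "\<pi> (x, 0) = (a, b)" by fastforce
    have "b = 0" using equi[OF x] ab by (auto simp: refl_h_def)
    then show ?thesis using step[OF x] ab by (auto simp: steps_def)
  qed
  have mem: "(int k, 0) \<in> diamond n - {0}" "(- int k, 0) \<in> diamond n - {0}" if "1 \<le> k" "k \<le> n" for k
    using that by (auto simp: diamond_def zero_prod_def)
  have pos: "\<pi> (int k, 0) = inward (int k, 0)" if "1 \<le> k" "k \<le> n" for k
    using parent_on_axis[OF p, of "(1, 0)" k] axis[OF mem(1)] that
    by (simp add: steps_def of_nat_diff add.commute)
  have "\<pi> (- int k, 0) = (- int (k - 1), 0) \<or> \<pi> (- int k, 0) = (- int (Suc k), 0)" if "1 \<le> k" "k \<le> n" for k
    using axis[OF mem(2)[OF that]] that by (auto simp: of_nat_diff)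
  then have neg: "\<pi> (- int k, 0) = inward (- int k, 0)" if "1 \<le> k" "k \<le> n" for k
    using parent_on_axis[OF p, of "(-1, 0)" k] that by (simp add: steps_def)
  show ?thesis
    using pos[of "nat x"] neg[of "nat (- x)"] x
    by (cases "x > 0") (auto simp: diamond_def zero_prod_def)
qed

lemma refl_v_equivariant_axis:
  assumes p: "parent_fun (diamond n) 0 \<pi>"
    and step: "\<And>v. v \<in> diamond n - {0} \<Longrightarrow> \<pi> v - v \<in> steps"
    and equi: "\<And>v. v \<in> diamond n - {0} \<Longrightarrow> \<pi> (refl_v v) = refl_v (\<pi> v)"
    and y: "(0, y) \<in> diamond n - {0}"
  shows "\<pi> (0, y) = inward (0, y)"
proof -
  have axis: "\<pi> (0, y) = (0, y - 1) \<or> \<pi> (0, y) = (0, y + 1)" if y: "(0, y) \<in> diamond n - {0}" for y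
  proof -
    obtain a b where ab: "\<pi> (0, y) = (a, b)" by fastforce
    have "a = 0" using equi[OF y] ab by (auto simp: refl_v_def)
    then show ?thesis using step[OF y] ab by (auto simp: steps_def)
  qed
  have mem: "(0, int k) \<in> diamond n - {0}" "(0, - int k) \<in> diamond n - {0}" if "1 \<le> k" "k \<le> n" for k
    using that by (auto simp: diamond_def zero_prod_def)
  have pos: "\<pi> (0, int k) = inward (0, int k)" if "1 \<le> k" "k \<le> n" for k
    using parent_on_axis[OF p, of "(0, 1)" k] axis[OF mem(1)] that
    by (simp add: steps_def of_nat_diff add.commute)
  have "\<pi> (0, - int k) = (0, - int (k - 1)) \<or> \<pi> (0, - int k) = (0, - int (Suc k))" if "1 \<le> k" "k \<le> n" for k
    using axis[OF mem(2)[OF that]] that by (auto simp: of_nat_diff)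
  then have neg: "\<pi> (0, - int k) = inward (0, - int k)" if "1 \<le> k" "k \<le> n" for k
    using parent_on_axis[OF p, of "(0, -1)" k] that by (simp add: steps_def)
  show ?thesis
    using pos[of "nat y"] neg[of "nat (- y)"] y
    by (cases "y > 0") (auto simp: diamond_def zero_prod_def)
qed

lemma escapes_inward: "escapes V inward" if "0 \<notin> V" "\<And>x y. (x, y) \<in> V \<Longrightarrow> x = 0 \<or> y = 0"
proof (rule escapes_if_rank[of _ "\<lambda>(x, y). nat (\<bar>x\<bar> + \<bar>y\<bar>)"])
  fix v assume v: "v \<in> V"
  obtain x y where xy: "v = (x, y)" by fastforce
  have "x = 0 \<or> y = 0" "x \<noteq> 0 \<or> y \<noteq> 0" using that v by (auto simp: xy zero_prod_def)
  then show "(case inward v of (x, y) \<Rightarrow> nat (\<bar>x\<bar> + \<bar>y\<bar>)) < (case v of (x, y) \<Rightarrow> nat (\<bar>x\<bar> + \<bar>y\<bar>))"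
    by (auto simp: xy inward_def sgn_if)
qed

lemma mirror_h:
  "mirror (diamond n) (half n) {v \<in> diamond n. snd v = 0} (closed_half n) {id, refl_h} inward
     (\<lambda>v. if snd v < 0 then refl_h else id)"
proof (unfold_locales, goal_cases)
  \<comment> \<open>Goal 20 is \<open>forced\<close> and goal 19 is \<open>tow_escapes\<close>; the
    other assumptions of \<open>mirror\<close> are coordinate checks.\<close>
  case (20 \<pi> v)
  obtain x where v: "v = (x, 0)" "(x, 0) \<in> diamond n - {0}" using 20(4) by (cases v) auto
  show ?case unfolding v(1)
    by (rule refl_h_equivariant_axis[OF 20(1)]) (use 20(2,3) v(2) in auto)
next
  case 19
  show ?case by (rule escapes_inward) auto
qed (auto simp: diamond_def half_def closed_half_def refl_h_def steps_def inward_def zero_prod_def sgn_if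
    split: if_splits)

lemma refl_pair: "refl_h (x, y) = (x, - y)" "refl_v (x, y) = (- x, y)"
  by (simp_all add: refl_h_def refl_v_def)

lemma refl_refl: "refl_h (refl_h v) = v" "refl_v (refl_v v) = v"
  by (cases v; simp add: refl_pair)+

lemma refl_comm: "refl_v (refl_h v) = refl_h (refl_v v)"
  by (cases v) (simp add: refl_pair)

lemma refl_step:
  assumes "q - p \<in> steps"
  shows "refl_h q - refl_h p \<in> steps" "refl_v q - refl_v p \<in> steps"
  using assms by (cases p; cases q; auto simp: refl_pair steps_def)+

lemma mirror_hv:
  "mirror (diamond n) (quadrant n) {v \<in> diamond n. fst v = 0 \<or> snd v = 0} (closed_quadrant n)
     {id, refl_h, refl_v, refl_h \<circ> refl_v} inward
     (\<lambda>v. (if fst v < 0 then refl_v else id) \<circ> (if snd v < 0 then refl_h else id))"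
proof (unfold_locales, goal_cases)
  case (20 \<pi> v)
  have "\<pi> v = inward v" if "snd v = 0"
  proof -
    define x where "x = fst v"
    have v: "v = (x, 0)" using that by (simp add: x_def prod_eq_iff)
    then have "(x, 0) \<in> diamond n - {0}" using 20(4) by simp
    then show ?thesis unfolding v
      by (rule refl_h_equivariant_axis[OF 20(1), rotated 2]) (use 20(2,3) in auto)
  qed
  moreover have "\<pi> v = inward v" if "fst v = 0"
  proof -
    define y where "y = snd v"
    have v: "v = (0, y)" using that by (simp add: y_def prod_eq_iff)
    then have "(0, y) \<in> diamond n - {0}" using 20(4) by simp
    then show ?thesis unfolding v
      by (rule refl_v_equivariant_axis[OF 20(1), rotated 2]) (use 20(2,3) in auto)
  qed
  ultimately show ?case using 20(4) by blast
next
  case 19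
  show ?case by (rule escapes_inward) auto
next
  case 1
  then show ?case by (auto simp: diamond_def quadrant_def closed_quadrant_def refl_h_def refl_v_def steps_def inward_def zero_prod_def sgn_if split: if_splits)
next
  case 2
  then show ?case by (auto simp: diamond_def quadrant_def closed_quadrant_def refl_h_def refl_v_def steps_def inward_def zero_prod_def sgn_if split: if_splits)
next
  case 3
  then show ?case by (auto simp: diamond_def quadrant_def closed_quadrant_def refl_h_def refl_v_def steps_def inward_def zero_prod_def sgn_if split: if_splits)
next
  case 4
  then show ?case by (auto simp: diamond_def quadrant_def closed_quadrant_def refl_h_def refl_v_def steps_def inward_def zero_prod_def sgn_if split: if_splits)
next
  case 5
  then show ?case by (auto simp: diamond_def quadrant_def closed_quadrant_def refl_h_def refl_v_def steps_def inward_def zero_prod_def sgn_if split: if_splits)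
next
  case 6
  then show ?case by (auto simp: diamond_def quadrant_def closed_quadrant_def refl_h_def refl_v_def steps_def inward_def zero_prod_def sgn_if split: if_splits)
next
  case 7
  then show ?case by (auto simp: refl_refl refl_comm)
next
  case 8
  then show ?case by (auto simp: refl_refl refl_comm)
next
  case 9
  then show ?case by (auto intro!: refl_step)
next
  case 10
  then show ?case by (auto simp: diamond_def quadrant_def closed_quadrant_def refl_h_def refl_v_def steps_def inward_def zero_prod_def sgn_if split: if_splits)
next
  case 11
  then show ?case by (auto simp: diamond_def quadrant_def closed_quadrant_def refl_h_def refl_v_def steps_def inward_def zero_prod_def sgn_if split: if_splits)
next
  case 12
  then show ?case by (auto simp: diamond_def quadrant_def closed_quadrant_def refl_h_def refl_v_def steps_def inward_def zero_prod_def sgn_if split: if_splits)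
next
  \<comment> \<open>Off the axes each reflection flips one of the two sign tests, so moving the
    point by \<tau> composes the selected fold with \<tau>.\<close>
  case (13 v \<tau> w)
  obtain x y where v: "v = (x, y)" by fastforce
  obtain a b where w: "w = (a, b)" by fastforce
  have "x \<noteq> 0" "y \<noteq> 0" using 13(1) by (auto simp: v)
  then show ?case
    using 13(2) unfolding v w by (elim insertE emptyE) (auto simp: refl_pair)
next
  case 14
  then show ?case by (auto simp: diamond_def quadrant_def closed_quadrant_def refl_h_def refl_v_def steps_def inward_def zero_prod_def sgn_if split: if_splits)
next
  case 15
  then show ?case by (auto simp: diamond_def quadrant_def closed_quadrant_def refl_h_def refl_v_def steps_def inward_def zero_prod_def sgn_if split: if_splits)
next
  case 16
  then show ?case by (auto simp: diamond_def quadrant_def closed_quadrant_def refl_h_def refl_v_def steps_def inward_def zero_prod_def sgn_if split: if_splits)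
next
  case 17
  then show ?case by (auto simp: diamond_def quadrant_def closed_quadrant_def refl_h_def refl_v_def steps_def inward_def zero_prod_def sgn_if split: if_splits)
next
  case 18
  then show ?case by (auto simp: diamond_def quadrant_def closed_quadrant_def refl_h_def refl_v_def steps_def inward_def zero_prod_def sgn_if split: if_splits)
qed

section \<open>From generators to the generated group, and the final count\<close>

lemma involution_inv_BijGroup:
  assumes "bij \<sigma>" "\<And>v. \<sigma> (\<sigma> v) = v"
  shows "inv\<^bsub>BijGroup UNIV\<^esub> \<sigma> = \<sigma>"
proof -
  have c: "\<sigma> \<in> Bij UNIV" using assms(1) by (simp add: Bij_def)
  have "inv_into UNIV \<sigma> = \<sigma>"
    using assms by (intro ext) (metis bij_inv_eq_iff)
  then show ?thesis using inv_BijGroup[OF c] by (simp add: restrict_def)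
qed

text \<open>Invariance passes to products, and an inverse brings nothing new because each generator
  is an involution.\<close>

lemma invariant_under_sym_gen:
  assumes S: "S \<subseteq> {refl_h, refl_v}"
  shows "invariant_under (sym_gen S) T \<longleftrightarrow> invariant_under S T"
proof
  assume "invariant_under (sym_gen S) T"
  then show "invariant_under S T"
    unfolding invariant_under_def by (blast intro: generate.incl)
next
  assume inv: "invariant_under S T"
  show "invariant_under (sym_gen S) T"
    unfolding invariant_under_def
  proof
    fix g assume g: "g \<in> sym_gen S"
    have Bij: "g \<in> Bij UNIV" if "g \<in> sym_gen S" for g
    proof -
      have "S \<subseteq> carrier (BijGroup UNIV)" using S refl_in_BijGroup by blast
      from group.generate_in_carrier[OF group_BijGroup this that] show ?thesis by (simp add: BijGroup_def)
    qed
    from g show "(\<lambda>e. g ` e) ` T = T"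
    proof (induction rule: generate.induct)
      case one
      have "\<one>\<^bsub>BijGroup UNIV\<^esub> = (\<lambda>x. x :: int \<times> int)" by (simp add: BijGroup_def restrict_def)
      then show ?case by simp
    next
      case (incl h)
      then show ?case using inv by (simp add: invariant_under_def)
    next
      case (inv h)
      have "h \<in> {refl_h, refl_v}" using inv S by blast
      then have "bij h" "\<And>v. h (h v) = v"
        using refl_in_BijGroup by (auto simp: BijGroup_def Bij_def refl_h_def refl_v_def)
      then have "inv\<^bsub>BijGroup UNIV\<^esub> h = h" by (rule involution_inv_BijGroup)
      then show ?case using inv \<open>invariant_under S T\<close> by (simp add: invariant_under_def)
    next
      case (eng h1 h2)
      have "h1 \<otimes>\<^bsub>BijGroup UNIV\<^esub> h2 = h1 \<circ> h2"
        using Bij eng.hyps by (simp add: BijGroup_def compose_def comp_def restrict_def)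
      then have "(\<lambda>e. (h1 \<otimes>\<^bsub>BijGroup UNIV\<^esub> h2) ` e) ` T = (\<lambda>e. h1 ` e) ` (\<lambda>e. h2 ` e) ` T"
        by (simp add: image_image image_comp)
      then show ?case using eng.IH by simp
    qed
  qed
qed

lemma odd_diamond_eq: "odd_diamond n = grid_graph (diamond n)"
  by (simp add: odd_diamond_def diamond_def)

lemma num_invariant_trees_h:
  "num_invariant_trees (sym_gen {refl_h}) (odd_diamond n) =
   card (escaping_choices (half n) (region_choices (closed_half n)) (+))"
proof -
  have "invariant_under (sym_gen {refl_h}) T \<longleftrightarrow> invariant_under {id, refl_h} T" for T
    by (subst invariant_under_sym_gen) (auto simp: invariant_under_def)
  then show ?thesis
    using mirror.card_inv_trees[OF mirror_h[of n]]
    by (simp add: num_invariant_trees_def odd_diamond_eq)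
qed

lemma num_invariant_trees_hv:
  "num_invariant_trees (sym_gen {refl_h, refl_v}) (odd_diamond n) =
   card (escaping_choices (quadrant n) (region_choices (closed_quadrant n)) (+))"
proof -
  have "invariant_under (sym_gen {refl_h, refl_v}) T \<longleftrightarrow>
      invariant_under {id, refl_h, refl_v, refl_h \<circ> refl_v} T" for T
  proof -
    have "(\<lambda>e. (refl_h \<circ> refl_v) ` e) ` T = (\<lambda>e. refl_h ` e) ` (\<lambda>e. refl_v ` e) ` T"
      by (simp add: image_image image_comp)
    then have "(\<lambda>e. (refl_h \<circ> refl_v) ` e) ` T = T"
      if "(\<lambda>e. refl_h ` e) ` T = T" "(\<lambda>e. refl_v ` e) ` T = T"
      by (simp only: that)
    then show ?thesis
      by (subst invariant_under_sym_gen) (auto simp only: invariant_under_def ball_simps image_ident id_apply image_id)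
  qed
  then show ?thesis
    using mirror.card_inv_trees[OF mirror_hv[of n]]
    by (simp add: num_invariant_trees_def odd_diamond_eq)
qed

theorem theorem4p5:
  fixes n :: nat
  assumes "n \<ge> 1"
  shows "num_invariant_trees (sym_gen {refl_h}) (odd_diamond n) = num_matchings (aztec_C (2 * n - 1))
    \<and> real (num_matchings (aztec_C (2 * n - 1))) =
        1 / 2 ^ (2 * n) *
        (\<Prod>(j, k) \<in> {(j :: nat, k :: nat). 1 \<le> j \<and> j \<le> k \<and> k \<le> 2 * n - 1 \<and> even (j + k)}.
           4 - 2 * cos (real j * pi / real (2 * n)) - 2 * cos (real k * pi / real (2 * n)))
    \<and> num_invariant_trees (sym_gen {refl_h, refl_v}) (odd_diamond n) = num_matchings (aztec_A (n - 1))
    \<and> real (num_matchings (aztec_A (n - 1))) =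
        1 / 2 ^ (n - 1) *
        (\<Prod>(j, k) \<in> {(j :: nat, k :: nat). 1 \<le> j \<and> j \<le> k \<and> k \<le> n - 1}.
           4 - 2 * cos (real j * pi / real n) - 2 * cos (real k * pi / real n))"
proof (intro conjI)
  show "num_invariant_trees (sym_gen {refl_h}) (odd_diamond n) = num_matchings (aztec_C (2 * n - 1))"
    by (simp only: num_invariant_trees_h num_matchings_C[OF assms])
  show "num_invariant_trees (sym_gen {refl_h, refl_v}) (odd_diamond n) = num_matchings (aztec_A (n - 1))"
    by (simp only: num_invariant_trees_hv num_matchings_A[OF assms])
  show "real (num_matchings (aztec_C (2 * n - 1))) =
      1 / 2 ^ (2 * n) *
      (\<Prod>(j, k) \<in> {(j :: nat, k :: nat). 1 \<le> j \<and> j \<le> k \<and> k \<le> 2 * n - 1 \<and> even (j + k)}.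
         4 - 2 * cos (real j * pi / real (2 * n)) - 2 * cos (real k * pi / real (2 * n)))"
    unfolding num_matchings_C[OF assms] using card_escaping_choices_half[OF assms, unfolded square_eigenvalue_def]
    by (simp add: field_simps)
  show "real (num_matchings (aztec_A (n - 1))) =
      1 / 2 ^ (n - 1) *
      (\<Prod>(j, k) \<in> {(j :: nat, k :: nat). 1 \<le> j \<and> j \<le> k \<and> k \<le> n - 1}.
         4 - 2 * cos (real j * pi / real n) - 2 * cos (real k * pi / real n))"
    unfolding num_matchings_A[OF assms] using card_escaping_choices_quadrant[OF assms, unfolded square_eigenvalue_def]
    by (simp add: field_simps)
qed

end
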